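(* Let $V\in C^{1,\gamma}(\mathbb{T}^d)$ and let $g:[0,\infty)\to\mathbb{R}\cup\{-\infty\}$ be strictly increasing with $g\in C^{1,\gamma}((0,\infty))$, satisfying the following: there exist $c_1,c_2>0$ and $\alpha>0$ with $c_1m^{\alpha-1}\le g'(m)\le c_2m^{\alpha-1}$ for all $m>0$, where $\alpha>0$ if $d\le4$, $\alpha>\frac{d-4}{d}$ if $4<d\le8$, and $\alpha>\frac{d-4}{2}$ if $d\ge8$. For $\epsilon>0$ let $(u^\epsilon,m^\epsilon)$ be a regular weak solution of the discounted problem $$\epsilon u^\epsilon+\tfrac12|Du^\epsilon|^2+V=g(m^\epsilon),\qquad \epsilon m^\epsilon-\operatorname{div}(m^\epsilon Du^\epsilon)=\epsilon\quad\text{in }\mathbb{T}^d .$$ Suppose that, as $\epsilon\to0$, $\langle u^\epsilon\rangle\rightharpoonup\bar u$ weakly in $H^1(\mathbb{T}^d)$ and $m^\epsilon\rightharpoonup\bar m$ weakly in $L^1(\mathbb{T}^d)$. Let $(u,m)$ (together with some $\overline H\in\mathbb{R}$) be a regular weak solution of the ergodic problem $$\tfrac12|Du|^2+V=g(m)+\overline H,\qquad -\operatorname{div}(mDu)=0\quad\text{in }\mathbb{T}^d,\qquad m\ge0,\ \int_{\mathbb{T}^d}m\,dx=1.$$ Then $$\int_{\mathbb{T}^d}(g(m^\epsilon)-g(m))(m^\epsilon-m)\,dx\to0$$ and $\bar m=m$. Moreover, $$\int_{\mathbb{T}^d}\langle\bar u\rangle\,m\,dx\le\int_{\mathbb{T}^d}\langle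 u\rangle\,m\,dx .$$
   Context: $\mathbb{T}^d$ is the $d$-dimensional flat torus identified with $[0,1]^d$, $\gamma\in(0,1)$ is a Hölder exponent (regularity of $g$ on $(0,\infty)$ understood locally), and $\langle f\rangle=f-\int_{\mathbb{T}^d}f\,dx$. Regular weak solutions. Fix a constant $C>0$ independent of $\epsilon$ (earlier work provides such a $C$ for which, when $g$ satisfies $c_1m^{\alpha-1}\le g'(m)\le c_2m^{\alpha-1}$ for all $m>0$ with constants $c_1,c_2>0$ and an exponent $\alpha>0$ such that $\alpha>\frac{d-4}{d}$ if $4<d\le8$ and $\alpha>\frac{d-4}{2}$ if $d\ge8$, regular weak solutions of the discounted problem exist for every $\epsilon>0$). A pair $(u^\epsilon,m^\epsilon)$ is a regular weak solution of the discounted problem if: (1) $m^\epsilon\ge0$ and $\int_{\mathbb{T}^d} m^\epsilon dx=1$; (2) $\|(m^\epsilon)^{\frac{\alpha+1}{2}}\|_{W^{1,2}(\mathbb{T}^d)}\le C$; (3) $\|u^\epsilon-\int_{\mathbb{T}^d} u^\epsilon dx\|_{W^{1,2}(\mathbb{T}^d)}\le C$; (4) $|\epsilon\int_{\mathbb{T}^d} u^\epsilon dx|\le C$; (5) $\|(m^\epsilon)^{\frac{\alpha+1}{2}}Du^\epsilon\|_{BV(\mathbb{T}^d)}\le C$; and moreover $-\epsilon u^\epsilon-\frac{|Du^\epsilon|^2}{2}-V+g(m^\epsilon)\ge0$ in the sense of distributions, $\big(-\epsilon u^\epsilon-\frac{|Du^\epsilon|^2}{2}-V+g(m^\epsilon)\big)m^\epsilon=0$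 almost everywhere, and $\epsilon m^\epsilon-\operatorname{div}(m^\epsilon Du^\epsilon)=\epsilon$ in the sense of distributions and almost everywhere. A triple $(u,m,\overline H)$, $\overline H\in\mathbb{R}$, is a regular weak solution of the ergodic problem if $(u,m)$ satisfies (1), (2), (3), (5) (with the same $C$, and $u,m$ in place of $u^\epsilon,m^\epsilon$), and $\overline H-\frac{|Du|^2}{2}-V+g(m)\ge0$ in the sense of distributions, $\big(\overline H-\frac{|Du|^2}{2}-V+g(m)\big)m=0$ almost everywhere, and $-\operatorname{div}(mDu)=0$ in the sense of distributions and almost everywhere. *)

theory Defs
  imports "HOL-Analysis.Analysis"
begin

section \<open>Functions on the flat torus\<close>

text \<open>
  The torus is \<open>[0,1]\<^sup>d\<close> with \<open>d = CARD('d)\<close> and opposite faces identified.  Continuous objects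
  (the potential, test functions) are \<open>\<int>\<^sup>d\<close>-periodic functions on \<open>\<real>\<^sup>d\<close>.  Measurable
  functions are represented by functions on \<open>\<real>\<^sup>d\<close> of which only the values on the unit
  cube, up to null sets, matter; they need not be periodic.  The periodic structure
  enters weak derivatives through the test functions.
\<close>

abbreviation torus :: "(real^'d) measure" where
  "torus \<equiv> lebesgue_on (cbox 0 One)"

definition periodic :: "(real^'d \<Rightarrow> real) \<Rightarrow> bool" where
  "periodic f \<longleftrightarrow> (\<forall>x i. f (x + axis i 1) = f x)"

definition grad :: "(real^'d \<Rightarrow> real) \<Rightarrow> real^'d \<Rightarrow> real^'d" where
  "grad f x = (\<chi> i. frechet_derivative f (at x) (axis i 1))"

primrec Ck :: "nat \<Rightarrow> (real^'d \<Rightarrow> real) \<Rightarrow> bool" where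
  "Ck 0 f \<longleftrightarrow> continuous_on UNIV f"
| "Ck (Suc k) f \<longleftrightarrow> (\<forall>x. f differentiable (at x)) \<and> (\<forall>i. Ck k (\<lambda>x. grad f x $ i))"

definition torus_Ck :: "nat \<Rightarrow> (real^'d \<Rightarrow> real) \<Rightarrow> bool" where
  "torus_Ck k f \<longleftrightarrow> periodic f \<and> Ck k f"

definition torus_test :: "(real^'d \<Rightarrow> real) \<Rightarrow> bool" where
  "torus_test f \<longleftrightarrow> (\<forall>k. torus_Ck k f)"

definition torus_C1_holder :: "real \<Rightarrow> (real^'d \<Rightarrow> real) \<Rightarrow> bool" where
  "torus_C1_holder \<gamma> f \<longleftrightarrow> torus_Ck 1 f \<and>
     (\<exists>L. \<forall>x y. norm (grad f x - grad f y) \<le> L * dist x y powr \<gamma>)"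

definition C1_holder_loc_pos :: "real \<Rightarrow> (real \<Rightarrow> real) \<Rightarrow> bool" where
  "C1_holder_loc_pos \<gamma> f \<longleftrightarrow> (\<forall>t>0. f differentiable (at t)) \<and>
     (\<forall>a b. 0 < a \<longrightarrow> (\<exists>L. \<forall>s\<in>{a..b}. \<forall>t\<in>{a..b}. \<bar>deriv f s - deriv f t\<bar> \<le> L * \<bar>s - t\<bar> powr \<gamma>))"

definition mean_free :: "(real^'d \<Rightarrow> real) \<Rightarrow> real^'d \<Rightarrow> real" where
  "mean_free f x = f x - (\<integral>y. f y \<partial>torus)"


section \<open>Weak derivatives, Sobolev and BV norms\<close>

definition has_weak_grad :: "(real^'d \<Rightarrow> real) \<Rightarrow> (real^'d \<Rightarrow> real^'d) \<Rightarrow> bool" where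
  "has_weak_grad f G \<longleftrightarrow> integrable torus f \<and> integrable torus G \<and>
     (\<forall>\<phi> i. torus_test \<phi> \<longrightarrow>
        (\<integral>x. f x * (grad \<phi> x $ i) \<partial>torus) = - (\<integral>x. (G x $ i) * \<phi> x \<partial>torus))"

text \<open>Weak gradients are unique up to null sets; \<open>weak_grad\<close> picks a representative.\<close>

definition weak_grad :: "(real^'d \<Rightarrow> real) \<Rightarrow> real^'d \<Rightarrow> real^'d" where
  "weak_grad f = (SOME G. has_weak_grad f G)"

definition torus_W12 :: "(real^'d \<Rightarrow> real) set" where
  "torus_W12 = {f. f \<in> borel_measurable torus \<and> integrable torus (\<lambda>x. (f x)\<^sup>2) \<and>
     (\<exists>G. has_weak_grad f G) \<and> integrable torus (\<lambda>x. (norm (weak_grad f x))\<^sup>2)}"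

definition W12_norm :: "(real^'d \<Rightarrow> real) \<Rightarrow> real" where
  "W12_norm f = sqrt ((\<integral>x. (f x)\<^sup>2 \<partial>torus) + (\<integral>x. (norm (weak_grad f x))\<^sup>2 \<partial>torus))"

definition torus_L1 :: "(real^'d \<Rightarrow> real) set" where
  "torus_L1 = {f. integrable torus f}"

definition L1_norm :: "(real^'d \<Rightarrow> real) \<Rightarrow> real" where
  "L1_norm f = (\<integral>x. \<bar>f x\<bar> \<partial>torus)"

text \<open>
  The norm on \<open>real^'d^'d\<close> is the Frobenius norm, so this is the usual total variation of
  the matrix-valued derivative of a vector field.
\<close>

definition torus_variation :: "(real^'d \<Rightarrow> real^'d) \<Rightarrow> ereal" where
  "torus_variation F =
     (SUP \<Phi> \<in> {\<Phi> :: real^'d \<Rightarrow> real^'d^'d.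
                 (\<forall>i j. torus_Ck 1 (\<lambda>x. \<Phi> x $ i $ j)) \<and> (\<forall>x. norm (\<Phi> x) \<le> 1)}.
        ereal (\<integral>x. (\<Sum>i\<in>UNIV. \<Sum>j\<in>UNIV. (F x $ i) * (grad (\<lambda>y. \<Phi> y $ i $ j) x $ j)) \<partial>torus))"

definition BV_norm :: "(real^'d \<Rightarrow> real^'d) \<Rightarrow> ereal" where
  "BV_norm F = ereal (\<integral>x. norm (F x) \<partial>torus) + torus_variation F"

definition has_weak_div :: "(real^'d \<Rightarrow> real^'d) \<Rightarrow> (real^'d \<Rightarrow> real) \<Rightarrow> bool" where
  "has_weak_div F w \<longleftrightarrow> integrable torus F \<and> integrable torus w \<and>
     (\<forall>\<phi>. torus_test \<phi> \<longrightarrow>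
        (\<integral>x. F x \<bullet> grad \<phi> x \<partial>torus) = - (\<integral>x. w x * \<phi> x \<partial>torus))"

text \<open>
  Nonnegativity in the sense of distributions of an extended-real function; it defines a
  distribution only if it is finite almost everywhere and integrable.
\<close>

definition nonneg_distr :: "(real^'d \<Rightarrow> ereal) \<Rightarrow> bool" where
  "nonneg_distr F \<longleftrightarrow>
     (AE x in torus. \<bar>F x\<bar> \<noteq> \<infinity>) \<and> integrable torus (\<lambda>x. real_of_ereal (F x)) \<and>
     (\<forall>\<phi>. torus_test \<phi> \<and> (\<forall>x. 0 \<le> \<phi> x) \<longrightarrow>
        0 \<le> (\<integral>x. real_of_ereal (F x) * \<phi> x \<partial>torus))"


section \<open>Weak convergence\<close>

text \<open>
  Function spaces are sets \<open>X\<close> of functions with a seminorm \<open>N\<close> that vanishes exactly on the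
  functions vanishing almost everywhere; a functional bounded by \<open>N\<close> therefore factors
  through the quotient.
\<close>

definition bounded_functional_on ::
  "('a \<Rightarrow> real) set \<Rightarrow> (('a \<Rightarrow> real) \<Rightarrow> real) \<Rightarrow> (('a \<Rightarrow> real) \<Rightarrow> real) \<Rightarrow> bool" where
  "bounded_functional_on X N \<Lambda> \<longleftrightarrow>
     (\<forall>f\<in>X. \<forall>h\<in>X. \<Lambda> (\<lambda>x. f x + h x) = \<Lambda> f + \<Lambda> h) \<and>
     (\<forall>c. \<forall>f\<in>X. \<Lambda> (\<lambda>x. c * f x) = c * \<Lambda> f) \<and>
     (\<exists>K. \<forall>f\<in>X. \<bar>\<Lambda> f\<bar> \<le> K * N f)"

definition weak_tendsto ::
  "('a \<Rightarrow> real) set \<Rightarrow> (('a \<Rightarrow> real) \<Rightarrow> real) \<Rightarrow>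
   ('e \<Rightarrow> 'a \<Rightarrow> real) \<Rightarrow> ('a \<Rightarrow> real) \<Rightarrow> 'e filter \<Rightarrow> bool" where
  "weak_tendsto X N f l F \<longleftrightarrow> (\<forall>\<^sub>F e in F. f e \<in> X) \<and> l \<in> X \<and>
     (\<forall>\<Lambda>. bounded_functional_on X N \<Lambda> \<longrightarrow> ((\<lambda>e. \<Lambda> (f e)) \<longlongrightarrow> \<Lambda> l) F)"


section \<open>Regular weak solutions\<close>

text \<open>The coupling \<open>g\<close> takes values in \<open>\<real> \<union> {-\<infinity>}\<close>; only its values on \<open>[0,\<infinity>)\<close> are relevant.\<close>

definition regular_bounds ::
  "real \<Rightarrow> real \<Rightarrow> (real^'d \<Rightarrow> real) \<Rightarrow> (real^'d \<Rightarrow> real) \<Rightarrow> bool" where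
  "regular_bounds \<alpha> C u m \<longleftrightarrow>
     integrable torus m \<and> (AE x in torus. 0 \<le> m x) \<and> (\<integral>x. m x \<partial>torus) = 1 \<and>
     (\<lambda>x. m x powr ((\<alpha> + 1) / 2)) \<in> torus_W12 \<and>
     W12_norm (\<lambda>x. m x powr ((\<alpha> + 1) / 2)) \<le> C \<and>
     integrable torus u \<and> mean_free u \<in> torus_W12 \<and> W12_norm (mean_free u) \<le> C \<and>
     integrable torus (\<lambda>x. m x powr ((\<alpha> + 1) / 2) *\<^sub>R weak_grad u x) \<and>
     BV_norm (\<lambda>x. m x powr ((\<alpha> + 1) / 2) *\<^sub>R weak_grad u x) \<le> ereal C"

definition discounted_residual ::
  "(real^'d \<Rightarrow> real) \<Rightarrow> (real \<Rightarrow> ereal) \<Rightarrow> real \<Rightarrow>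
   (real^'d \<Rightarrow> real) \<Rightarrow> (real^'d \<Rightarrow> real) \<Rightarrow> real^'d \<Rightarrow> ereal" where
  "discounted_residual V g \<epsilon> u m x =
     ereal (- \<epsilon> * u x - (norm (weak_grad u x))\<^sup>2 / 2 - V x) + g (m x)"

definition ergodic_residual ::
  "(real^'d \<Rightarrow> real) \<Rightarrow> (real \<Rightarrow> ereal) \<Rightarrow>
   (real^'d \<Rightarrow> real) \<Rightarrow> (real^'d \<Rightarrow> real) \<Rightarrow> real \<Rightarrow> real^'d \<Rightarrow> ereal" where
  "ergodic_residual V g u m H x =
     ereal (H - (norm (weak_grad u x))\<^sup>2 / 2 - V x) + g (m x)"

text \<open>
  The divergence equations are required in the sense of distributions and almost
  everywhere; the latter means that the distributional divergence of the flux is an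
  integrable function satisfying the equation at almost every point.
\<close>

definition regular_weak_discounted ::
  "real \<Rightarrow> real \<Rightarrow> (real^'d \<Rightarrow> real) \<Rightarrow> (real \<Rightarrow> ereal) \<Rightarrow> real \<Rightarrow>
   (real^'d \<Rightarrow> real) \<Rightarrow> (real^'d \<Rightarrow> real) \<Rightarrow> bool" where
  "regular_weak_discounted \<alpha> C V g \<epsilon> u m \<longleftrightarrow>
     regular_bounds \<alpha> C u m \<and>
     \<bar>\<epsilon> * (\<integral>x. u x \<partial>torus)\<bar> \<le> C \<and>
     nonneg_distr (discounted_residual V g \<epsilon> u m) \<and>
     (AE x in torus. discounted_residual V g \<epsilon> u m x * ereal (m x) = 0) \<and>
     integrable torus (\<lambda>x. m x *\<^sub>R weak_grad u x) \<and>
     (\<forall>\<phi>. torus_test \<phi> \<longrightarrow>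
        (\<integral>x. \<epsilon> * m x * \<phi> x + (m x *\<^sub>R weak_grad u x) \<bullet> grad \<phi> x \<partial>torus)
          = (\<integral>x. \<epsilon> * \<phi> x \<partial>torus)) \<and>
     (\<exists>w. has_weak_div (\<lambda>x. m x *\<^sub>R weak_grad u x) w \<and>
          (AE x in torus. \<epsilon> * m x - w x = \<epsilon>))"

definition regular_weak_ergodic ::
  "real \<Rightarrow> real \<Rightarrow> (real^'d \<Rightarrow> real) \<Rightarrow> (real \<Rightarrow> ereal) \<Rightarrow>
   (real^'d \<Rightarrow> real) \<Rightarrow> (real^'d \<Rightarrow> real) \<Rightarrow> real \<Rightarrow> bool" where
  "regular_weak_ergodic \<alpha> C V g u m H \<longleftrightarrow>
     regular_bounds \<alpha> C u m \<and>
     nonneg_distr (ergodic_residual V g u m H) \<and>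
     (AE x in torus. ergodic_residual V g u m H x * ereal (m x) = 0) \<and>
     integrable torus (\<lambda>x. m x *\<^sub>R weak_grad u x) \<and>
     (\<forall>\<phi>. torus_test \<phi> \<longrightarrow>
        (\<integral>x. (m x *\<^sub>R weak_grad u x) \<bullet> grad \<phi> x \<partial>torus) = 0) \<and>
     (\<exists>w. has_weak_div (\<lambda>x. m x *\<^sub>R weak_grad u x) w \<and>
          (AE x in torus. - w x = 0))"

text \<open>
  The integral of \<open>(g m\<^sub>1 - g m\<^sub>2) (m\<^sub>1 - m\<^sub>2)\<close> is taken as a nonnegative Lebesgue integral, so
  that it has its true value (possibly \<open>\<infinity>\<close>) without integrability assumptions.  Nothing is
  truncated by \<open>e2ennreal\<close>, by the following lemma; where \<open>m\<^sub>1 = m\<^sub>2\<close> the integrand is \<open>0\<close> even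
  if \<open>g m\<^sub>1 = -\<infinity>\<close>.
\<close>

definition coupling_integral ::
  "(real \<Rightarrow> ereal) \<Rightarrow> (real^'d \<Rightarrow> real) \<Rightarrow> (real^'d \<Rightarrow> real) \<Rightarrow> ennreal" where
  "coupling_integral g m1 m2 =
     (\<integral>\<^sup>+x. e2ennreal ((g (m1 x) - g (m2 x)) * ereal (m1 x - m2 x)) \<partial>torus)"

lemma coupling_integrand_nonneg:
  fixes g :: "real \<Rightarrow> ereal"
  assumes "strict_mono_on {0..} g" "0 \<le> s" "0 \<le> t"
  shows "0 \<le> (g s - g t) * ereal (s - t)"
proof (cases s t rule: linorder_cases)
  case less
  then have "g s < g t"
    using assms by (auto simp: strict_mono_on_def)
  then have "g s - g t \<le> 0"
    by (cases "g s"; cases "g t") auto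
  with less show ?thesis
    by (cases "g s - g t") (auto simp: zero_le_mult_iff mult_nonpos_nonpos)
next
  case equal
  then show ?thesis by simp
next
  case greater
  then have "g t < g s"
    using assms by (auto simp: strict_mono_on_def)
  then have "0 \<le> g s - g t"
    by (cases "g s"; cases "g t") auto
  with greater show ?thesis
    by simp
qed

end

theory Submission
  imports Defs
begin

text \<open>
  Write \<open>v = \<langle>u\<rangle>\<close> and \<open>s = 2 (\<alpha> + 1) / \<alpha>\<close>.  The inequality \<open>\<bar>Du\<bar>\<^sup>2 / 2 \<le> g(m) + \<dots>\<close>, valid almost everywhere, bounds
  \<open>\<bar>Du\<bar>\<^sup>2\<close> by a multiple of \<open>1 + \<bar>v\<bar> + m\<^sup>\<alpha>\<close>.  Since \<open>m\<close> is bounded in \<open>L\<close> of order \<open>\<alpha> + 1\<close>, iterating this bound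
  with the Poincare inequality doubles the integrability exponent of \<open>v\<close> until \<open>v\<close> and \<open>Du\<close> are in \<open>L\<close> of order \<open>s\<close>,
  uniformly in \<open>\<epsilon>\<close>; no Sobolev embedding is involved.  By Hoelder's inequality \<open>u\<^sub>\<epsilon> - u\<close> is then an admissible test
  function in both continuity equations (approximate it by convolution with trigonometric polynomials), and the
  monotonicity argument of Lasry and Lions gives
  \<open>0 \<le> \<integral>(g(m\<^sub>\<epsilon>) - g(m)) (m\<^sub>\<epsilon> - m) \<le> \<epsilon> (\<integral>v m\<^sub>\<epsilon> - \<integral>v\<^sub>\<epsilon> m)\<close>.
  The right-hand side is \<open>O(\<epsilon>)\<close>, which forces \<open>m\<^sub>\<epsilon>\<close> to converge to \<open>m\<close>; dividing by \<open>\<epsilon>\<close> and passing to the limit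
  gives the selection inequality.
\<close>

section \<open>Periodic functions on the torus\<close>

text \<open>The obstacle is that the densities are controlled only in L^(\<alpha>+1), while the
  monotonicity argument pairs the fluxes \<open>m Du\<close> with gradients of the solutions. The
  exponent s solves 1/(\<alpha>+1) + 2/s = 1: by Hoelder the flux lies in L^p with 1/p =
  1/(\<alpha>+1) + 1/s, and this p is exactly conjugate to s. The bootstrap stops at the same s,
  because m^\<alpha> is controlled up to order s/2. Mollification has to produce smooth periodic
  functions from data given only on the unit cube. Nonnegative trigonometric kernels achieve this:
  convolution with them is a finite Fourier sum, so smoothness and gradient are explicit. The last
  limit pairs weakly convergent functions with unbounded ones. The weak convergences are tested with
  bounded functions, and the uniform bounds extend them to the conjugate Lebesgue class.\<close>

lemma emeasure_torus [simp]: "emeasure (torus :: (real^'d) measure) (cbox 0 One) = 1"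
  by (simp add: emeasure_restrict_space emeasure_lborel_cbox_eq)

lemma finite_measure_torus: "finite_measure (torus :: (real^'d) measure)"
  by (rule finite_measure_lebesgue_on) simp

lemma measure_torus [simp]: "measure (torus :: (real^'d) measure) (cbox 0 One) = 1"
  by (simp add: measure_def)

lemma integrable_torus_const [simp]: "integrable (torus :: (real^'d) measure) (\<lambda>x. c::real)"
  using finite_measure.integrable_const[OF finite_measure_torus] .

lemma continuous_integrable_torus:
  fixes f :: "real^'d \<Rightarrow> 'b::euclidean_space"
  assumes "continuous_on UNIV f"
  shows "integrable torus f"
  using assms continuous_imp_integrable continuous_on_subset by blast

lemma continuous_measurable_torus:
  fixes f :: "real^'d \<Rightarrow> 'b::euclidean_space"
  assumes "continuous_on UNIV f"
  shows "f \<in> borel_measurable torus"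
  using continuous_integrable_torus[OF assms] by auto

lemma integral_torus_HK:
  fixes f :: "real^'d \<Rightarrow> real"
  assumes "continuous_on UNIV f"
  shows "(\<integral>x. f x \<partial>torus) = integral (cbox 0 One) f"
  by (rule lebesgue_integral_eq_integral[OF continuous_integrable_torus[OF assms]]) simp

lemma axis_diff: "axis i (a - b) = axis i a - (axis i b :: real^'d)"
  by (simp add: axis_def vec_eq_iff)

lemma axis_add: "axis i (a + b) = axis i a + (axis i b :: real^'d)"
  by (simp add: axis_def vec_eq_iff)

lemma periodic_axis_nat:
  assumes "periodic f"
  shows "f (x + axis i (of_nat n)) = f x"
proof (induction n)
  case 0
  have "axis i (real 0) = (0::real^'a)" by (simp add: axis_def vec_eq_iff)
  then show ?case by (simp only: add_0_right)
next
  case (Suc n)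
  have eq: "x + axis i (of_nat (Suc n)) = x + axis i (of_nat n) + axis i 1"
    unfolding of_nat_Suc axis_add by (simp only: add_ac)
  show ?case unfolding eq using Suc assms by (simp add: periodic_def)
qed

lemma periodic_axis_int:
  assumes "periodic f"
  shows "f (x + axis i (of_int n)) = f x"
proof (cases "n \<ge> 0")
  case True
  then show ?thesis using periodic_axis_nat[OF assms, of x i "nat n"] by simp
next
  case False
  then have "f (x + axis i (of_int n) + axis i (of_nat (nat (-n)))) = f (x + axis i (of_int n))"
    using periodic_axis_nat[OF assms] by blast
  moreover have "x + axis i (of_int n) + axis i (of_nat (nat (-n))) = x"
    using False by (simp add: axis_def vec_eq_iff)
  ultimately show ?thesis by simp
qed

lemma periodic_shift:
  assumes "periodic f"
  shows "periodic (\<lambda>x. f (x + a))"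
  unfolding periodic_def
proof (intro allI)
  fix x :: "real^'a" and i
  have eq: "x + axis i 1 + a = (x + a) + axis i 1" by simp
  show "f (x + axis i 1 + a) = f (x + a)" unfolding eq using assms by (simp add: periodic_def)
qed

lemma One_nth: "(One :: real^'d) $ i = 1"
  by (metis Cart_1 one_index)

text \<open>A shift along one axis by at most one period makes the cube stick out on one side only.
  Cutting at \<open>x $ i = 1\<close> leaves the slab \<open>M\<close> common to both cubes and a
  slab beyond it, which periodicity moves back onto the missing piece \<open>L\<close>.\<close>

lemma integral_torus_shift_axis_unit:
  fixes f :: "real^'d \<Rightarrow> real"
  assumes f: "continuous_on UNIV f" "periodic f" and t: "0 \<le> t" "t \<le> 1"
  shows "(\<integral>x. f (x + axis i t) \<partial>torus) = (\<integral>x. f x \<partial>torus)"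
proof -
  define k :: "real^'d" where "k = axis i 1"
  have k: "k \<in> Basis" by (simp add: k_def)
  have int: "f integrable_on cbox a b" for a b
    by (rule integrable_continuous) (rule continuous_on_subset[OF f(1)], simp)
  define B where "B p q = {x::real^'d. p \<le> x $ i \<and> x $ i \<le> q \<and> (\<forall>j. j \<noteq> i \<longrightarrow> 0 \<le> x $ j \<and> x $ j \<le> 1)}" for p q
  have B: "cbox (axis i p) (One + axis i q) = B p (1 + q)" for p q
  proof (intro set_eqI)
    fix x :: "real^'d"
    have "x \<in> cbox (axis i p) (One + axis i q) \<longleftrightarrow>
      (\<forall>j. (if j = i then p else 0) \<le> x $ j \<and> x $ j \<le> (if j = i then 1 + q else 1))"
      unfolding mem_box_cart vector_add_component One_nth axis_def vec_lambda_beta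
      by (intro all_cong1) auto
    also have "\<dots> \<longleftrightarrow> x \<in> B p (1 + q)" 
      unfolding B_def mem_Collect_eq
    proof (intro iffI conjI allI impI)
      assume *: "\<forall>j. (if j = i then p else 0) \<le> x $ j \<and> x $ j \<le> (if j = i then 1 + q else 1)"
      show "p \<le> x $ i" "x $ i \<le> 1 + q" using spec[OF *, of i] by simp_all
      fix j assume "j \<noteq> i"
      then show "0 \<le> x $ j" "x $ j \<le> 1" using spec[OF *, of j] by simp_all
    qed simp_all
    finally show "x \<in> cbox (axis i p) (One + axis i q) \<longleftrightarrow> x \<in> B p (1 + q)" .
  qed
  have axis0: "axis i 0 = (0::real^'d)" by (simp add: axis_def vec_eq_iff)
  have xk: "x \<bullet> k = x $ i" for x by (simp add: k_def inner_axis)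
  define M where "M = B t 1"
  have B01: "cbox 0 One = B 0 1" using B[of 0 0] by (simp add: axis0)
  have M1: "cbox 0 One \<inter> {x. t \<le> x \<bullet> k} = M"
    using t by (auto simp: M_def B01 xk B_def)
  have M2: "cbox (axis i t) (One + axis i t) \<inter> {x. x \<bullet> k \<le> 1} = M"
    using t by (auto simp: M_def B xk B_def)
  \<comment> \<open>The offset \<open>t - 1\<close> of the upper corner makes this the slab 0 \<le>
    x_i \<le> t, one period below the box in \<open>L2\<close>.\<close>
  define L where "L = cbox (axis i 0) (One + axis i (t - 1))"
  have L1: "cbox 0 One \<inter> {x. x \<bullet> k \<le> t} = L"
    using t by (auto simp: L_def B01 B xk B_def)
  have L2: "cbox (axis i t) (One + axis i t) \<inter> {x. 1 \<le> x \<bullet> k} = cbox (axis i 1) (One + axis i t)"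
    using t by (auto simp: B xk B_def)
  have "integral (cbox 0 One) (\<lambda>x. f (x + axis i t)) = integral (cbox (axis i t) (One + axis i t)) f"
    using integral_shift_cbox[of "axis i t" "axis i t" "One + axis i t" f] by simp
  also have "\<dots> = integral M f + integral (cbox (axis i 1) (One + axis i t)) f"
    using integral_split[OF int k, of "axis i t" "One + axis i t" 1] by (simp add: M2 L2)
  also have "integral (cbox (axis i 1) (One + axis i t)) f = integral L (\<lambda>x. f (x + axis i 1))"
    using integral_shift_cbox[of "axis i 1" "axis i 1" "One + axis i t" f]
    by (simp add: L_def axis_diff axis0 add_diff_eq)
  also have "\<dots> = integral L f"
    using f(2) by (simp add: periodic_def)
  also have "integral M f + integral L f = integral (cbox 0 One) f"
    using integral_split[OF int k, of 0 One t] by (simp add: M1 L1)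
  finally have *: "integral (cbox 0 One) (\<lambda>x. f (x + axis i t)) = integral (cbox 0 One) f" .
  have "continuous_on UNIV (\<lambda>x. f (x + axis i t))"
    by (intro continuous_on_compose2[OF f(1)] continuous_intros) auto
  then show ?thesis using * f(1) by (simp add: integral_torus_HK)
qed

lemma integral_torus_shift_axis:
  fixes f :: "real^'d \<Rightarrow> real"
  assumes f: "continuous_on UNIV f" "periodic f"
  shows "(\<integral>x. f (x + axis i t) \<partial>torus) = (\<integral>x. f x \<partial>torus)"
proof -
  have "f (x + axis i t) = f (x + axis i (frac t))" for x
  proof -
    have eq: "x + axis i t = x + axis i (frac t) + axis i (of_int \<lfloor>t\<rfloor>)"
      by (simp add: frac_def axis_def vec_eq_iff)
    show ?thesis unfolding eq by (rule periodic_axis_int[OF f(2)])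
  qed
  then show ?thesis
    using integral_torus_shift_axis_unit[OF f, of "frac t" i] frac_lt_1[of t] by simp
qed

lemma integral_torus_shift:
  fixes f :: "real^'d \<Rightarrow> real"
  assumes f: "continuous_on UNIV f" "periodic f"
  shows "(\<integral>x. f (x + a) \<partial>torus) = (\<integral>x. f x \<partial>torus)"
proof -
  have "(\<integral>x. f (x + (\<Sum>i\<in>S. axis i (a $ i))) \<partial>torus) = (\<integral>x. f x \<partial>torus)" if "finite S" for S
    using that
  proof (induction S)
    case (insert j S)
    let ?b = "\<Sum>i\<in>S. axis i (a $ i)"
    have "continuous_on UNIV (\<lambda>x. f (x + ?b))"
      by (intro continuous_on_compose2[OF f(1)] continuous_intros) auto
    from integral_torus_shift_axis[OF this periodic_shift[OF f(2)], of j "a $ j"] insert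
    show ?case by (simp add: add_ac)
  qed simp
  from this[of UNIV] have "(\<integral>x. f (x + (\<Sum>i\<in>UNIV. axis i (a $ i))) \<partial>torus) = (\<integral>x. f x \<partial>torus)"
    by simp
  moreover have "(\<Sum>i\<in>UNIV. axis i (a $ i)) = a"
    by (simp add: vec_eq_iff axis_def)
  ultimately show ?thesis by simp
qed

section \<open>Trigonometric polynomials\<close>

text \<open>Free phases replace separate sines: differentiation shifts the phase by pi/2 and
  products lead to sums and differences of frequencies, so the closure properties stay within one
  kind of generator. Integer frequencies make these functions periodic, hence test
  functions.\<close>

inductive trig :: "(real^'d \<Rightarrow> real) \<Rightarrow> bool" where
  cos: "(\<And>i. k $ i \<in> \<int>) \<Longrightarrow> trig (\<lambda>x. cos (2 * pi * (k \<bullet> x) + \<theta>))"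
| add: "trig f \<Longrightarrow> trig h \<Longrightarrow> trig (\<lambda>x. f x + h x)"
| scale: "trig f \<Longrightarrow> trig (\<lambda>x. c * f x)"

lemma grad_eqI:
  assumes "(f has_derivative D) (at x)"
  shows "grad f x = (\<chi> i. D (axis i 1))"
  unfolding grad_def using frechet_derivative_at[OF assms] by simp

lemma has_derivative_grad:
  assumes "f differentiable (at x)"
  shows "(f has_derivative (\<lambda>h. grad f x \<bullet> h)) (at x)"
proof -
  have D: "(f has_derivative frechet_derivative f (at x)) (at x)"
    using assms frechet_derivative_works by blast
  have "frechet_derivative f (at x) h = grad f x \<bullet> h" for h
  proof -
    have "frechet_derivative f (at x) (\<Sum>i\<in>UNIV. (h $ i) *\<^sub>R axis i 1) =
          (\<Sum>i\<in>UNIV. (h $ i) *\<^sub>R frechet_derivative f (at x) (axis i 1))"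
      using has_derivative_linear[OF D] by (simp add: linear_sum linear_scale)
    moreover have "(\<Sum>i\<in>UNIV. (h $ i) *\<^sub>R axis i 1) = h"
      by (simp add: vec_eq_iff axis_def if_distrib[of "\<lambda>t. _ * t"] cong: if_cong)
    ultimately show ?thesis by (simp add: grad_def inner_vec_def mult.commute)
  qed
  then have "frechet_derivative f (at x) = (\<lambda>h. grad f x \<bullet> h)" by auto
  with D show ?thesis by simp
qed

lemma grad_cos:
  fixes k :: "real^'d"
  shows "(\<lambda>x. cos (2 * pi * (k \<bullet> x) + \<theta>)) differentiable (at x)"
    and "grad (\<lambda>x. cos (2 * pi * (k \<bullet> x) + \<theta>)) x $ i
           = (2 * pi * k $ i) * cos (2 * pi * (k \<bullet> x) + (\<theta> + pi/2))"
proof -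
  have D: "((\<lambda>x. cos (2 * pi * (k \<bullet> x) + \<theta>)) has_derivative
      (\<lambda>h. - sin (2 * pi * (k \<bullet> x) + \<theta>) * (2 * pi * (k \<bullet> h)))) (at x)"
    by (auto intro!: derivative_eq_intros simp: algebra_simps)
  then show "(\<lambda>x. cos (2 * pi * (k \<bullet> x) + \<theta>)) differentiable (at x)"
    unfolding differentiable_def by blast
  have "cos (2 * pi * (k \<bullet> x) + (\<theta> + pi/2)) = - sin (2 * pi * (k \<bullet> x) + \<theta>)"
    by (simp add: minus_sin_cos_eq add_ac)
  then show "grad (\<lambda>x. cos (2 * pi * (k \<bullet> x) + \<theta>)) x $ i
           = (2 * pi * k $ i) * cos (2 * pi * (k \<bullet> x) + (\<theta> + pi/2))"
    by (simp add: grad_eqI[OF D] inner_axis)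
qed

lemma grad_add:
  assumes "f differentiable (at x)" "h differentiable (at x)"
  shows "grad (\<lambda>x. f x + h x) x = grad f x + grad h x"
proof -
  have "((\<lambda>x. f x + h x) has_derivative (\<lambda>v. grad f x \<bullet> v + grad h x \<bullet> v)) (at x)"
    using has_derivative_grad[OF assms(1)] has_derivative_grad[OF assms(2)] by (rule has_derivative_add)
  from grad_eqI[OF this] show ?thesis by (simp add: vec_eq_iff inner_axis)
qed

lemma grad_cmult:
  assumes "f differentiable (at x)"
  shows "grad (\<lambda>x. c * f x) x = c *\<^sub>R grad f x"
proof -
  have "((\<lambda>x. c * f x) has_derivative (\<lambda>v. c * (grad f x \<bullet> v))) (at x)"
    using has_derivative_grad[OF assms(1)] by (rule has_derivative_mult_right)
  from grad_eqI[OF this] show ?thesis by (simp add: vec_eq_iff inner_axis)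
qed

lemma trig_differentiable: "trig f \<Longrightarrow> f differentiable (at x)"
  by (induction rule: trig.induct) (auto intro: grad_cos(1))

lemma trig_continuous: "trig f \<Longrightarrow> continuous_on UNIV f"
  by (induction rule: trig.induct) (auto intro!: continuous_intros)

lemma trig_grad: "trig f \<Longrightarrow> trig (\<lambda>x. grad f x $ i)"
proof (induction rule: trig.induct)
  case (cos k \<theta>)
  then show ?case unfolding grad_cos(2) by (intro trig.scale trig.cos)
next
  case (add f h)
  then show ?case by (simp add: grad_add trig_differentiable trig.add)
next
  case (scale f c)
  then show ?case by (simp add: grad_cmult trig_differentiable trig.scale)
qed

lemma trig_Ck: "trig f \<Longrightarrow> Ck n f"
  by (induction n arbitrary: f) (auto simp: trig_continuous trig_differentiable trig_grad)

lemma trig_periodic: "trig f \<Longrightarrow> periodic f"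
proof (induction rule: trig.induct)
  case (cos k \<theta>)
  show ?case unfolding periodic_def
  proof (intro allI)
    fix x :: "real^'a" and i
    obtain n where n: "k $ i = of_int n" using cos[of i] by (auto elim: Ints_cases)
    have "2 * pi * (k \<bullet> (x + axis i 1)) + \<theta> = (2 * pi * (k \<bullet> x) + \<theta>) + 2 * pi * of_int n"
      by (simp add: inner_axis n algebra_simps)
    then show "cos (2 * pi * (k \<bullet> (x + axis i 1)) + \<theta>) = cos (2 * pi * (k \<bullet> x) + \<theta>)"
      by (simp only: cos_add[of _ "2 * pi * of_int n"] cos_int_2pin sin_int_2pin)
  qed
qed (auto simp: periodic_def)

lemma trig_test: "trig f \<Longrightarrow> torus_test f"
  by (simp add: torus_test_def torus_Ck_def trig_Ck trig_periodic)

lemma trig_const: "trig (\<lambda>x. c)"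
  using trig.scale[OF trig.cos[of 0 0], of c] by simp

text \<open>Product-to-sum formula for cosines, with frequencies k + l and k - l. Closure under
  products makes the powers of \<open>kap\<close> below available as kernels.\<close>

lemma trig_mult: "trig f \<Longrightarrow> trig h \<Longrightarrow> trig (\<lambda>x. f x * h x)"
proof (induction rule: trig.induct)
  case (cos k \<theta>)
  note k = cos(1)
  show ?case using cos(2)
  proof (induction rule: trig.induct)
    case (cos l \<eta>)
    have cc: "cos a * cos b = 1/2 * cos (a + b) + 1/2 * cos (a - b)" for a b :: real
      by (simp add: cos_add cos_diff field_simps)
    have eq: "cos (2 * pi * (k \<bullet> x) + \<theta>) * cos (2 * pi * (l \<bullet> x) + \<eta>) =
      1/2 * cos (2 * pi * ((k + l) \<bullet> x) + (\<theta> + \<eta>)) + 1/2 * cos (2 * pi * ((k - l) \<bullet> x) + (\<theta> - \<eta>))" for x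
      unfolding cc by (simp add: algebra_simps)
    show ?case unfolding eq using k cos by (intro trig.add trig.scale trig.cos) auto
  next
    case (add f h)
    then show ?case by (simp add: distrib_left trig.add)
  next
    case (scale f c)
    then show ?case by (simp add: mult.left_commute trig.scale)
  qed
next
  case (add f h)
  then show ?case by (simp add: distrib_right trig.add)
next
  case (scale f c)
  then show ?case by (simp add: mult.assoc trig.scale)
qed

lemma trig_power: "trig f \<Longrightarrow> trig (\<lambda>x. f x ^ n)"
  by (induction n) (auto simp: trig_const trig_mult)

lemma trig_prod: "finite S \<Longrightarrow> (\<And>i. i \<in> S \<Longrightarrow> trig (f i)) \<Longrightarrow> trig (\<lambda>x. \<Prod>i\<in>S. f i x)"
  by (induction S rule: finite_induct) (auto simp: trig_const trig_mult)

text \<open>Reflection negates the frequency and moves x into the phase. It makes K(x - y), as a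
  function of y, an admissible test function for weak gradients.\<close>

lemma trig_diff_right: "trig f \<Longrightarrow> trig (\<lambda>y. f (x - y))"
proof (induction rule: trig.induct)
  case (cos k \<theta>)
  have "2 * pi * (k \<bullet> (x - y)) + \<theta> = 2 * pi * ((- k) \<bullet> y) + (2 * pi * (k \<bullet> x) + \<theta>)" for y
    by (simp add: algebra_simps)
  then show ?case using cos by (simp only:) (intro trig.cos, auto)
qed (auto intro: trig.intros)

lemma grad_diff_right:
  assumes "f differentiable (at (x - y))"
  shows "grad (\<lambda>y. f (x - y)) y = - grad f (x - y)"
proof -
  have "((\<lambda>y. f (x - y)) has_derivative (\<lambda>v. grad f (x - y) \<bullet> (0 - v))) (at y)"
    by (rule has_derivative_compose[where f = "\<lambda>y. x - y" and g = f, OF _ has_derivative_grad[OF assms]])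
      (auto intro!: derivative_eq_intros)
  from grad_eqI[OF this] show ?thesis by (simp add: vec_eq_iff inner_axis)
qed

section \<open>Convolution with trigonometric polynomials\<close>

lemma continuous_bdd_torus:
  fixes f :: "real^'d \<Rightarrow> real"
  assumes "continuous_on UNIV f"
  shows "\<exists>B\<ge>0. \<forall>x\<in>cbox 0 One. \<bar>f x\<bar> \<le> B"
proof -
  have "compact (f ` cbox 0 One)"
    by (rule compact_continuous_image[OF continuous_on_subset[OF assms]]) auto
  then obtain B where "\<forall>y\<in>f ` cbox 0 One. norm y \<le> B"
    using compact_imp_bounded bounded_iff by blast
  then show ?thesis by (intro exI[of _ "max B 0"]) fastforce
qed

lemma integrable_bounded_mult_torus:
  fixes f h :: "real^'d \<Rightarrow> real"
  assumes f: "integrable torus f" and h: "h \<in> borel_measurable torus"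
    and B: "\<And>x. x \<in> cbox 0 One \<Longrightarrow> \<bar>h x\<bar> \<le> B"
  shows "integrable torus (\<lambda>x. f x * h x)"
proof (rule Bochner_Integration.integrable_bound)
  show "integrable torus (\<lambda>x. B * f x)" using f by simp
  show "(\<lambda>x. f x * h x) \<in> borel_measurable torus" using f h by simp
  show "AE x in torus. norm (f x * h x) \<le> norm (B * f x)"
  proof (rule AE_I2)
    fix x :: "real^'d" assume "x \<in> space torus"
    then have "\<bar>h x\<bar> \<le> B" using B by simp
    moreover then have "0 \<le> B" by linarith
    ultimately have "\<bar>f x\<bar> * \<bar>h x\<bar> \<le> \<bar>f x\<bar> * B" by (intro mult_left_mono) auto
    then show "norm (f x * h x) \<le> norm (B * f x)" using \<open>0 \<le> B\<close> by (simp add: abs_mult mult.commute)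
  qed
qed

lemma integrable_cont_mult_torus:
  fixes f h :: "real^'d \<Rightarrow> real"
  assumes "integrable torus f" "continuous_on UNIV h"
  shows "integrable torus (\<lambda>x. f x * h x)"
  using continuous_bdd_torus[OF assms(2)] integrable_bounded_mult_torus[OF assms(1) continuous_measurable_torus[OF assms(2)]]
  by blast

text \<open>Only the values of f on the unit cube enter, so no periodic extension of f is required;
  periodicity in x comes from K.\<close>

definition conv :: "(real^'d \<Rightarrow> real) \<Rightarrow> (real^'d \<Rightarrow> real) \<Rightarrow> real^'d \<Rightarrow> real" where
  "conv f K x = (\<integral>y. f y * K (x - y) \<partial>torus)"

lemma integrable_conv_trig:
  assumes "integrable torus f" "trig K"
  shows "integrable torus (\<lambda>y. f y * K (x - y))"
  by (rule integrable_cont_mult_torus[OF assms(1) trig_continuous[OF trig_diff_right[OF assms(2)]]])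

lemma conv_cmult: "conv f (\<lambda>x. c * K x) x = c * conv f K x"
  unfolding conv_def by (simp only: mult.left_commute[of _ c] integral_mult_right_zero)

text \<open>The addition formulas separate x from y, so convolving f with one cosine gives two
  phases of that cosine with constant coefficients. The gradient formula becomes an identity between
  finite sums, without differentiation under the integral sign.\<close>

lemma trig_conv:
  assumes f: "integrable torus f" and "trig K"
  shows "trig (conv f K) \<and> (\<forall>x i. grad (conv f K) x $ i = conv f (\<lambda>z. grad K z $ i) x)"
  using assms(2)
proof (induction rule: trig.induct)
  case (cos k \<theta>)
  \<comment> \<open>Fourier coefficients of f at frequency k: the phases used below differ by pi/2,
    which gives a cosine and a sine coefficient.\<close>
  define a where "a \<theta> = (\<integral>y. f y * cos (2 * pi * (k \<bullet> y) - \<theta>) \<partial>torus)" for \<theta>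
  \<comment> \<open>The summand \<open>+ 0\<close> keeps both terms in the shape required by
    \<open>trig.cos\<close> and \<open>grad_cos\<close>.\<close>
  have c: "conv f (\<lambda>x. cos (2 * pi * (k \<bullet> x) + \<theta>)) x =
      a \<theta> * cos (2 * pi * (k \<bullet> x) + 0) + a (\<theta> - pi/2) * cos (2 * pi * (k \<bullet> x) + pi / 2)" for \<theta> x
  proof -
    have eq: "f y * cos (2 * pi * (k \<bullet> (x - y)) + \<theta>) = 
       cos (2 * pi * (k \<bullet> x) + 0) * (f y * cos (2 * pi * (k \<bullet> y) - \<theta>)) +
       cos (2 * pi * (k \<bullet> x) + pi/2) * (f y * cos (2 * pi * (k \<bullet> y) - (\<theta> - pi/2)))" for y
    proof -
      have 1: "2 * pi * (k \<bullet> (x - y)) + \<theta> = 2 * pi * (k \<bullet> x) - (2 * pi * (k \<bullet> y) - \<theta>)"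
        by (simp add: algebra_simps)
      have 2: "2 * pi * (k \<bullet> y) - (\<theta> - pi/2) = (2 * pi * (k \<bullet> y) - \<theta>) + pi/2" by simp
      have cc: "c * cos (a - b) = cos (a + 0) * (c * cos b) + cos (a + pi/2) * (c * cos (b + pi/2))" for a b c :: real
        by (simp add: cos_diff cos_add algebra_simps)
      show ?thesis unfolding 1 2 by (rule cc)
    qed
    have i: "integrable torus (\<lambda>y. f y * cos (2 * pi * (k \<bullet> y) - \<theta>))" for \<theta>
      by (rule integrable_cont_mult_torus[OF f]) (intro continuous_intros)
    show ?thesis unfolding conv_def eq a_def
      by (subst Bochner_Integration.integral_add) (use i in \<open>auto simp: mult.commute\<close>)
  qed
  have t: "trig (conv f (\<lambda>x. cos (2 * pi * (k \<bullet> x) + \<theta>)))"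
    using cos unfolding c by (intro trig.add trig.scale trig.cos) auto
  have "grad (conv f (\<lambda>x. cos (2 * pi * (k \<bullet> x) + \<theta>))) x $ i = conv f (\<lambda>z. grad (\<lambda>x. cos (2 * pi * (k \<bullet> x) + \<theta>)) z $ i) x" for x i
  proof -
    have "conv f (\<lambda>z. grad (\<lambda>x. cos (2 * pi * (k \<bullet> x) + \<theta>)) z $ i) x
      = (2 * pi * k $ i) * conv f (\<lambda>z. cos (2 * pi * (k \<bullet> z) + (\<theta> + pi/2))) x"
      unfolding grad_cos(2) by (rule conv_cmult)
    moreover have "a (\<theta> + pi/2) = - a (\<theta> - pi/2)"
    proof -
      have "cos (t - (\<theta> + pi/2)) = - cos (t - (\<theta> - pi/2))" for t
        by (simp add: cos_diff cos_add sin_diff sin_add)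
      then show ?thesis unfolding a_def by simp
    qed
    moreover have "grad (conv f (\<lambda>x. cos (2 * pi * (k \<bullet> x) + \<theta>))) x $ i =
      a \<theta> * ((2 * pi * k $ i) * cos (2 * pi * (k \<bullet> x) + (0 + pi/2))) +
      a (\<theta> - pi/2) * ((2 * pi * k $ i) * cos (2 * pi * (k \<bullet> x) + (pi/2 + pi/2)))"
    proof -
      have e: "conv f (\<lambda>x. cos (2 * pi * (k \<bullet> x) + \<theta>)) = (\<lambda>x. 
        a \<theta> * cos (2 * pi * (k \<bullet> x) + 0) + a (\<theta> - pi/2) * cos (2 * pi * (k \<bullet> x) + pi / 2))"
        by (rule ext) (rule c)
      show ?thesis unfolding e
        by (subst grad_add) (simp_all only: grad_cmult grad_cos differentiable_cmult_left_iff vector_add_component vector_scaleR_component real_scaleR_def, auto intro!: derivative_intros grad_cos(1))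
    qed
    moreover have "cos (2 * pi * (k \<bullet> x) + (pi/2 + pi/2)) = - cos (2 * pi * (k \<bullet> x) + 0)"
      by simp
    moreover have "conv f (\<lambda>z. cos (2 * pi * (k \<bullet> z) + (\<theta> + pi/2))) x =
      a (\<theta> + pi/2) * cos (2 * pi * (k \<bullet> x) + 0) + a \<theta> * cos (2 * pi * (k \<bullet> x) + (0 + pi/2))"
      using c[of "\<theta> + pi/2" x] by simp
    ultimately show ?thesis by (simp only:) (simp add: algebra_simps)
  qed
  with t show ?case by blast
next
  case (add K L)
  have e: "conv f (\<lambda>x. K x + L x) = (\<lambda>x. conv f K x + conv f L x)" if "trig K" "trig L" for K L
    unfolding conv_def distrib_left using that f
    by (intro ext Bochner_Integration.integral_add integrable_conv_trig)
  have "grad (\<lambda>x. conv f K x + conv f L x) x $ i = conv f (\<lambda>z. grad (\<lambda>x. K x + L x) z $ i) x" for x i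
    using add by (simp add: grad_add trig_differentiable e trig_grad)
  with add show ?case by (simp add: e trig.add)
next
  case (scale K c)
  have e: "conv f (\<lambda>x. c * K x) = (\<lambda>x. c * conv f K x)" for K
    by (intro ext conv_cmult)
  have "grad (\<lambda>x. c * conv f K x) x $ i = conv f (\<lambda>z. grad (\<lambda>x. c * K x) z $ i) x" for x i
    using scale by (simp add: grad_cmult trig_differentiable e)
  with scale show ?case by (simp add: e trig.scale)
qed

text \<open>The definition of the weak gradient is applied to K(x - y) as a test function of y; the
  sign from differentiating in y cancels the sign of integration by parts.\<close>

lemma grad_conv_weak:
  assumes w: "has_weak_grad f G" and K: "trig K"
  shows "grad (conv f K) x $ i = conv (\<lambda>y. G y $ i) K x"
proof -
  have f: "integrable torus f" using w by (simp add: has_weak_grad_def)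
  have "grad (conv f K) x $ i = (\<integral>y. f y * grad K (x - y) $ i \<partial>torus)"
    using trig_conv[OF f K] by (simp add: conv_def)
  also have "\<dots> = - (\<integral>y. f y * grad (\<lambda>y. K (x - y)) y $ i \<partial>torus)"
    by (simp add: grad_diff_right trig_differentiable[OF K])
  also have "\<dots> = (\<integral>y. G y $ i * K (x - y) \<partial>torus)"
    using w trig_test[OF trig_diff_right[OF K]] by (simp add: has_weak_grad_def)
  finally show ?thesis by (simp add: conv_def)
qed

section \<open>Integrability of order \<open>r\<close> and mollification\<close>

text \<open>Young's inequality for t and a^(r-1), with conjugate exponents r and r/(r-1), is the
  tangent inequality of the convex function t^r at a.\<close>

lemma powr_tangent_le:
  fixes a t r :: real
  assumes "0 < a" "0 \<le> t" "1 \<le> r"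
  shows "a powr r + r * a powr (r - 1) * (t - a) \<le> t powr r"
proof (cases "r = 1")
  case True
  then show ?thesis using assms by simp
next
  case False
  then have r: "1 < r" using assms by simp
  define q where "q = r / (r - 1)"
  have "t * a powr (r - 1) \<le> t powr r / r + (a powr (r - 1)) powr q / q"
    by (rule Youngs_inequality) (use r assms in \<open>auto simp: q_def field_simps\<close>)
  moreover have "(a powr (r - 1)) powr q = a powr r"
    using r by (simp add: powr_powr q_def)
  ultimately have "t * a powr (r - 1) \<le> t powr r / r + a powr r * (r - 1) / r"
    using r by (simp add: q_def)
  then have "r * (t * a powr (r - 1)) \<le> t powr r + a powr r * (r - 1)"
    using r by (simp add: field_simps)
  moreover have "a * a powr (r - 1) = a powr r"
    using assms by (simp add: powr_diff)
  ultimately show ?thesis by (simp add: algebra_simps)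
qed

text \<open>The tangent inequality is integrated with base point the K-mean \<open>a\<close> of |f|,
  where the linear term drops out because K has mass 1. The density K will be either a kernel or the
  constant 1.\<close>

lemma jensen_powr:
  fixes f K :: "'a \<Rightarrow> real"
  assumes r: "1 \<le> r" and K: "\<And>x. 0 \<le> K x" "integrable M K" "integral\<^sup>L M K = 1"
    and f: "integrable M (\<lambda>x. f x * K x)" "integrable M (\<lambda>x. \<bar>f x\<bar> powr r * K x)"
  shows "\<bar>\<integral>x. f x * K x \<partial>M\<bar> powr r \<le> (\<integral>x. \<bar>f x\<bar> powr r * K x \<partial>M)"
proof -
  define a where "a = (\<integral>x. \<bar>f x\<bar> * K x \<partial>M)"
  have int: "integrable M (\<lambda>x. \<bar>f x\<bar> * K x)"
    using integrable_abs[OF f(1)] K(1) by (simp add: abs_mult)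
  have le: "\<bar>\<integral>x. f x * K x \<partial>M\<bar> \<le> a"
    using integral_abs_bound[of M "\<lambda>x. f x * K x"] K(1) by (simp add: abs_mult a_def)
  have nn: "0 \<le> (\<integral>x. \<bar>f x\<bar> powr r * K x \<partial>M)"
    by (intro Bochner_Integration.integral_nonneg) (simp add: K)
  show ?thesis
  proof (cases "a = 0")
    case True
    then show ?thesis using le nn by simp
  next
    case False
    then have a: "0 < a" using le by linarith
    have "(\<integral>x. (a powr r - r * a powr (r - 1) * a) * K x + r * a powr (r - 1) * (\<bar>f x\<bar> * K x) \<partial>M)
        \<le> (\<integral>x. \<bar>f x\<bar> powr r * K x \<partial>M)"
    proof (rule integral_mono)
      fix x
      have "(a powr r + r * a powr (r - 1) * (\<bar>f x\<bar> - a)) * K x \<le> \<bar>f x\<bar> powr r * K x"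
        by (intro mult_right_mono powr_tangent_le a r K) simp
      then show "(a powr r - r * a powr (r - 1) * a) * K x + r * a powr (r - 1) * (\<bar>f x\<bar> * K x)
          \<le> \<bar>f x\<bar> powr r * K x" by (simp add: algebra_simps)
    qed (use K int f in auto)
    then have "a powr r \<le> (\<integral>x. \<bar>f x\<bar> powr r * K x \<partial>M)"
      using K int by (simp add: a_def[symmetric])
    moreover have "\<bar>\<integral>x. f x * K x \<partial>M\<bar> powr r \<le> a powr r"
      using le r by (intro powr_mono2) auto
    ultimately show ?thesis by linarith
  qed
qed

text \<open>Bounding the sum by twice the larger term costs 2^r but works for every r \<ge> 0, also
  where t^r is not convex.\<close>

lemma abs_add_powr_le:
  fixes a b :: real
  assumes "0 \<le> r"
  shows "\<bar>a + b\<bar> powr r \<le> 2 powr r * (\<bar>a\<bar> powr r + \<bar>b\<bar> powr r)"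
proof -
  have "\<bar>a + b\<bar> powr r \<le> (2 * max \<bar>a\<bar> \<bar>b\<bar>) powr r"
    using assms by (intro powr_mono2) auto
  also have "\<dots> = 2 powr r * max \<bar>a\<bar> \<bar>b\<bar> powr r" by (rule powr_mult)
  also have "\<dots> \<le> 2 powr r * (\<bar>a\<bar> powr r + \<bar>b\<bar> powr r)"
    by (intro mult_left_mono) (auto simp: max_def)
  finally show ?thesis .
qed

definition Lp :: "real \<Rightarrow> (real^'d \<Rightarrow> real) \<Rightarrow> bool" where
  "Lp r f \<longleftrightarrow> f \<in> borel_measurable torus \<and> integrable torus (\<lambda>x. \<bar>f x\<bar> powr r)"

lemma LpD: "Lp r f \<Longrightarrow> f \<in> borel_measurable torus" "Lp r f \<Longrightarrow> integrable torus (\<lambda>x. \<bar>f x\<bar> powr r)"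
  by (auto simp: Lp_def)

lemma Lp_bound:
  assumes f: "f \<in> borel_measurable torus" and h: "integrable torus h"
    and "AE x in torus. \<bar>f x\<bar> powr r \<le> h x"
  shows "Lp r f"
  unfolding Lp_def
proof
  show "integrable torus (\<lambda>x. \<bar>f x\<bar> powr r)"
    by (rule Bochner_Integration.integrable_bound[OF h]) (use assms in \<open>auto elim!: eventually_mono\<close>)
qed (rule f)

lemma Lp_add:
  assumes "0 \<le> r" "Lp r f" "Lp r g"
  shows "Lp r (\<lambda>x. f x + g x)"
proof (rule Lp_bound)
  show "integrable torus (\<lambda>x. 2 powr r * (\<bar>f x\<bar> powr r + \<bar>g x\<bar> powr r))"
    using assms by (auto simp: Lp_def)
qed (use assms in \<open>auto simp: Lp_def abs_add_powr_le\<close>)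

lemma Lp_cmult:
  assumes "Lp r f"
  shows "Lp r (\<lambda>x. c * f x)"
  using assms by (auto simp: Lp_def abs_mult powr_mult)

lemma Lp_minus: "Lp r f \<Longrightarrow> Lp r (\<lambda>x. - f x)"
  by (auto simp: Lp_def)

lemma Lp_diff:
  assumes "0 \<le> r" "Lp r f" "Lp r g"
  shows "Lp r (\<lambda>x. f x - g x)"
  using Lp_add[OF assms(1,2) Lp_minus[OF assms(3)]] by simp

lemma Lp_bounded:
  assumes "f \<in> borel_measurable torus" "AE x in torus. \<bar>f x\<bar> \<le> B" "0 \<le> r"
  shows "Lp r f"
proof (rule Lp_bound[OF assms(1)])
  show "AE x in torus. \<bar>f x\<bar> powr r \<le> B powr r"
    using assms(2) by eventually_elim (intro powr_mono2 assms(3), auto)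
qed simp

lemma Lp_const: "Lp r (\<lambda>x. c)" by (simp add: Lp_def)

lemma Lp_continuous:
  assumes "continuous_on UNIV f" "0 \<le> r"
  shows "Lp r f"
proof -
  obtain B where B: "\<forall>x\<in>cbox 0 One. \<bar>f x\<bar> \<le> B" using continuous_bdd_torus[OF assms(1)] by blast
  show ?thesis
    by (rule Lp_bounded[of _ B]) (use B assms continuous_measurable_torus in \<open>auto intro!: AE_I2\<close>)
qed

lemma powr_le_one_plus:
  fixes t :: real
  assumes "0 \<le> t" "0 \<le> p" "p \<le> r"
  shows "t powr p \<le> 1 + t powr r"
proof (cases "t \<le> 1")
  case True
  then have "t powr p \<le> 1 powr p" using assms by (intro powr_mono2) auto
  moreover have "0 \<le> t powr r" by simp
  ultimately show ?thesis by (simp only: powr_one_eq_one)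
next
  case False
  then have "t powr p \<le> t powr r" using assms by (intro powr_mono) auto
  then show ?thesis by simp
qed

lemma Lp_mono:
  assumes "Lp r f" "0 \<le> p" "p \<le> r"
  shows "Lp p f"
proof (rule Lp_bound)
  show "integrable torus (\<lambda>x. 1 + \<bar>f x\<bar> powr r)" using assms by (auto simp: Lp_def)
qed (use assms in \<open>auto simp: Lp_def intro!: powr_le_one_plus\<close>)

lemma Lp_one_iff: "Lp 1 f \<longleftrightarrow> integrable torus f"
  by (auto simp: Lp_def integrable_abs_iff)

lemma Lp_integrable: "Lp r f \<Longrightarrow> 1 \<le> r \<Longrightarrow> integrable torus f"
  using Lp_mono[of r f 1] by (simp add: Lp_one_iff)

section \<open>Fubini on the torus and the mollifying kernels\<close>

lemma sigma_finite_torus: "sigma_finite_measure (torus :: (real^'d) measure)"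
  using finite_measure_torus finite_measure.axioms(1) by blast

interpretation torus2: pair_sigma_finite "torus :: (real^'d) measure" "torus :: (real^'d) measure"
  by (intro pair_sigma_finite.intro sigma_finite_torus)

lemma measurable_torus2:
  shows "(\<lambda>p. fst p) \<in> borel_measurable ((torus :: (real^'d) measure) \<Otimes>\<^sub>M (torus :: (real^'d) measure))"
    and "(\<lambda>p. snd p) \<in> borel_measurable ((torus :: (real^'d) measure) \<Otimes>\<^sub>M (torus :: (real^'d) measure))"
  using measurable_compose[OF measurable_fst continuous_measurable_torus[OF continuous_on_id]]
    measurable_compose[OF measurable_snd continuous_measurable_torus[OF continuous_on_id]] by auto

text \<open>Each factor is cos^2(pi x_i), so the normalised powers are products of de la Vallee
  Poussin kernels: nonnegative trigonometric polynomials that concentrate at the integer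
  lattice.\<close>

definition kap :: "real^'d \<Rightarrow> real" where
  "kap x = (\<Prod>i\<in>UNIV. (1 + cos (2 * pi * x $ i)) / 2)"

lemma trig_kap: "trig kap"
proof -
  have "trig (\<lambda>x. 1 / 2 * (1 + cos (2 * pi * (axis i 1 \<bullet> x) + 0)))" for i :: 'a
    by (intro trig.scale trig.add trig_const trig.cos) (auto simp: axis_def)
  then have "trig (\<lambda>x. (1 + cos (2 * pi * x $ i)) / 2)" for i :: 'a
    by (simp add: inner_axis')
  then show ?thesis unfolding kap_def[abs_def] by (intro trig_prod) auto
qed

lemma kap_nonneg: "0 \<le> kap x"
  unfolding kap_def by (intro prod_nonneg) (smt (verit) cos_ge_minus_one divide_nonneg_pos)

lemma kap_zero [simp]: "kap 0 = 1"
  by (simp add: kap_def)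

lemma kap_minus: "kap (- x) = kap x"
  by (simp add: kap_def)

text \<open>The bound on the coordinates excludes the nonzero lattice points, where
  \<open>kap\<close> equals 1 again. One factor below 1 is enough, as the others lie between 0 and
  1.\<close>

lemma kap_less_one:
  assumes "\<And>i. \<bar>z $ i\<bar> < 1" "z \<noteq> 0"
  shows "kap z < 1"
proof -
  obtain i where i: "z $ i \<noteq> 0" using assms(2) by (auto simp: vec_eq_iff)
  have "cos (2 * pi * z $ i) \<noteq> 1"
  proof
    assume "cos (2 * pi * z $ i) = 1"
    then obtain n :: int where "2 * pi * z $ i = of_int n * 2 * pi"
      using cos_one_2pi_int by blast
    then have "z $ i = of_int n" by simp
    then show False using assms(1)[of i] i by auto
  qed
  then have "cos (2 * pi * z $ i) < 1"
    by (intro le_neq_trans cos_le_one)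
  then have lt: "(1 + cos (2 * pi * z $ i)) / 2 < 1" by simp
  have "kap z = (1 + cos (2 * pi * z $ i)) / 2 * (\<Prod>j\<in>UNIV - {i}. (1 + cos (2 * pi * z $ j)) / 2)"
    unfolding kap_def by (rule prod.remove) auto
  also have "\<dots> \<le> (1 + cos (2 * pi * z $ i)) / 2 * 1"
    by (intro mult_left_mono prod_le_1)
      (smt (verit) cos_ge_minus_one cos_le_one divide_nonneg_pos divide_le_eq_1)+
  finally show ?thesis using lt by simp
qed

text \<open>The normalising integrals decay more slowly than any fixed geometric rate: on the set
  where \<open>kap\<close> exceeds q the integrand is at least q^n, and \<mu> is the measure of that
  set inside the cube.\<close>

lemma kap_integral_lower:
  assumes q: "0 \<le> q" "q < 1"
  shows "\<exists>\<mu>>0. \<forall>n. \<mu> * q ^ n \<le> (\<integral>x. kap x ^ n \<partial>(torus :: (real^'d) measure))"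
proof -
  have cont: "continuous_on UNIV (kap :: real^'d \<Rightarrow> real)" by (rule trig_continuous[OF trig_kap])
  define S where "S = box 0 (One::real^'d) \<inter> {x. q < kap x}"
  have op: "open {x::real^'d. q < kap x}"
    using open_Collect_less[OF continuous_on_const cont] .
  then have openS: "open S" by (auto simp: S_def)
  have "S \<noteq> {}"
  proof -
    \<comment> \<open>The peak 0 is a corner of the cube. Being in the closure of the open box, it
      still forces the open set around it to meet the box.\<close>
    have "(0::real^'d) \<in> closure (box 0 One)"
      by (subst closure_box) (auto simp: box_eq_empty mem_box)
    moreover have "0 \<in> {x::real^'d. q < kap x}" using q by simp
    ultimately show ?thesis unfolding S_def using op closure_iff_nhds_not_empty by blast
  qed
  have Sm: "S \<in> lmeasurable"
    unfolding S_def using openS by (intro bounded_set_imp_lmeasurable) (auto simp: S_def intro: bounded_subset[OF bounded_box])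
  have sub: "S \<subseteq> cbox 0 One" using box_subset_cbox S_def by blast
  have "\<not> negligible S" using open_not_negligible[OF openS \<open>S \<noteq> {}\<close>] .
  then have pos: "0 < measure lebesgue S"
    using Sm by (simp add: negligible_iff_measure0 zero_less_measure_iff)
  have meas: "measure torus S = measure lebesgue S"
    using sub by (intro measure_restrict_space) auto
  have Sst: "S \<in> sets torus" using Sm sub by (auto simp: sets_restrict_space fmeasurable_def image_iff)
  have "measure lebesgue S * q ^ n \<le> (\<integral>x. kap x ^ n \<partial>(torus :: (real^'d) measure))" for n
  proof -
    have fin: "emeasure torus S < \<infinity>"
      using finite_measure.emeasure_finite[OF finite_measure_torus, of S] by (simp add: top.not_eq_extremum)
    have "(\<integral>x. indicator S x * q ^ n \<partial>torus) \<le> (\<integral>x. kap x ^ n \<partial>(torus :: (real^'d) measure))"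
    proof (rule integral_mono)
      show "integrable torus (\<lambda>x. indicat_real S x * q ^ n)"
        using Sst fin by simp
      show "integrable torus (\<lambda>x. kap x ^ n)"
        by (rule continuous_integrable_torus[OF trig_continuous[OF trig_power[OF trig_kap]]])
      show "indicat_real S x * q ^ n \<le> kap x ^ n" for x
        using q by (auto simp: indicator_def S_def kap_nonneg intro!: power_mono)
    qed
    then show ?thesis using Sst fin sub meas by (simp add: Int_absorb2)
  qed
  with pos show ?thesis by blast
qed

definition ker :: "nat \<Rightarrow> real^'d \<Rightarrow> real" where
  "ker n x = kap x ^ n / (\<integral>y. kap y ^ n \<partial>(torus :: (real^'d) measure))"

lemma kap_integral_pos: "0 < (\<integral>x. kap x ^ n \<partial>(torus :: (real^'d) measure))"
proof -
  obtain \<mu> where "\<mu> > 0" "\<mu> * (1/2) ^ n \<le> (\<integral>x. kap x ^ n \<partial>(torus :: (real^'d) measure))"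
    using kap_integral_lower[of "1/2"] by auto
  moreover then have "0 < \<mu> * (1/2) ^ n" by simp
  ultimately show ?thesis by linarith
qed

lemma trig_ker: "trig (ker n)"
  unfolding ker_def[abs_def] divide_inverse mult.commute[of "kap _ ^ n"]
  by (intro trig.scale trig_power trig_kap)

lemma ker_nonneg: "0 \<le> ker n x"
  unfolding ker_def by (intro divide_nonneg_nonneg zero_le_power kap_nonneg less_imp_le[OF kap_integral_pos])

lemma ker_minus: "ker n (- x) = ker n x"
  by (simp add: ker_def kap_minus)

lemma integral_ker: "(\<integral>x. ker n x \<partial>(torus :: (real^'d) measure)) = 1"
  using kap_integral_pos[of n, where 'd='d] by (simp add: ker_def)

lemma integral_ker_fst: "(\<integral>x. ker n (x - y) \<partial>(torus :: (real^'d) measure)) = 1"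
  using integral_torus_shift[OF trig_continuous[OF trig_ker] trig_periodic[OF trig_ker], of n "- y"] integral_ker
  by simp

lemma integral_ker_snd: "(\<integral>y. ker n (x - y) \<partial>(torus :: (real^'d) measure)) = 1"
proof -
  have "ker n (x - y) = ker n (y - x)" for y :: "real^'d" using ker_minus[of n "x - y"] by simp
  then show ?thesis using integral_ker_fst[of n x] by simp
qed

lemma integrable_ker_snd: "integrable torus (\<lambda>y. ker n (x - y))"
  by (rule continuous_integrable_torus[OF trig_continuous[OF trig_diff_right[OF trig_ker]]])

lemma continuous_conv_ker: "integrable torus f \<Longrightarrow> continuous_on UNIV (conv f (ker n))"
  using trig_conv[OF _ trig_ker] trig_continuous by blast

text \<open>Fubini, since the kernel has mass 1 in the x variable for every y. It serves twice:
  applied to f it preserves the mean, applied to |f|^r it gives the contraction below.\<close>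

lemma integral_conv_ker:
  fixes h :: "real^'d \<Rightarrow> real"
  assumes h: "integrable torus h"
  shows "(\<integral>x. conv h (ker n) x \<partial>torus) = (\<integral>x. h x \<partial>torus)"
proof -
  note [measurable] = measurable_torus2 borel_measurable_integrable[OF h]
  have [measurable]: "ker n \<in> borel_measurable borel"
    by (rule borel_measurable_continuous_onI[OF trig_continuous[OF trig_ker]])
  have "integrable (torus \<Otimes>\<^sub>M torus) (\<lambda>(x, y). h y * ker n (x - y))"
  proof (rule torus2.Fubini_integrable)
    show "(\<lambda>(x, y). h y * ker n (x - y)) \<in> borel_measurable (torus \<Otimes>\<^sub>M torus)"
      by measurable
    have "(\<lambda>x. \<integral>y. norm (case (x, y) of (x, y) \<Rightarrow> h y * ker n (x - y)) \<partial>torus) = conv (\<lambda>x. \<bar>h x\<bar>) (ker n)"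
      by (simp add: conv_def[abs_def] abs_mult ker_nonneg)
    then show "integrable torus (\<lambda>x. \<integral>y. norm (case (x, y) of (x, y) \<Rightarrow> h y * ker n (x - y)) \<partial>torus)"
      using continuous_integrable_torus[OF continuous_conv_ker[OF integrable_abs[OF h]]] by simp
    show "AE x in torus. integrable torus (\<lambda>y. case (x, y) of (x, y) \<Rightarrow> h y * ker n (x - y))"
      using integrable_conv_trig[OF h trig_ker] by simp
  qed
  from torus2.Fubini_integral[OF this]
  have "(\<integral>y. \<integral>x. h y * ker n (x - y) \<partial>torus \<partial>torus) = (\<integral>x. \<integral>y. h y * ker n (x - y) \<partial>torus \<partial>torus)" .
  then show ?thesis by (simp add: conv_def integral_ker_fst)
qed

lemma conv_ker_powr_le:
  assumes f: "Lp r f" and r: "1 \<le> r"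
  shows "\<bar>conv f (ker n) x\<bar> powr r \<le> conv (\<lambda>x. \<bar>f x\<bar> powr r) (ker n) x"
  unfolding conv_def
  by (rule jensen_powr[OF r])
    (auto simp: ker_nonneg integral_ker_snd integrable_ker_snd intro!: integrable_conv_trig trig_ker Lp_integrable[OF f r] LpD(2)[OF f])

text \<open>Jensen with the density ker n (x - y) in y holds at every x, and integration in x
  preserves the right-hand side; hence the constant 1, independent of n.\<close>

lemma conv_ker_Lp:
  assumes f: "Lp r f" and r: "1 \<le> r"
  shows "Lp r (conv f (ker n))"
    and "(\<integral>x. \<bar>conv f (ker n) x\<bar> powr r \<partial>torus) \<le> (\<integral>x. \<bar>f x\<bar> powr r \<partial>torus)"
proof -
  show *: "Lp r (conv f (ker n))"
    by (rule Lp_continuous[OF continuous_conv_ker[OF Lp_integrable[OF f r]]]) (use r in auto)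
  have "(\<integral>x. \<bar>conv f (ker n) x\<bar> powr r \<partial>torus) \<le> (\<integral>x. conv (\<lambda>x. \<bar>f x\<bar> powr r) (ker n) x \<partial>torus)"
    using LpD(2)[OF *] continuous_integrable_torus[OF continuous_conv_ker[OF LpD(2)[OF f]]] conv_ker_powr_le[OF f r]
    by (intro integral_mono) auto
  then show "(\<integral>x. \<bar>conv f (ker n) x\<bar> powr r \<partial>torus) \<le> (\<integral>x. \<bar>f x\<bar> powr r \<partial>torus)"
    by (simp add: integral_conv_ker[OF LpD(2)[OF f]])
qed

section \<open>Convergence of the mollifications\<close>

lemma mem_unit_cube:
  fixes x :: "real^'d"
  shows "x \<in> cbox 0 One \<longleftrightarrow> (\<forall>i. 0 \<le> x $ i \<and> x $ i \<le> 1)"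
    and "x \<in> box 0 One \<longleftrightarrow> (\<forall>i. 0 < x $ i \<and> x $ i < 1)"
  unfolding mem_box_cart One_nth zero_index by simp_all

lemma conv_ker_bounded:
  assumes h: "integrable torus h" "\<And>x. x \<in> cbox 0 One \<Longrightarrow> \<bar>h x\<bar> \<le> B"
  shows "\<bar>conv h (ker n) x\<bar> \<le> B"
proof -
  have "\<bar>conv h (ker n) x\<bar> \<le> (\<integral>y. \<bar>h y * ker n (x - y)\<bar> \<partial>torus)"
    unfolding conv_def by (rule integral_abs_bound)
  also have "\<dots> \<le> (\<integral>y. B * ker n (x - y) \<partial>torus)"
    using h integrable_conv_trig[OF integrable_abs[OF h(1)] trig_ker]
    by (intro integral_mono) (auto simp: abs_mult ker_nonneg integrable_ker_snd intro!: mult_right_mono)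
  also have "\<dots> = B" by (simp add: integral_ker_snd)
  finally show ?thesis .
qed

text \<open>The point is interior because h carries no periodicity: at a boundary point the kernel
  also peaks at the opposite faces, where h may have other values.\<close>

lemma conv_ker_tendsto:
  fixes h :: "real^'d \<Rightarrow> real"
  assumes h: "continuous_on UNIV h" and x: "x \<in> box 0 One"
  shows "(\<lambda>n. conv h (ker n) x) \<longlonglongrightarrow> h x"
proof (rule LIMSEQ_I)
  fix e :: real assume e: "0 < e"
  obtain B where B: "B \<ge> 0" "\<forall>y\<in>cbox 0 One. \<bar>h y\<bar> \<le> B" using continuous_bdd_torus[OF h] by blast
  have "isCont h x" using h by (simp add: continuous_on_eq_continuous_at)
  then obtain d where d: "d > 0" "\<And>y. dist y x < d \<Longrightarrow> dist (h y) (h x) < e / 2"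
    using e unfolding continuous_at_eps_delta by (meson half_gt_zero)
  \<comment> \<open>The compact part of the cube away from x, on which \<open>kap (x - y)\<close>
    attains a maximum below 1.\<close>
  define S where "S = cbox 0 One - ball x d"
  have "\<exists>q. 0 \<le> q \<and> q < 1 \<and> (\<forall>y\<in>S. kap (x - y) \<le> q)"
  proof (cases "S = {}")
    case True
    then show ?thesis by (intro exI[of _ 0]) auto
  next
    case False
    have "compact S" unfolding S_def by (intro compact_diff) auto
    moreover have "continuous_on S (\<lambda>y. kap (x - y))"
      by (rule continuous_on_subset[OF trig_continuous[OF trig_diff_right[OF trig_kap]]]) auto
    ultimately obtain y where y: "y \<in> S" "\<forall>z\<in>S. kap (x - z) \<le> kap (x - y)"
      using continuous_attains_sup[of S "\<lambda>y. kap (x - y)"] False by blast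
    have "kap (x - y) < 1"
    proof (rule kap_less_one)
      show "x - y \<noteq> 0" using y(1) d(1) by (auto simp: S_def)
      fix i
      have "0 < x $ i" "x $ i < 1" using x by (auto simp: mem_unit_cube)
      moreover have "0 \<le> y $ i" "y $ i \<le> 1" using y(1) by (auto simp: S_def mem_unit_cube)
      ultimately show "\<bar>(x - y) $ i\<bar> < 1" by auto
    qed
    then show ?thesis using y kap_nonneg by blast
  qed
  then obtain q where q: "0 \<le> q" "q < 1" "\<And>y. y \<in> S \<Longrightarrow> kap (x - y) \<le> q" by blast
  \<comment> \<open>Strictly between q and 1: the normalising integral is at least \<mu> p^n while
    the numerator is at most q^n on S, so the kernel decays there like (q / p)^n.\<close>
  define p where "p = (1 + q) / 2"
  have p: "0 < p" "p < 1" "q < p" using q by (auto simp: p_def)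
  obtain \<mu> where \<mu>: "\<mu> > 0" "\<And>n. \<mu> * p ^ n \<le> (\<integral>x. kap x ^ n \<partial>(torus :: (real^'d) measure))"
    using kap_integral_lower[of p] p by auto
  have far: "ker n (x - y) \<le> (q / p) ^ n / \<mu>" if "y \<in> S" for n y
  proof -
    have "ker n (x - y) \<le> q ^ n / (\<mu> * p ^ n)"
      unfolding ker_def
      using q(3)[OF that] \<mu> p by (intro frac_le power_mono kap_nonneg) (auto simp: q)
    also have "\<dots> = (q / p) ^ n / \<mu>" by (simp add: power_divide)
    finally show ?thesis .
  qed
  have hi: "integrable torus h" by (rule continuous_integrable_torus[OF h])
  have bound: "\<bar>conv h (ker n) x - h x\<bar> \<le> e / 2 + 2 * B * ((q / p) ^ n / \<mu>)" for n
  proof -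
    have "conv h (ker n) x - h x = (\<integral>y. h y * ker n (x - y) - h x * ker n (x - y) \<partial>torus)"
      unfolding conv_def using integrable_conv_trig[OF hi trig_ker]
      by (subst Bochner_Integration.integral_diff) (auto simp: integrable_ker_snd integral_ker_snd)
    also have "\<bar>\<dots>\<bar> \<le> (\<integral>y. \<bar>h y * ker n (x - y) - h x * ker n (x - y)\<bar> \<partial>torus)"
      by (rule integral_abs_bound)
    also have "\<dots> \<le> (\<integral>y. e / 2 * ker n (x - y) + 2 * B * ((q / p) ^ n / \<mu>) \<partial>torus)"
    proof (rule integral_mono)
      show "integrable torus (\<lambda>y. \<bar>h y * ker n (x - y) - h x * ker n (x - y)\<bar>)"
        by (intro integrable_abs Bochner_Integration.integrable_diff integrable_conv_trig hi trig_ker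
            integrable_mult_right integrable_ker_snd)
      show "integrable torus (\<lambda>y. e / 2 * ker n (x - y) + 2 * B * ((q / p) ^ n / \<mu>))"
        by (intro Bochner_Integration.integrable_add integrable_mult_right integrable_ker_snd integrable_torus_const)
      fix y :: "real^'d" assume "y \<in> space torus"
      then have y: "y \<in> cbox 0 One" by simp
      have eq: "\<bar>h y * ker n (x - y) - h x * ker n (x - y)\<bar> = \<bar>h y - h x\<bar> * ker n (x - y)"
        using ker_nonneg[of n "x - y"] by (simp add: abs_mult flip: left_diff_distrib)
      show "\<bar>h y * ker n (x - y) - h x * ker n (x - y)\<bar> \<le> e / 2 * ker n (x - y) + 2 * B * ((q / p) ^ n / \<mu>)"
      proof (cases "y \<in> S")
        case True
        have "\<bar>h y\<bar> \<le> B" "\<bar>h x\<bar> \<le> B" using B(2) y x box_subset_cbox by blast+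
        then have "\<bar>h y - h x\<bar> * ker n (x - y) \<le> 2 * B * ((q / p) ^ n / \<mu>)"
          by (intro mult_mono far True ker_nonneg) (use B in auto)
        moreover have "0 \<le> e / 2 * ker n (x - y)" using e ker_nonneg[of n "x - y"] by simp
        ultimately show ?thesis unfolding eq by linarith
      next
        case False
        then have "\<bar>h y - h x\<bar> \<le> e / 2"
          using d(2)[of y] y by (simp add: S_def dist_commute[of x y] dist_real_def)
        then have "\<bar>h y - h x\<bar> * ker n (x - y) \<le> e / 2 * ker n (x - y)"
          by (intro mult_right_mono ker_nonneg)
        moreover have "0 \<le> 2 * B * ((q / p) ^ n / \<mu>)" using B q p \<mu>(1) by simp
        ultimately show ?thesis unfolding eq by linarith
      qed
    qed
    also have "\<dots> = e / 2 + 2 * B * ((q / p) ^ n / \<mu>)"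
      by (subst Bochner_Integration.integral_add) (auto simp: integrable_ker_snd integral_ker_snd)
    finally show ?thesis .
  qed
  have "(\<lambda>n. 2 * B * ((q / p) ^ n / \<mu>)) \<longlonglongrightarrow> 2 * B * (0 / \<mu>)"
    by (intro tendsto_intros LIMSEQ_realpow_zero) (use q p \<mu> in auto)
  then have "(\<lambda>n. 2 * B * ((q / p) ^ n / \<mu>)) \<longlonglongrightarrow> 0" by simp
  then have "\<forall>\<^sub>F n in sequentially. 2 * B * ((q / p) ^ n / \<mu>) < e / 2"
    using e by (intro order_tendstoD(2)) auto
  then obtain N where N: "\<And>n. n \<ge> N \<Longrightarrow> 2 * B * ((q / p) ^ n / \<mu>) < e / 2"
    unfolding eventually_sequentially by blast
  show "\<exists>N. \<forall>n\<ge>N. norm (conv h (ker n) x - h x) < e"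
  proof (intro exI allI impI)
    fix n assume "n \<ge> N"
    from N[OF this] bound[of n] show "norm (conv h (ker n) x - h x) < e"
      unfolding real_norm_def by linarith
  qed
qed

lemma AE_torus_box: "AE x in (torus :: (real^'d) measure). x \<in> box 0 One"
proof -
  have "negligible (cbox 0 One - box 0 (One::real^'d))" by (rule negligible_frontier_interval)
  then have "AE x in lebesgue. x \<notin> cbox 0 One - box 0 (One::real^'d)"
    unfolding negligible_iff_null_sets by (rule AE_not_in)
  then have "AE x in lebesgue. x \<in> cbox 0 One \<longrightarrow> x \<in> box 0 (One::real^'d)"
    by eventually_elim auto
  then show ?thesis by (subst AE_restrict_space_iff) auto
qed

lemma conv_ker_tendsto_Lp_continuous:
  fixes h :: "real^'d \<Rightarrow> real"
  assumes h: "continuous_on UNIV h" and r: "0 < r"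
  shows "(\<lambda>n. \<integral>x. \<bar>conv h (ker n) x - h x\<bar> powr r \<partial>torus) \<longlonglongrightarrow> 0"
proof -
  obtain B where B: "B \<ge> 0" "\<forall>y\<in>cbox 0 One. \<bar>h y\<bar> \<le> B" using continuous_bdd_torus[OF h] by blast
  have hi: "integrable torus h" by (rule continuous_integrable_torus[OF h])
  have "(\<lambda>n. \<integral>x. \<bar>conv h (ker n) x - h x\<bar> powr r \<partial>torus) \<longlonglongrightarrow> (\<integral>x. 0 \<partial>(torus :: (real^'d) measure))"
  proof (rule integral_dominated_convergence)
    show "integrable torus (\<lambda>x::real^'d. (2 * B) powr r)" by simp
    have "continuous_on UNIV (\<lambda>x. \<bar>conv h (ker n) x - h x\<bar> powr r)" for n
      using continuous_conv_ker[OF hi] h r by (intro continuous_on_powr' continuous_intros) auto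
    then show "(\<lambda>x. \<bar>conv h (ker n) x - h x\<bar> powr r) \<in> borel_measurable torus" for n
      by (rule continuous_measurable_torus)
    show "AE x in torus. norm (\<bar>conv h (ker n) x - h x\<bar> powr r) \<le> (2 * B) powr r" for n
    proof (rule AE_I2)
      fix x :: "real^'d" assume "x \<in> space torus"
      then have "\<bar>conv h (ker n) x\<bar> \<le> B" "\<bar>h x\<bar> \<le> B" using conv_ker_bounded[OF hi] B by auto
      then show "norm (\<bar>conv h (ker n) x - h x\<bar> powr r) \<le> (2 * B) powr r"
        using r by (auto intro!: powr_mono2)
    qed
    show "AE x in torus. (\<lambda>n. \<bar>conv h (ker n) x - h x\<bar> powr r) \<longlonglongrightarrow> 0"
      using AE_torus_box
    proof eventually_elim
      case (elim x)
      have "(\<lambda>n. \<bar>conv h (ker n) x - h x\<bar>) \<longlonglongrightarrow> \<bar>h x - h x\<bar>"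
        by (intro tendsto_intros conv_ker_tendsto h elim)
      then have "(\<lambda>n. \<bar>conv h (ker n) x - h x\<bar> powr r) \<longlonglongrightarrow> 0 powr r"
        using r by (intro tendsto_powr') auto
      then show ?case by simp
    qed
  qed simp
  then show ?thesis by simp
qed

section \<open>Truncation and density of continuous functions\<close>

definition clip :: "real \<Rightarrow> real \<Rightarrow> real" where
  "clip B t = max (- B) (min B t)"

lemma clip_bound: "0 \<le> B \<Longrightarrow> \<bar>clip B t\<bar> \<le> B"
  by (auto simp: clip_def)

lemma clip_eq: "\<bar>t\<bar> \<le> B \<Longrightarrow> clip B t = t"
  by (auto simp: clip_def)

lemma clip_diff_le: "0 \<le> B \<Longrightarrow> \<bar>clip B t - t\<bar> \<le> \<bar>t\<bar>"
  by (auto simp: clip_def max_def min_def)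

lemma clip_le: "0 \<le> B \<Longrightarrow> \<bar>clip B t\<bar> \<le> \<bar>t\<bar>"
  by (auto simp: clip_def max_def min_def)

lemma continuous_on_clip: "continuous_on S f \<Longrightarrow> continuous_on S (\<lambda>x. clip B (f x))"
  unfolding clip_def by (intro continuous_intros)

lemma measurable_clip [measurable]: "f \<in> borel_measurable M \<Longrightarrow> (\<lambda>x. clip B (f x)) \<in> borel_measurable M"
  unfolding clip_def by simp

lemma clip_tendsto_Lp:
  fixes f :: "real^'d \<Rightarrow> real"
  assumes f: "Lp r f" and r: "0 < r"
  shows "(\<lambda>n. \<integral>x. \<bar>clip (real n) (f x) - f x\<bar> powr r \<partial>torus) \<longlonglongrightarrow> 0"
proof -
  note [measurable] = LpD(1)[OF f]
  have "(\<lambda>n. \<integral>x. \<bar>clip (real n) (f x) - f x\<bar> powr r \<partial>torus) \<longlonglongrightarrow> (\<integral>x. 0 \<partial>(torus :: (real^'d) measure))"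
  proof (rule integral_dominated_convergence[where w = "\<lambda>x. \<bar>f x\<bar> powr r"])
    show "AE x in torus. norm (\<bar>clip (real n) (f x) - f x\<bar> powr r) \<le> \<bar>f x\<bar> powr r" for n
      using r by (auto intro!: AE_I2 powr_mono2 clip_diff_le)
    show "AE x in torus. (\<lambda>n. \<bar>clip (real n) (f x) - f x\<bar> powr r) \<longlonglongrightarrow> 0"
    proof (rule AE_I2)
      fix x :: "real^'d"
      have "\<forall>\<^sub>F n in sequentially. 0 = \<bar>clip (real n) (f x) - f x\<bar> powr r"
        using eventually_ge_at_top[of "nat \<lceil>\<bar>f x\<bar>\<rceil>"]
      proof eventually_elim
        case (elim n)
        then have "\<bar>f x\<bar> \<le> real n" by linarith
        then show ?case using r by (simp add: clip_eq)
      qed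
      then show "(\<lambda>n. \<bar>clip (real n) (f x) - f x\<bar> powr r) \<longlonglongrightarrow> 0"
        by (rule Lim_transform_eventually[OF tendsto_const])
    qed
  qed (use LpD[OF f] in auto)
  then show ?thesis by simp
qed

text \<open>f is truncated first. The continuous approximants supplied by
  \<open>measurable_on\<close> converge only almost everywhere; clipping them at the same height
  provides a constant majorant for dominated convergence.\<close>

lemma Lp_approx_continuous:
  fixes f :: "real^'d \<Rightarrow> real"
  assumes f: "Lp r f" and r: "0 < r" and e: "0 < e"
  shows "\<exists>h. continuous_on UNIV h \<and> (\<integral>x. \<bar>f x - h x\<bar> powr r \<partial>torus) < e"
proof -
  define C where "C = (2::real) powr r"
  have C: "C > 0" by (simp add: C_def)
  note [measurable] = LpD(1)[OF f]
  have eC: "e / (2 * C) > 0" using e C by simp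
  obtain m where m: "(\<integral>x. \<bar>clip (real m) (f x) - f x\<bar> powr r \<partial>torus) < e / (2 * C)"
    using order_tendstoD(2)[OF clip_tendsto_Lp[OF f r] eC] by (auto simp: eventually_sequentially)
  define B where "B = real m"
  have B: "0 \<le> B" by (simp add: B_def)
  have "f measurable_on cbox 0 One"
    using LpD(1)[OF f] by (simp add: measurable_on_iff_borel_measurable)
  then obtain N g where N: "negligible N" and g: "\<And>n. continuous_on UNIV (g n :: real^'d \<Rightarrow> real)"
      "\<And>x. x \<notin> N \<Longrightarrow> (\<lambda>n. g n x) \<longlonglongrightarrow> (if x \<in> cbox 0 One then f x else 0)"
    unfolding measurable_on_def by blast
  have "AE x in lebesgue. x \<notin> N" using N by (simp add: negligible_iff_null_sets AE_not_in)
  then have AEN: "AE x in torus. x \<notin> N" by (subst AE_restrict_space_iff) auto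
  have "(\<lambda>n. \<integral>x. \<bar>clip B (f x) - clip B (g n x)\<bar> powr r \<partial>torus) \<longlonglongrightarrow> (\<integral>x. 0 \<partial>(torus :: (real^'d) measure))"
  proof (rule integral_dominated_convergence[where w = "\<lambda>x. (2 * B) powr r"])
    show "(\<lambda>x. \<bar>clip B (f x) - clip B (g n x)\<bar> powr r) \<in> borel_measurable torus" for n
      using continuous_measurable_torus[OF g(1)] by measurable
    show "AE x in torus. norm (\<bar>clip B (f x) - clip B (g n x)\<bar> powr r) \<le> (2 * B) powr r" for n
    proof (rule AE_I2)
      fix x
      have "\<bar>clip B (f x) - clip B (g n x)\<bar> \<le> 2 * B"
        using clip_bound[OF B, of "f x"] clip_bound[OF B, of "g n x"] by linarith
      then show "norm (\<bar>clip B (f x) - clip B (g n x)\<bar> powr r) \<le> (2 * B) powr r"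
        using r by (auto intro!: powr_mono2)
    qed
    have "AE x in torus. x \<in> cbox 0 One" by (rule AE_I2) simp
    then show "AE x in torus. (\<lambda>n. \<bar>clip B (f x) - clip B (g n x)\<bar> powr r) \<longlonglongrightarrow> 0"
      using AEN
    proof eventually_elim
      case (elim x)
      then have "(\<lambda>n. g n x) \<longlonglongrightarrow> f x" using g(2)[of x] by simp
      then have "(\<lambda>n. \<bar>clip B (f x) - clip B (g n x)\<bar>) \<longlonglongrightarrow> \<bar>clip B (f x) - clip B (f x)\<bar>"
        unfolding clip_def by (intro tendsto_intros)
      then have "(\<lambda>n. \<bar>clip B (f x) - clip B (g n x)\<bar> powr r) \<longlonglongrightarrow> 0 powr r"
        using r by (intro tendsto_powr') auto
      then show ?case by simp
    qed
  qed auto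
  then have "(\<lambda>n. \<integral>x. \<bar>clip B (f x) - clip B (g n x)\<bar> powr r \<partial>torus) \<longlonglongrightarrow> 0" by simp
  from order_tendstoD(2)[OF this eC] obtain k where
    k: "(\<integral>x. \<bar>clip B (f x) - clip B (g k x)\<bar> powr r \<partial>torus) < e / (2 * C)"
    by (auto simp: eventually_sequentially)
  define h where "h x = clip B (g k x)" for x
  have h: "continuous_on UNIV h" unfolding h_def by (rule continuous_on_clip[OF g(1)])
  have Lh: "Lp r h" by (rule Lp_continuous[OF h]) (use r in auto)
  have Lc: "Lp r (\<lambda>x. clip B (f x))"
    by (rule Lp_bounded[of _ B]) (use r B in \<open>auto simp: clip_bound\<close>)
  have "(\<integral>x. \<bar>f x - h x\<bar> powr r \<partial>torus) \<le>
        (\<integral>x. C * (\<bar>clip B (f x) - f x\<bar> powr r + \<bar>clip B (f x) - h x\<bar> powr r) \<partial>torus)"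
  proof (rule integral_mono)
    show "integrable torus (\<lambda>x. \<bar>f x - h x\<bar> powr r)"
      by (rule LpD(2)[OF Lp_diff]) (use r f Lh in auto)
    show "integrable torus (\<lambda>x. C * (\<bar>clip B (f x) - f x\<bar> powr r + \<bar>clip B (f x) - h x\<bar> powr r))"
      using LpD(2)[OF Lp_diff[OF _ Lc f]] LpD(2)[OF Lp_diff[OF _ Lc Lh]] r by simp
    fix x
    show "\<bar>f x - h x\<bar> powr r \<le> C * (\<bar>clip B (f x) - f x\<bar> powr r + \<bar>clip B (f x) - h x\<bar> powr r)"
      using abs_add_powr_le[of r "f x - clip B (f x)" "clip B (f x) - h x"] r
      by (simp add: C_def abs_minus_commute[of "f x"])
  qed
  also have "\<dots> = C * ((\<integral>x. \<bar>clip B (f x) - f x\<bar> powr r \<partial>torus) + (\<integral>x. \<bar>clip B (f x) - h x\<bar> powr r \<partial>torus))"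
    using LpD(2)[OF Lp_diff[OF _ Lc f]] LpD(2)[OF Lp_diff[OF _ Lc Lh]] r by simp
  also have "\<dots> < C * (e / (2 * C) + e / (2 * C))"
    by (intro mult_strict_left_mono add_strict_mono C) (use m k in \<open>auto simp: B_def h_def\<close>)
  also have "\<dots> = e" using C by simp
  finally show ?thesis using h by blast
qed

lemma conv_diff:
  assumes "integrable torus f" "integrable torus h" "trig K"
  shows "conv (\<lambda>y. f y - h y) K x = conv f K x - conv h K x"
  using assms unfolding conv_def left_diff_distrib
  by (intro Bochner_Integration.integral_diff integrable_conv_trig)

text \<open>For a continuous h close to f, contraction makes the mollification of f - h as small as
  f - h itself, uniformly in n; the mollifications of h converge by the continuous case.\<close>

lemma conv_ker_tendsto_Lp:
  fixes f :: "real^'d \<Rightarrow> real"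
  assumes f: "Lp r f" and r: "1 \<le> r"
  shows "(\<lambda>n. \<integral>x. \<bar>conv f (ker n) x - f x\<bar> powr r \<partial>torus) \<longlonglongrightarrow> 0"
proof (rule LIMSEQ_I)
  fix e :: real assume e: "0 < e"
  define C where "C = (2::real) powr r"
  have C: "C \<ge> 1" using r by (simp add: C_def ge_one_powr_ge_zero)
  \<comment> \<open>\<open>C\<close> is the constant of \<open>abs_add_powr_le\<close>, applied
    twice to split a sum of three terms, each of which will be below e'.\<close>
  define e' where "e' = e / (3 * C * C)"
  have e': "e' > 0" using e C by (simp add: e'_def)
  obtain h where h: "continuous_on UNIV h" and fh: "(\<integral>x. \<bar>f x - h x\<bar> powr r \<partial>torus) < e'"
    using Lp_approx_continuous[OF f _ e'] r by auto
  have Lh: "Lp r h" by (rule Lp_continuous[OF h]) (use r in auto)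
  have fi: "integrable torus f" and hi: "integrable torus h" using Lp_integrable f Lh r by auto
  have Lfh: "Lp r (\<lambda>x. f x - h x)" using Lp_diff[OF _ f Lh] r by auto
  have "\<forall>\<^sub>F n in sequentially. (\<integral>x. \<bar>conv h (ker n) x - h x\<bar> powr r \<partial>torus) < e'"
    using order_tendstoD(2)[OF conv_ker_tendsto_Lp_continuous[OF h] e'] r by auto
  then obtain N where N: "\<And>n. n \<ge> N \<Longrightarrow> (\<integral>x. \<bar>conv h (ker n) x - h x\<bar> powr r \<partial>torus) < e'"
    unfolding eventually_sequentially by blast
  show "\<exists>N. \<forall>n\<ge>N. norm ((\<integral>x. \<bar>conv f (ker n) x - f x\<bar> powr r \<partial>torus) - 0) < e"
  proof (intro exI allI impI)
    fix n assume n: "n \<ge> N"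
    note L1 = conv_ker_Lp[OF Lfh r, of n]
    have L2: "Lp r (\<lambda>x. conv h (ker n) x - h x)"
      using Lp_diff[OF _ conv_ker_Lp(1)[OF Lh r] Lh] r by auto
    have "(\<integral>x. \<bar>conv f (ker n) x - f x\<bar> powr r \<partial>torus) \<le>
      (\<integral>x. C * C * (\<bar>conv (\<lambda>x. f x - h x) (ker n) x\<bar> powr r + \<bar>conv h (ker n) x - h x\<bar> powr r + \<bar>f x - h x\<bar> powr r) \<partial>torus)"
    proof (rule integral_mono)
      show "integrable torus (\<lambda>x. \<bar>conv f (ker n) x - f x\<bar> powr r)"
        using LpD(2)[OF Lp_diff[OF _ conv_ker_Lp(1)[OF f r] f]] r by auto
      show "integrable torus (\<lambda>x. C * C * (\<bar>conv (\<lambda>x. f x - h x) (ker n) x\<bar> powr r + \<bar>conv h (ker n) x - h x\<bar> powr r + \<bar>f x - h x\<bar> powr r))"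
        using LpD(2)[OF L1(1)] LpD(2)[OF L2] LpD(2)[OF Lfh] by simp
      fix x
      let ?a = "conv (\<lambda>x. f x - h x) (ker n) x" and ?b = "conv h (ker n) x - h x" and ?c = "f x - h x"
      have "\<bar>conv f (ker n) x - f x\<bar> powr r = \<bar>(?a + ?b) + - ?c\<bar> powr r"
        by (simp add: conv_diff[OF fi hi trig_ker])
      also have "\<dots> \<le> C * (\<bar>?a + ?b\<bar> powr r + \<bar>- ?c\<bar> powr r)"
        unfolding C_def by (rule abs_add_powr_le) (use r in auto)
      also have "\<dots> = C * (\<bar>?a + ?b\<bar> powr r + \<bar>?c\<bar> powr r)" by (simp only: abs_minus_cancel)
      also have "\<dots> \<le> C * (C * (\<bar>?a\<bar> powr r + \<bar>?b\<bar> powr r) + C * \<bar>?c\<bar> powr r)"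
        using abs_add_powr_le[of r ?a ?b] r C mult_right_mono[of 1 C "\<bar>?c\<bar> powr r"]
        by (intro mult_left_mono add_mono) (auto simp: C_def)
      finally show "\<bar>conv f (ker n) x - f x\<bar> powr r \<le> C * C * (\<bar>?a\<bar> powr r + \<bar>?b\<bar> powr r + \<bar>?c\<bar> powr r)"
        by (simp add: algebra_simps)
    qed
    also have "\<dots> = C * C * ((\<integral>x. \<bar>conv (\<lambda>x. f x - h x) (ker n) x\<bar> powr r \<partial>torus) + (\<integral>x. \<bar>conv h (ker n) x - h x\<bar> powr r \<partial>torus) + (\<integral>x. \<bar>f x - h x\<bar> powr r \<partial>torus))"
      using LpD(2)[OF L1(1)] LpD(2)[OF L2] LpD(2)[OF Lfh] by simp
    also have "\<dots> < C * C * (e' + e' + e')"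
      using L1(2) fh N[OF n] C by (intro mult_strict_left_mono add_strict_mono) auto
    also have "\<dots> = e" using C by (simp add: e'_def)
    finally have "(\<integral>x. \<bar>conv f (ker n) x - f x\<bar> powr r \<partial>torus) < e" .
    moreover have "0 \<le> (\<integral>x. \<bar>conv f (ker n) x - f x\<bar> powr r \<partial>torus)" by simp
    ultimately show "norm ((\<integral>x. \<bar>conv f (ker n) x - f x\<bar> powr r \<partial>torus) - 0) < e" by simp
  qed
qed

section \<open>Poincare inequality\<close>

lemma has_weak_gradD:
  assumes "has_weak_grad f G"
  shows "integrable torus f" "integrable torus G"
    "\<And>\<phi> i. torus_test \<phi> \<Longrightarrow> (\<integral>x. f x * (grad \<phi> x $ i) \<partial>torus) = - (\<integral>x. (G x $ i) * \<phi> x \<partial>torus)"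
  using assms by (auto simp: has_weak_grad_def)

lemma integrable_pair_continuous:
  fixes F :: "'a::euclidean_space \<times> 'b::euclidean_space \<Rightarrow> real"
  assumes F: "continuous_on UNIV F"
  shows "integrable (lebesgue_on (cbox a b) \<Otimes>\<^sub>M lebesgue_on (cbox c d)) F"
proof -
  have m: "(\<lambda>x. x) \<in> borel_measurable (lebesgue_on S)" for S :: "'c::euclidean_space set"
    using id_borel_measurable_lebesgue_on[of S] by (simp add: id_def)
  interpret finite_measure "lebesgue_on (cbox a b) \<Otimes>\<^sub>M lebesgue_on (cbox c d)"
    by (intro finite_measure_pair_measure finite_measure_lebesgue_on) auto
  have "compact (F ` (cbox a b \<times> cbox c d))"
    by (rule compact_continuous_image[OF continuous_on_subset[OF F]]) (auto intro: compact_Times)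
  then obtain B where B: "\<forall>y\<in>F ` (cbox a b \<times> cbox c d). norm y \<le> B"
    using compact_imp_bounded bounded_iff by blast
  show ?thesis
  proof (rule integrable_const_bound[where B = B])
    show "AE x in lebesgue_on (cbox a b) \<Otimes>\<^sub>M lebesgue_on (cbox c d). norm (F x) \<le> B"
      using B by (intro AE_I2) (auto simp: space_pair_measure)
    have [measurable]: "F \<in> borel_measurable (borel \<Otimes>\<^sub>M borel)"
      using borel_measurable_continuous_onI[OF F] by (simp add: borel_prod)
    note [measurable] = measurable_compose[OF measurable_fst m] measurable_compose[OF measurable_snd m]
    have "(\<lambda>p. F (fst p, snd p)) \<in> borel_measurable (lebesgue_on (cbox a b) \<Otimes>\<^sub>M lebesgue_on (cbox c d))"
      by measurable
    then show "F \<in> borel_measurable (lebesgue_on (cbox a b) \<Otimes>\<^sub>M lebesgue_on (cbox c d))" by simp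
  qed
qed

lemma fubini_continuous:
  fixes F :: "'a::euclidean_space \<Rightarrow> 'b::euclidean_space \<Rightarrow> real" and a b c d
  assumes F: "continuous_on UNIV (\<lambda>p. F (fst p) (snd p))"
  defines "M \<equiv> lebesgue_on (cbox a b)" and "N \<equiv> lebesgue_on (cbox c d)"
  shows "integrable M (\<lambda>x. \<integral>y. F x y \<partial>N)" "integrable N (\<lambda>y. \<integral>x. F x y \<partial>M)"
    "(\<integral>x. (\<integral>y. F x y \<partial>N) \<partial>M) = (\<integral>y. (\<integral>x. F x y \<partial>M) \<partial>N)"
proof -
  have fin: "finite_measure M" "finite_measure N"
    unfolding M_def N_def by (auto intro: finite_measure_lebesgue_on)
  interpret pair_sigma_finite M N
    using fin by (intro pair_sigma_finite.intro finite_measure.axioms(1))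
  have "integrable (M \<Otimes>\<^sub>M N) (\<lambda>p. F (fst p) (snd p))"
    unfolding M_def N_def by (rule integrable_pair_continuous[OF F])
  then have i: "integrable (M \<Otimes>\<^sub>M N) (\<lambda>(x, y). F x y)" by (simp add: case_prod_unfold)
  show "(\<integral>x. (\<integral>y. F x y \<partial>N) \<partial>M) = (\<integral>y. (\<integral>x. F x y \<partial>M) \<partial>N)"
    using Fubini_integral[OF i] by simp
  show "integrable M (\<lambda>x. \<integral>y. F x y \<partial>N)" using integrable_fst[OF i] by simp
  show "integrable N (\<lambda>y. \<integral>x. F x y \<partial>M)" using integrable_snd[OF i] by simp
qed

section \<open>Line integrals and means of gradients\<close>

lemma continuous_on_grad:
  assumes "Ck (Suc 0) \<phi>"
  shows "continuous_on UNIV (grad \<phi>)"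
proof -
  have "continuous_on UNIV (\<lambda>x. \<chi> i. grad \<phi> x $ i)"
    using assms by (intro continuous_on_vec_lambda) simp
  then show ?thesis by (simp add: vec_lambda_eta)
qed

lemma C1_line_integral:
  fixes \<phi> :: "real^'d \<Rightarrow> real"
  assumes "Ck (Suc 0) \<phi>"
  shows "\<phi> (x + h) - \<phi> x = (\<integral>t. grad \<phi> (x + t *\<^sub>R h) \<bullet> h \<partial>lebesgue_on (cbox 0 1))"
proof -
  have d: "\<phi> differentiable (at z)" for z using assms by simp
  have c: "continuous_on UNIV (\<lambda>z. grad \<phi> z \<bullet> h)"
    by (intro continuous_intros continuous_on_grad assms)
  have "((\<lambda>t. grad \<phi> (x + t *\<^sub>R h) \<bullet> h) has_integral \<phi> (x + 1 *\<^sub>R h) - \<phi> (x + 0 *\<^sub>R h)) {0..1}"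
  proof (rule fundamental_theorem_of_calculus)
    fix t :: real
    have "((\<lambda>t. \<phi> (x + t *\<^sub>R h)) has_derivative (\<lambda>s. grad \<phi> (x + t *\<^sub>R h) \<bullet> (s *\<^sub>R h))) (at t within {0..1})"
      by (rule has_derivative_compose[where f = "\<lambda>t. x + t *\<^sub>R h" and g = \<phi>, OF _ has_derivative_grad[OF d]])
        (auto intro!: derivative_eq_intros)
    then show "((\<lambda>t. \<phi> (x + t *\<^sub>R h)) has_vector_derivative grad \<phi> (x + t *\<^sub>R h) \<bullet> h) (at t within {0..1})"
      by (simp add: has_vector_derivative_def)
  qed simp
  moreover have "integrable (lebesgue_on (cbox 0 1)) (\<lambda>t. grad \<phi> (x + t *\<^sub>R h) \<bullet> h)"
    by (intro continuous_imp_integrable continuous_on_compose2[OF c] continuous_intros) auto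
  ultimately show ?thesis
    by (simp add: lebesgue_integral_eq_integral integral_unique)
qed

text \<open>After exchanging the integrals, translation invariance removes the shift t h for each
  fixed t.\<close>

lemma integral_along_segments:
  fixes G :: "real^'d \<Rightarrow> real"
  assumes G: "continuous_on UNIV G" "periodic G"
  shows "(\<integral>x. \<integral>t. G (x + t *\<^sub>R h) \<partial>lebesgue_on (cbox 0 1) \<partial>torus) = (\<integral>x. G x \<partial>torus)"
    and "integrable torus (\<lambda>x. \<integral>t. G (x + t *\<^sub>R h) \<partial>lebesgue_on (cbox 0 (1::real)))"
proof -
  have c: "continuous_on UNIV (\<lambda>p::(real^'d) \<times> real. G (fst p + snd p *\<^sub>R h))"
    by (intro continuous_on_compose2[OF G(1)] continuous_intros) auto
  show "integrable torus (\<lambda>x. \<integral>t. G (x + t *\<^sub>R h) \<partial>lebesgue_on (cbox 0 (1::real)))"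
    by (rule fubini_continuous(1)[OF c])
  have "(\<integral>x. \<integral>t. G (x + t *\<^sub>R h) \<partial>lebesgue_on (cbox 0 1) \<partial>torus)
      = (\<integral>t. \<integral>x. G (x + t *\<^sub>R h) \<partial>torus \<partial>lebesgue_on (cbox 0 (1::real)))"
    by (rule fubini_continuous(3)[OF c])
  also have "\<dots> = (\<integral>x. G x \<partial>torus)"
    by (simp add: integral_torus_shift[OF G] measure_restrict_space)
  finally show "(\<integral>x. \<integral>t. G (x + t *\<^sub>R h) \<partial>lebesgue_on (cbox 0 1) \<partial>torus) = (\<integral>x. G x \<partial>torus)" .
qed

lemma grad_periodic:
  assumes "periodic \<phi>"
  shows "periodic (\<lambda>x. grad \<phi> x $ i)"
  unfolding periodic_def
proof (intro allI)
  fix x :: "real^'a" and j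
  have tr: "(\<phi> has_derivative D) (at z)"
    if "(\<phi> has_derivative D) (at (z + a))" "\<And>y. \<phi> (y + a) = \<phi> y" for D z a
  proof -
    have "((\<lambda>y. \<phi> (y + a)) has_derivative D) (at z)"
      by (rule has_derivative_compose[where f = "\<lambda>y. y + a" and g = \<phi>, OF _ that(1)])
        (auto intro!: derivative_eq_intros)
    then show ?thesis using that(2) by simp
  qed
  have "\<phi> (y + - axis j 1) = \<phi> y" for y
    using assms unfolding periodic_def by (metis diff_add_cancel uminus_add_conv_diff add.commute)
  \<comment> \<open>The equivalence is proved for every D, so the choice inside
    \<open>frechet_derivative\<close> yields the same map at both points, even where \<phi> is not
    differentiable.\<close>
  then have "(\<phi> has_derivative D) (at (x + axis j 1)) \<longleftrightarrow> (\<phi> has_derivative D) (at x)" for D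
    using tr[of D x "axis j 1"] tr[of D "x + axis j 1" "- axis j 1"] assms
    by (auto simp: periodic_def)
  then show "grad \<phi> (x + axis j 1) $ i = grad \<phi> x $ i"
    by (simp add: grad_def frechet_derivative_def)
qed

text \<open>The increment of \<phi> over a full period is zero; as a line integral averaged over x
  it equals the mean of the partial derivative. Hence constants have weak gradient 0.\<close>

lemma integral_grad_zero:
  fixes \<phi> :: "real^'d \<Rightarrow> real"
  assumes "torus_Ck (Suc 0) \<phi>"
  shows "(\<integral>x. grad \<phi> x $ i \<partial>torus) = 0"
proof -
  have p: "periodic \<phi>" and C: "Ck (Suc 0) \<phi>" using assms by (auto simp: torus_Ck_def)
  have c: "continuous_on UNIV (\<lambda>x. grad \<phi> x $ i)" using C by simp
  have "0 = (\<integral>t. grad \<phi> (x + t *\<^sub>R axis i 1) \<bullet> axis i 1 \<partial>lebesgue_on (cbox 0 1))" for x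
    using C1_line_integral[OF C, of x "axis i 1"] p by (simp add: periodic_def)
  then have "(\<integral>x. \<integral>t. grad \<phi> (x + t *\<^sub>R axis i 1) $ i \<partial>lebesgue_on (cbox 0 1) \<partial>torus) = (\<integral>x. 0 \<partial>(torus :: (real^'d) measure))"
    by (simp add: inner_axis)
  then show ?thesis using integral_along_segments(1)[OF c grad_periodic[OF p], of "axis i 1"] by simp
qed

lemma has_weak_grad_mean_free:
  assumes u: "integrable torus u"
  shows "has_weak_grad (mean_free u) G \<longleftrightarrow> has_weak_grad u G"
proof -
  define c where "c = (\<integral>y. u y \<partial>torus)"
  have "(\<integral>x. mean_free u x * (grad \<phi> x $ i) \<partial>torus) = (\<integral>x. u x * (grad \<phi> x $ i) \<partial>torus)"
    if "torus_test \<phi>" for \<phi> i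
  proof -
    have \<phi>: "torus_Ck (Suc 0) \<phi>" using that by (simp add: torus_test_def)
    then have c1: "continuous_on UNIV (\<lambda>x. grad \<phi> x $ i)" by (simp add: torus_Ck_def)
    have "(\<integral>x. mean_free u x * (grad \<phi> x $ i) \<partial>torus)
        = (\<integral>x. u x * (grad \<phi> x $ i) - c * (grad \<phi> x $ i) \<partial>torus)"
      by (simp add: mean_free_def c_def left_diff_distrib)
    also have "\<dots> = (\<integral>x. u x * (grad \<phi> x $ i) \<partial>torus) - c * (\<integral>x. grad \<phi> x $ i \<partial>torus)"
      using integrable_cont_mult_torus[OF u c1] continuous_integrable_torus[OF c1] by simp
    finally show ?thesis by (simp add: integral_grad_zero[OF \<phi>])
  qed
  moreover have "integrable torus (mean_free u)"
    unfolding mean_free_def[abs_def] using u by simp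
  ultimately show ?thesis using u by (simp add: has_weak_grad_def)
qed

text \<open>Equality of functions and not only almost everywhere: both sides choose from the same
  collection of weak gradients.\<close>

lemma weak_grad_mean_free: "integrable torus u \<Longrightarrow> weak_grad (mean_free u) = weak_grad u"
  by (simp add: weak_grad_def has_weak_grad_mean_free)

lemma norm_powr_le_sum:
  fixes v :: "real^'d"
  assumes r: "0 \<le> r"
  shows "norm v powr r \<le> real CARD('d) powr r * (\<Sum>i\<in>UNIV. \<bar>v $ i\<bar> powr r)"
proof -
  have "Max (range (\<lambda>i. \<bar>v $ i\<bar>)) \<in> range (\<lambda>i. \<bar>v $ i\<bar>)" by (rule Max_in) auto
  then obtain j where j: "\<bar>v $ j\<bar> = Max (range (\<lambda>i. \<bar>v $ i\<bar>))" by (metis imageE)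
  have "norm v \<le> (\<Sum>i\<in>UNIV. \<bar>v $ i\<bar>)" by (rule norm_le_l1_cart)
  also have "\<dots> \<le> (\<Sum>i\<in>(UNIV::'d set). \<bar>v $ j\<bar>)"
    unfolding j by (intro sum_mono Max_ge) auto
  finally have "norm v \<le> real CARD('d) * \<bar>v $ j\<bar>" by simp
  then have "norm v powr r \<le> (real CARD('d) * \<bar>v $ j\<bar>) powr r" by (intro powr_mono2 r) auto
  also have "\<dots> = real CARD('d) powr r * \<bar>v $ j\<bar> powr r" by (rule powr_mult)
  also have "\<dots> \<le> real CARD('d) powr r * (\<Sum>i\<in>UNIV. \<bar>v $ i\<bar> powr r)"
    by (intro mult_left_mono member_le_sum[where f = "\<lambda>i. \<bar>v $ i\<bar> powr r"]) auto
  finally show ?thesis .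
qed

text \<open>Direct comparison of \<phi> at x and x + h, averaged over h in the unit cube. This gives
  an explicit constant for every r \<ge> 1, with no compactness argument.\<close>

lemma poincare_trig:
  fixes \<phi> :: "real^'d \<Rightarrow> real"
  assumes \<phi>: "trig \<phi>" and r: "1 \<le> r"
  shows "(\<integral>x. \<bar>\<phi> x - (\<integral>y. \<phi> y \<partial>torus)\<bar> powr r \<partial>torus)
    \<le> real CARD('d) powr r * (\<integral>x. norm (grad \<phi> x) powr r \<partial>torus)"
proof -
  let ?T = "torus :: (real^'d) measure" and ?I = "lebesgue_on (cbox 0 (1::real))"
  define A where "A = (\<integral>x. norm (grad \<phi> x) powr r \<partial>torus)"
  have c: "continuous_on UNIV \<phi>" by (rule trig_continuous[OF \<phi>])
  have C1: "Ck (Suc 0) \<phi>" by (rule trig_Ck[OF \<phi>])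
  have cg: "continuous_on UNIV (\<lambda>x. grad \<phi> x)"
    using continuous_on_grad[OF C1] .
  have pg: "periodic (\<lambda>x. F (grad \<phi> x))" for F :: "real^'d \<Rightarrow> real"
  proof -
    have "grad \<phi> (x + axis j 1) = grad \<phi> x" for x j
      using grad_periodic[OF trig_periodic[OF \<phi>]] by (simp add: periodic_def vec_eq_iff)
    then show ?thesis by (simp add: periodic_def)
  qed
  have A: "0 \<le> A" unfolding A_def by simp
  \<comment> \<open>Jensen along the segment from x to x + h; averaging over x, every point of the
    segment contributes the same mean.\<close>
  have step: "(\<integral>x. \<bar>\<phi> (x + h) - \<phi> x\<bar> powr r \<partial>torus) \<le> norm h powr r * A" for h
  proof -
    define G where "G x = \<bar>grad \<phi> x \<bullet> h\<bar> powr r" for x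
    have cG: "continuous_on UNIV G" unfolding G_def using r by (intro continuous_on_powr' continuous_intros cg) auto
    have pG: "periodic G" unfolding G_def by (rule pg)
    have ct: "continuous_on UNIV (\<lambda>t. f (x + t *\<^sub>R h))" if "continuous_on UNIV f" for f :: "real^'d \<Rightarrow> real" and x
      by (intro continuous_on_compose2[OF that] continuous_intros) auto
    have it: "integrable ?I (\<lambda>t. f (x + t *\<^sub>R h))" if "continuous_on UNIV f" for f :: "real^'d \<Rightarrow> real" and x
      by (rule continuous_imp_integrable[OF continuous_on_subset[OF ct[OF that]]]) auto
    have "\<bar>\<phi> (x + h) - \<phi> x\<bar> powr r \<le> (\<integral>t. G (x + t *\<^sub>R h) \<partial>?I)" for x
    proof -
      have cd: "continuous_on UNIV (\<lambda>x. grad \<phi> x \<bullet> h)" by (intro continuous_intros cg)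
      have "\<bar>\<integral>t. (grad \<phi> (x + t *\<^sub>R h) \<bullet> h) * 1 \<partial>?I\<bar> powr r \<le> (\<integral>t. \<bar>grad \<phi> (x + t *\<^sub>R h) \<bullet> h\<bar> powr r * 1 \<partial>?I)"
        by (rule jensen_powr[OF r])
          (use it[OF cd, of x] it[OF cG, of x] cg in
            \<open>auto simp: G_def measure_restrict_space intro!: continuous_intros continuous_imp_integrable\<close>)
      then show ?thesis by (simp add: C1_line_integral[OF C1] G_def)
    qed
    then have "(\<integral>x. \<bar>\<phi> (x + h) - \<phi> x\<bar> powr r \<partial>torus) \<le> (\<integral>x. \<integral>t. G (x + t *\<^sub>R h) \<partial>?I \<partial>torus)"
    proof (intro integral_mono)
      have "continuous_on UNIV (\<lambda>x. \<bar>\<phi> (x + h) - \<phi> x\<bar> powr r)"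
        using r by (intro continuous_on_powr' continuous_intros c continuous_on_compose2[OF c]) auto
      then show "integrable torus (\<lambda>x. \<bar>\<phi> (x + h) - \<phi> x\<bar> powr r)" by (rule continuous_integrable_torus)
      show "integrable torus (\<lambda>x. \<integral>t. G (x + t *\<^sub>R h) \<partial>?I)" by (rule integral_along_segments(2)[OF cG pG])
    qed
    also have "\<dots> = (\<integral>x. G x \<partial>torus)" by (rule integral_along_segments(1)[OF cG pG])
    also have "\<dots> \<le> (\<integral>x. norm h powr r * norm (grad \<phi> x) powr r \<partial>torus)"
    proof (rule integral_mono)
      show "integrable torus G" by (rule continuous_integrable_torus[OF cG])
      show "integrable torus (\<lambda>x. norm h powr r * norm (grad \<phi> x) powr r)"
        using r by (intro continuous_integrable_torus continuous_on_mult continuous_on_powr' continuous_intros cg) auto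
      show "G x \<le> norm h powr r * norm (grad \<phi> x) powr r" for x
        using Cauchy_Schwarz_ineq2[of "grad \<phi> x" h] r
        by (auto simp: G_def mult.commute intro!: powr_mono2 simp flip: powr_mult)
    qed
    finally show ?thesis by (simp add: A_def)
  qed
  have cF: "continuous_on UNIV (\<lambda>p. \<bar>\<phi> (fst p + snd p) - \<phi> (fst p)\<bar> powr r)"
    using r by (intro continuous_on_powr' continuous_intros continuous_on_compose2[OF c]) auto
  \<comment> \<open>By translation invariance the mean of \<phi> is the average of \<phi> (x + h)
    over h, and Jensen moves the power inside that average.\<close>
  have key: "\<bar>\<phi> x - (\<integral>y. \<phi> y \<partial>torus)\<bar> powr r \<le> (\<integral>h. \<bar>\<phi> (x + h) - \<phi> x\<bar> powr r \<partial>torus)" for x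
  proof -
    have i1: "integrable torus \<phi>" by (rule continuous_integrable_torus[OF c])
    have cc: "continuous_on UNIV (\<lambda>y. \<bar>\<phi> y - \<phi> x\<bar> powr r)"
      using r by (intro continuous_on_powr' continuous_intros c) auto
    have pp: "periodic (\<lambda>y. \<bar>\<phi> y - \<phi> x\<bar> powr r)"
      using trig_periodic[OF \<phi>] by (simp add: periodic_def)
    have "\<bar>\<integral>y. (\<phi> y - \<phi> x) * 1 \<partial>torus\<bar> powr r \<le> (\<integral>y. \<bar>\<phi> y - \<phi> x\<bar> powr r * 1 \<partial>torus)"
      by (rule jensen_powr[OF r]) (use i1 continuous_integrable_torus[OF cc] in auto)
    moreover have "(\<integral>y. \<phi> y - \<phi> x \<partial>torus) = (\<integral>y. \<phi> y \<partial>torus) - \<phi> x" using i1 by simp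
    moreover have "(\<integral>y. \<bar>\<phi> y - \<phi> x\<bar> powr r \<partial>torus) = (\<integral>h. \<bar>\<phi> (x + h) - \<phi> x\<bar> powr r \<partial>torus)"
      using integral_torus_shift[OF cc pp, of x] by (simp add: add.commute)
    ultimately show ?thesis by (simp add: abs_minus_commute)
  qed
  have "(\<integral>x. \<bar>\<phi> x - (\<integral>y. \<phi> y \<partial>torus)\<bar> powr r \<partial>torus) \<le> (\<integral>x. \<integral>h. \<bar>\<phi> (x + h) - \<phi> x\<bar> powr r \<partial>?T \<partial>torus)"
  proof (rule integral_mono)
    show "integrable torus (\<lambda>x. \<bar>\<phi> x - (\<integral>y. \<phi> y \<partial>torus)\<bar> powr r)"
      using r by (intro continuous_integrable_torus continuous_on_powr' continuous_intros c) auto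
    show "integrable torus (\<lambda>x. \<integral>h. \<bar>\<phi> (x + h) - \<phi> x\<bar> powr r \<partial>?T)"
      by (rule fubini_continuous(1)[OF cF])
  qed (rule key)
  also have "\<dots> = (\<integral>h. \<integral>x. \<bar>\<phi> (x + h) - \<phi> x\<bar> powr r \<partial>torus \<partial>?T)"
    by (rule fubini_continuous(3)[OF cF])
  also have "\<dots> \<le> (\<integral>h. real CARD('d) powr r * A \<partial>?T)"
  proof (rule integral_mono)
    show "integrable ?T (\<lambda>h. \<integral>x. \<bar>\<phi> (x + h) - \<phi> x\<bar> powr r \<partial>torus)"
      by (rule fubini_continuous(2)[OF cF])
    \<comment> \<open>In the unit cube the norm of h is at most its l1 norm, hence at most the
      dimension; this is the origin of the Poincare constant.\<close>
    fix h :: "real^'d" assume "h \<in> space torus"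
    then have "\<bar>h $ i\<bar> \<le> 1" for i by (simp add: mem_unit_cube)
    then have "norm h \<le> (\<Sum>i\<in>(UNIV::'d set). 1)"
      by (intro order_trans[OF norm_le_l1_cart] sum_mono)
    then have "norm h powr r \<le> real CARD('d) powr r" using r by (intro powr_mono2) auto
    then show "(\<integral>x. \<bar>\<phi> (x + h) - \<phi> x\<bar> powr r \<partial>torus) \<le> real CARD('d) powr r * A"
      by (intro order_trans[OF step] mult_right_mono A)
  qed simp
  finally show ?thesis by (simp add: A_def)
qed

section \<open>Weak gradients and their test functions\<close>

lemma conv_ker_AE_subseq:
  fixes f :: "real^'d \<Rightarrow> real"
  assumes f: "integrable torus f"
  shows "\<exists>s. strict_mono s \<and> (AE x in torus. (\<lambda>n. conv f (ker (s n)) x) \<longlonglongrightarrow> f x)"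
proof -
  have "Lp 1 f" using f by (simp add: Lp_one_iff)
  then have "(\<lambda>n. \<integral>x. \<bar>conv f (ker n) x - f x\<bar> powr 1 \<partial>torus) \<longlonglongrightarrow> 0"
    by (rule conv_ker_tendsto_Lp) simp
  then have "(\<lambda>n. \<integral>x. norm (conv f (ker n) x - f x) \<partial>torus) \<longlonglongrightarrow> 0" by simp
  moreover have "integrable torus (\<lambda>x. conv f (ker n) x - f x)" for n
    by (intro Bochner_Integration.integrable_diff f continuous_integrable_torus continuous_conv_ker)
  ultimately obtain s where s: "strict_mono s" "AE x in torus. (\<lambda>n. conv f (ker (s n)) x - f x) \<longlonglongrightarrow> 0"
    using tendsto_L1_AE_subseq[of torus "\<lambda>n x. conv f (ker n) x - f x"] by blast
  from s(2) have "AE x in torus. (\<lambda>n. conv f (ker (s n)) x) \<longlonglongrightarrow> f x"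
    by eventually_elim (rule LIM_zero_cancel)
  with s(1) show ?thesis by blast
qed

text \<open>The kernels ker n (x - y) are nonnegative test functions of y, so every mollification of
  f is nonnegative, and a subsequence converges to f almost everywhere.\<close>

lemma AE_nonneg_of_distr:
  fixes f :: "real^'d \<Rightarrow> real"
  assumes f: "integrable torus f"
    and nn: "\<And>\<phi>. torus_test \<phi> \<Longrightarrow> (\<And>x. 0 \<le> \<phi> x) \<Longrightarrow> 0 \<le> (\<integral>x. f x * \<phi> x \<partial>torus)"
  shows "AE x in torus. 0 \<le> f x"
proof -
  obtain s where s: "AE x in torus. (\<lambda>n. conv f (ker (s n)) x) \<longlonglongrightarrow> f x"
    using conv_ker_AE_subseq[OF f] by blast
  have "0 \<le> conv f (ker n) x" for n x
    unfolding conv_def by (intro nn trig_test trig_diff_right trig_ker ker_nonneg)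
  then have nn: "\<exists>N. \<forall>n\<ge>N. 0 \<le> conv f (ker (s n)) x" for x by blast
  from s show ?thesis
    by eventually_elim (rule LIMSEQ_le_const[OF _ nn])
qed

text \<open>Fatou with integrability of the limit as a conclusion, so that uniform bounds on
  approximations raise the integrability of what they approximate.\<close>

lemma fatou_bounded:
  fixes h :: "'a \<Rightarrow> real"
  assumes [measurable]: "h \<in> borel_measurable M"
    and hn: "\<And>n. integrable M (H n)" "\<And>n x. 0 \<le> H n x" "\<And>n. (\<integral>x. H n x \<partial>M) \<le> A"
    and lim: "AE x in M. (\<lambda>n. H n x) \<longlonglongrightarrow> h x"
  shows "integrable M h" and "(\<integral>x. h x \<partial>M) \<le> A"
proof -
  note [measurable] = borel_measurable_integrable[OF hn(1)]
  have A: "0 \<le> A" using order_trans[OF Bochner_Integration.integral_nonneg hn(3)[of 0]] hn(2) by blast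
  have nn: "AE x in M. 0 \<le> h x"
    using lim
  proof eventually_elim
    case (elim x)
    then show ?case by (rule LIMSEQ_le_const) (use hn(2) in blast)
  qed
  have "(\<integral>\<^sup>+x. ennreal (h x) \<partial>M) \<le> (\<integral>\<^sup>+x. liminf (\<lambda>n. ennreal (H n x)) \<partial>M)"
  proof (rule nn_integral_mono_AE)
    show "AE x in M. ennreal (h x) \<le> liminf (\<lambda>n. ennreal (H n x))"
      using lim
    proof eventually_elim
      case (elim x)
      from lim_imp_Liminf[OF trivial_limit_sequentially tendsto_ennrealI[OF elim]]
      show ?case by (simp only: order_refl)
    qed
  qed
  also have "\<dots> \<le> liminf (\<lambda>n. \<integral>\<^sup>+x. ennreal (H n x) \<partial>M)"
    by (rule nn_integral_liminf) measurable
  also have "\<dots> \<le> ennreal A"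
  proof (rule Liminf_le)
    show "\<forall>\<^sub>F n in sequentially. (\<integral>\<^sup>+x. ennreal (H n x) \<partial>M) \<le> ennreal A"
      using hn by (simp add: nn_integral_eq_integral ennreal_leI)
  qed simp
  finally have fin: "(\<integral>\<^sup>+x. ennreal (h x) \<partial>M) \<le> ennreal A" .
  show int: "integrable M h"
  proof (rule integrableI_nonneg)
    show "(\<integral>\<^sup>+x. ennreal (h x) \<partial>M) < \<infinity>"
      using le_less_trans[OF fin ennreal_less_top] by simp
  qed (use nn in auto)
  have "ennreal (\<integral>x. h x \<partial>M) \<le> ennreal A"
    using fin nn_integral_eq_integral[OF int nn] by simp
  then show "(\<integral>x. h x \<partial>M) \<le> A" using A by simp
qed

text \<open>Gradients of mollifications are mollifications of G, hence bounded in L^r by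
  contraction, and Fatou carries the smooth inequality over to f. Order r for f is thereby gained
  from G alone, f being only integrable at the outset; this gain drives the bootstrap.\<close>

lemma poincare_weak:
  fixes f :: "real^'d \<Rightarrow> real"
  assumes w: "has_weak_grad f G" and r: "1 \<le> r" and G: "\<And>i. Lp r (\<lambda>x. G x $ i)"
  shows "Lp r f"
    and "(\<integral>x. \<bar>f x - (\<integral>y. f y \<partial>torus)\<bar> powr r \<partial>torus)
      \<le> real CARD('d) powr (2 * r) * (\<Sum>i\<in>UNIV. \<integral>x. \<bar>G x $ i\<bar> powr r \<partial>torus)"
proof -
  define a where "a = (\<integral>y. f y \<partial>torus)"
  define A where "A = real CARD('d) powr (2 * r) * (\<Sum>i\<in>UNIV. \<integral>x. \<bar>G x $ i\<bar> powr r \<partial>torus)"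
  have f: "integrable torus f" by (rule has_weak_gradD(1)[OF w])
  note [measurable] = borel_measurable_integrable[OF f]
  obtain s where s: "AE x in torus. (\<lambda>n. conv f (ker (s n)) x) \<longlonglongrightarrow> f x"
    using conv_ker_AE_subseq[OF f] by blast
  have tr: "trig (conv f (ker n))" for n using trig_conv[OF f trig_ker] by blast
  have bound: "(\<integral>x. \<bar>conv f (ker n) x - a\<bar> powr r \<partial>torus) \<le> A" for n
  proof -
    have gi: "integrable torus (\<lambda>x. \<bar>grad (conv f (ker n)) x $ i\<bar> powr r)" for i
      unfolding grad_conv_weak[OF w trig_ker] by (rule LpD(2)[OF conv_ker_Lp(1)[OF G r]])
    have "(\<integral>x. norm (grad (conv f (ker n)) x) powr r \<partial>torus)
      \<le> (\<integral>x. real CARD('d) powr r * (\<Sum>i\<in>UNIV. \<bar>grad (conv f (ker n)) x $ i\<bar> powr r) \<partial>torus)"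
    proof (rule integral_mono)
      show "integrable torus (\<lambda>x. norm (grad (conv f (ker n)) x) powr r)"
        using r by (intro continuous_integrable_torus continuous_on_powr' continuous_intros
            continuous_on_grad trig_Ck tr) auto
      show "integrable torus (\<lambda>x. real CARD('d) powr r * (\<Sum>i\<in>UNIV. \<bar>grad (conv f (ker n)) x $ i\<bar> powr r))"
        using gi by (intro integrable_mult_right Bochner_Integration.integrable_sum)
    qed (use r in \<open>auto intro: norm_powr_le_sum\<close>)
    also have "\<dots> = real CARD('d) powr r * (\<Sum>i\<in>UNIV. \<integral>x. \<bar>grad (conv f (ker n)) x $ i\<bar> powr r \<partial>torus)"
      using gi by simp
    also have "\<dots> \<le> real CARD('d) powr r * (\<Sum>i\<in>UNIV. \<integral>x. \<bar>G x $ i\<bar> powr r \<partial>torus)"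
      unfolding grad_conv_weak[OF w trig_ker]
      by (intro mult_left_mono sum_mono conv_ker_Lp(2)[OF G r]) auto
    finally have "real CARD('d) powr r * (\<integral>x. norm (grad (conv f (ker n)) x) powr r \<partial>torus) \<le>
      real CARD('d) powr r * (real CARD('d) powr r * (\<Sum>i\<in>UNIV. \<integral>x. \<bar>G x $ i\<bar> powr r \<partial>torus))"
      by (rule mult_left_mono) simp
    \<comment> \<open>One factor CARD('d)^r comes from \<open>poincare_trig\<close>, the other from
      \<open>norm_powr_le_sum\<close>.\<close>
    also have "\<dots> = A" by (simp add: A_def flip: powr_add)
    finally show ?thesis
      using poincare_trig[OF tr r, of n] by (simp add: integral_conv_ker[OF f] a_def)
  qed
  have 1: "(\<lambda>x. \<bar>f x - a\<bar> powr r) \<in> borel_measurable torus" by measurable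
  have 2: "integrable torus (\<lambda>x. \<bar>conv f (ker (s n)) x - a\<bar> powr r)" for n
    using r by (intro continuous_integrable_torus continuous_on_powr' continuous_intros
        trig_continuous tr) auto
  have 3: "AE x in torus. (\<lambda>n. \<bar>conv f (ker (s n)) x - a\<bar> powr r) \<longlonglongrightarrow> \<bar>f x - a\<bar> powr r"
    using s
  proof eventually_elim
    case (elim x)
    then show ?case using r by (intro tendsto_powr' tendsto_intros) auto
  qed
  note int = fatou_bounded(1)[OF 1 2 _ bound 3] and le = fatou_bounded(2)[OF 1 2 _ bound 3]
  show "(\<integral>x. \<bar>f x - (\<integral>y. f y \<partial>torus)\<bar> powr r \<partial>torus)
      \<le> real CARD('d) powr (2 * r) * (\<Sum>i\<in>UNIV. \<integral>x. \<bar>G x $ i\<bar> powr r \<partial>torus)"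
    using le by (simp add: A_def a_def)
  have "Lp r (\<lambda>x. f x - a)" using int by (simp add: Lp_def)
  from Lp_add[OF _ this Lp_const[of r a]] r show "Lp r f" by simp
qed

section \<open>Hoelder duality and admissible test functions\<close>

lemma Lp_AE_zero:
  assumes f: "Lp r f" and "(\<integral>x. \<bar>f x\<bar> powr r \<partial>torus) = 0"
  shows "AE x in torus. f x = 0"
proof -
  have "AE x in torus. \<bar>f x\<bar> powr r = 0"
    using assms(2) integral_nonneg_eq_0_iff_AE[OF LpD(2)[OF f]] by simp
  then show ?thesis by eventually_elim simp
qed

lemma Lp_mult_integrable:
  assumes pq: "1 < p" "1 < q" "1 / p + 1 / q = 1" and f: "Lp p f" and h: "Lp q h"
  shows "integrable torus (\<lambda>x. f x * h x)"
proof (rule Bochner_Integration.integrable_bound)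
  show "integrable torus (\<lambda>x. \<bar>f x\<bar> powr p / p + \<bar>h x\<bar> powr q / q)"
    using LpD(2)[OF f] LpD(2)[OF h] by simp
  show "(\<lambda>x. f x * h x) \<in> borel_measurable torus" using LpD(1)[OF f] LpD(1)[OF h] by simp
  show "AE x in torus. norm (f x * h x) \<le> norm (\<bar>f x\<bar> powr p / p + \<bar>h x\<bar> powr q / q)"
  proof (rule AE_I2)
    fix x
    have "\<bar>f x\<bar> * \<bar>h x\<bar> \<le> \<bar>f x\<bar> powr p / p + \<bar>h x\<bar> powr q / q"
      by (rule Youngs_inequality[OF pq]) auto
    then show "norm (f x * h x) \<le> norm (\<bar>f x\<bar> powr p / p + \<bar>h x\<bar> powr q / q)"
      by (simp add: abs_mult)
  qed
qed

lemma holder_torus: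
  assumes pq: "1 < p" "1 < q" "1 / p + 1 / q = 1" and f: "Lp p f" and h: "Lp q h"
  shows "(\<integral>x. \<bar>f x * h x\<bar> \<partial>torus)
    \<le> (\<integral>x. \<bar>f x\<bar> powr p \<partial>torus) powr (1 / p) * (\<integral>x. \<bar>h x\<bar> powr q \<partial>torus) powr (1 / q)"
proof -
  define A where "A = (\<integral>x. \<bar>f x\<bar> powr p \<partial>torus)"
  define B where "B = (\<integral>x. \<bar>h x\<bar> powr q \<partial>torus)"
  have nn: "0 \<le> A" "0 \<le> B" by (auto simp: A_def B_def)
  show ?thesis
  proof (cases "A = 0 \<or> B = 0")
    case True
    then have "AE x in torus. \<bar>f x * h x\<bar> = 0"
    proof
      assume "A = 0"
      from Lp_AE_zero[OF f this[unfolded A_def]] show ?thesis by eventually_elim simp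
    next
      assume "B = 0"
      from Lp_AE_zero[OF h this[unfolded B_def]] show ?thesis by eventually_elim simp
    qed
    then have "(\<integral>x. \<bar>f x * h x\<bar> \<partial>torus) = 0" by (rule integral_eq_zero_AE)
    then show ?thesis by simp
  next
    case False
    then have pos: "0 < A" "0 < B" using nn by auto
    define a where "a = A powr (1 / p)"
    define b where "b = B powr (1 / q)"
    have ab: "0 < a" "0 < b" using pos by (auto simp: a_def b_def)
    have apow: "a powr p = A" "b powr q = B"
      using pos pq by (auto simp: a_def b_def powr_powr)
    have "(\<integral>x. \<bar>f x * h x\<bar> \<partial>torus) \<le> (\<integral>x. a * b / (p * A) * \<bar>f x\<bar> powr p + a * b / (q * B) * \<bar>h x\<bar> powr q \<partial>torus)"
    proof (rule integral_mono)
      show "integrable torus (\<lambda>x. \<bar>f x * h x\<bar>)" by (rule integrable_abs[OF Lp_mult_integrable[OF pq f h]])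
      show "integrable torus (\<lambda>x. a * b / (p * A) * \<bar>f x\<bar> powr p + a * b / (q * B) * \<bar>h x\<bar> powr q)"
        using LpD(2)[OF f] LpD(2)[OF h] by simp
      fix x
      have "(\<bar>f x\<bar> / a) * (\<bar>h x\<bar> / b) \<le> (\<bar>f x\<bar> / a) powr p / p + (\<bar>h x\<bar> / b) powr q / q"
        by (rule Youngs_inequality[OF pq]) (use ab in auto)
      also have "\<dots> = \<bar>f x\<bar> powr p / (p * A) + \<bar>h x\<bar> powr q / (q * B)"
        using ab by (simp add: powr_divide apow field_simps)
      finally have "(a * b) * ((\<bar>f x\<bar> / a) * (\<bar>h x\<bar> / b)) \<le> (a * b) * (\<bar>f x\<bar> powr p / (p * A) + \<bar>h x\<bar> powr q / (q * B))"
        using ab by (intro mult_left_mono) auto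
      then show "\<bar>f x * h x\<bar> \<le> a * b / (p * A) * \<bar>f x\<bar> powr p + a * b / (q * B) * \<bar>h x\<bar> powr q"
        using ab by (simp add: abs_mult distrib_left)
    qed
    also have "\<dots> = a * b / (p * A) * A + a * b / (q * B) * B"
      using LpD(2)[OF f] LpD(2)[OF h] by (simp add: A_def B_def)
    also have "\<dots> = a * b * (1 / p + 1 / q)"
      using pos by (simp add: distrib_left)
    also have "\<dots> = a * b" using pq by simp
    finally show ?thesis by (simp add: a_def b_def A_def B_def)
  qed
qed

lemma Lp_pairing_tendsto:
  fixes h :: "real^'d \<Rightarrow> real"
  assumes pq: "1 < p" "1 < q" "1 / p + 1 / q = 1" and f: "Lp p f" and h: "Lp q h"
    and X: "\<And>n. Lp q (X n)" "(\<lambda>n. \<integral>x. \<bar>X n x - h x\<bar> powr q \<partial>torus) \<longlonglongrightarrow> 0"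
  shows "(\<lambda>n. \<integral>x. f x * X n x \<partial>torus) \<longlonglongrightarrow> (\<integral>x. f x * h x \<partial>torus)"
proof -
  define A where "A = (\<integral>x. \<bar>f x\<bar> powr p \<partial>torus) powr (1 / p)"
  have L: "Lp q (\<lambda>x. X n x - h x)" for n using Lp_diff[OF _ X(1) h] pq by auto
  have "(\<lambda>n. A * (\<integral>x. \<bar>X n x - h x\<bar> powr q \<partial>torus) powr (1 / q)) \<longlonglongrightarrow> A * 0 powr (1 / q)"
    using pq by (intro tendsto_mult tendsto_powr' X(2)) auto
  then have lim: "(\<lambda>n. A * (\<integral>x. \<bar>X n x - h x\<bar> powr q \<partial>torus) powr (1 / q)) \<longlonglongrightarrow> 0" by simp
  have "(\<lambda>n. (\<integral>x. f x * X n x \<partial>torus) - (\<integral>x. f x * h x \<partial>torus)) \<longlonglongrightarrow> 0"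
  proof (rule Lim_null_comparison[OF _ lim], rule always_eventually, rule allI)
    fix n
    have "(\<integral>x. f x * X n x \<partial>torus) - (\<integral>x. f x * h x \<partial>torus) = (\<integral>x. f x * (X n x - h x) \<partial>torus)"
      using Lp_mult_integrable[OF pq f X(1)] Lp_mult_integrable[OF pq f h] by (simp add: right_diff_distrib)
    also have "norm \<dots> \<le> (\<integral>x. \<bar>f x * (X n x - h x)\<bar> \<partial>torus)" by simp
    also have "\<dots> \<le> A * (\<integral>x. \<bar>X n x - h x\<bar> powr q \<partial>torus) powr (1 / q)"
      unfolding A_def by (rule holder_torus[OF pq f L])
    finally show "norm ((\<integral>x. f x * X n x \<partial>torus) - (\<integral>x. f x * h x \<partial>torus)) \<le> A * (\<integral>x. \<bar>X n x - h x\<bar> powr q \<partial>torus) powr (1 / q)" .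
  qed
  then show ?thesis by (rule LIM_zero_cancel)
qed

text \<open>Mollification commutes with the weak gradient, so the mollified v and its gradient
  converge in L^q together; w and F have the conjugate exponent, so both pairings pass to the
  limit.\<close>

lemma extend_weak_equation:
  fixes F :: "real^'d \<Rightarrow> real^'d"
  assumes pq: "1 < p" "1 < q" "1 / p + 1 / q = 1"
    and w: "Lp p w" and F: "\<And>i. Lp p (\<lambda>x. F x $ i)"
    and eq: "\<And>\<phi>. torus_test \<phi> \<Longrightarrow> (\<integral>x. w x * \<phi> x + F x \<bullet> grad \<phi> x \<partial>torus) = 0"
    and v: "has_weak_grad v G" "Lp q v" and G: "\<And>i. Lp q (\<lambda>x. G x $ i)"
  shows "integrable torus (\<lambda>x. w x * v x)" "integrable torus (\<lambda>x. F x \<bullet> G x)"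
    "(\<integral>x. w x * v x \<partial>torus) + (\<integral>x. F x \<bullet> G x \<partial>torus) = 0"
proof -
  have q: "1 \<le> q" using pq by simp
  have vi: "integrable torus v" by (rule has_weak_gradD(1)[OF v(1)])
  show int_wv: "integrable torus (\<lambda>x. w x * v x)" by (rule Lp_mult_integrable[OF pq w v(2)])
  show int_FG: "integrable torus (\<lambda>x. F x \<bullet> G x)"
    unfolding inner_vec_def
    using Lp_mult_integrable[OF pq F G] by (intro Bochner_Integration.integrable_sum) simp
  define \<phi> where "\<phi> n = conv v (ker n)" for n
  have g: "grad (\<phi> n) x $ i = conv (\<lambda>y. G y $ i) (ker n) x" for n x i
    unfolding \<phi>_def by (rule grad_conv_weak[OF v(1) trig_ker])
  have L\<phi>: "Lp q (\<phi> n)" for n unfolding \<phi>_def by (rule conv_ker_Lp(1)[OF v(2) q])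
  have Lg: "Lp q (\<lambda>x. grad (\<phi> n) x $ i)" for n i unfolding g by (rule conv_ker_Lp(1)[OF G q])
  have lim1: "(\<lambda>n. \<integral>x. w x * \<phi> n x \<partial>torus) \<longlonglongrightarrow> (\<integral>x. w x * v x \<partial>torus)"
    by (rule Lp_pairing_tendsto[OF pq w v(2) L\<phi>]) (unfold \<phi>_def, rule conv_ker_tendsto_Lp[OF v(2) q])
  have lim2: "(\<lambda>n. \<integral>x. F x $ i * grad (\<phi> n) x $ i \<partial>torus) \<longlonglongrightarrow> (\<integral>x. F x $ i * G x $ i \<partial>torus)" for i
    by (rule Lp_pairing_tendsto[OF pq F G Lg]) (unfold g, rule conv_ker_tendsto_Lp[OF G q])
  have "(\<integral>x. w x * \<phi> n x \<partial>torus) + (\<Sum>i\<in>UNIV. \<integral>x. F x $ i * grad (\<phi> n) x $ i \<partial>torus) = 0" for n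
  proof -
    have "torus_test (\<phi> n)" unfolding \<phi>_def using trig_conv[OF vi trig_ker] trig_test by blast
    from eq[OF this] show ?thesis
      using Lp_mult_integrable[OF pq w L\<phi>] Lp_mult_integrable[OF pq F Lg]
      by (simp add: inner_vec_def)
  qed
  moreover have "(\<lambda>n. (\<integral>x. w x * \<phi> n x \<partial>torus) + (\<Sum>i\<in>UNIV. \<integral>x. F x $ i * grad (\<phi> n) x $ i \<partial>torus))
      \<longlonglongrightarrow> (\<integral>x. w x * v x \<partial>torus) + (\<Sum>i\<in>UNIV. \<integral>x. F x $ i * G x $ i \<partial>torus)"
    by (intro tendsto_add tendsto_sum lim1 lim2)
  ultimately have "(\<integral>x. w x * v x \<partial>torus) + (\<Sum>i\<in>UNIV. \<integral>x. F x $ i * G x $ i \<partial>torus) = 0"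
    using LIMSEQ_unique[OF _ tendsto_const[of 0]] by simp
  then show "(\<integral>x. w x * v x \<partial>torus) + (\<integral>x. F x \<bullet> G x \<partial>torus) = 0"
    using Lp_mult_integrable[OF pq F G] by (simp add: inner_vec_def)
qed

section \<open>A priori bounds and weak convergence\<close>

text \<open>Young's inequality with exponents a / p and b / p. It determines the Lebesgue class of
  the fluxes.\<close>

lemma Lp_mult:
  assumes p: "0 < p" "p < a" "p < b" "1 / a + 1 / b = 1 / p" and f: "Lp a f" and h: "Lp b h"
  shows "Lp p (\<lambda>x. f x * h x)"
proof (rule Lp_bound)
  show "(\<lambda>x. f x * h x) \<in> borel_measurable torus" using LpD(1)[OF f] LpD(1)[OF h] by simp
  show "integrable torus (\<lambda>x. \<bar>f x\<bar> powr a / (a / p) + \<bar>h x\<bar> powr b / (b / p))"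
    using LpD(2)[OF f] LpD(2)[OF h] by simp
  show "AE x in torus. \<bar>f x * h x\<bar> powr p \<le> \<bar>f x\<bar> powr a / (a / p) + \<bar>h x\<bar> powr b / (b / p)"
  proof (rule AE_I2)
    fix x
    have "1 / (a / p) + 1 / (b / p) = p * (1 / a + 1 / b)" using p by (simp add: field_simps)
    also have "\<dots> = 1" unfolding p(4) using p(1) by simp
    finally have "\<bar>f x\<bar> powr p * \<bar>h x\<bar> powr p \<le> (\<bar>f x\<bar> powr p) powr (a / p) / (a / p) + (\<bar>h x\<bar> powr p) powr (b / p) / (b / p)"
      using p by (intro Youngs_inequality) auto
    then show "\<bar>f x * h x\<bar> powr p \<le> \<bar>f x\<bar> powr a / (a / p) + \<bar>h x\<bar> powr b / (b / p)"
      using p by (simp add: abs_mult powr_mult powr_powr)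
  qed
qed

lemma sum3_powr_le:
  fixes a b c q :: real
  assumes "0 \<le> a" "0 \<le> b" "0 \<le> c" "0 \<le> q"
  shows "(a + b + c) powr q \<le> 3 powr q * (a powr q + b powr q + c powr q)"
proof -
  have "(a + b + c) powr q \<le> (3 * max a (max b c)) powr q"
    using assms by (intro powr_mono2) auto
  also have "\<dots> = 3 powr q * max a (max b c) powr q" by (rule powr_mult)
  also have "\<dots> \<le> 3 powr q * (a powr q + b powr q + c powr q)"
    by (intro mult_left_mono) (auto simp: max_def)
  finally show ?thesis .
qed

text \<open>The pointwise bound is raised to the power q; the exponent doubles because the gradient
  enters squared. The upper limit on q is the order to which m^\<alpha> is integrable.\<close>

lemma gradient_bootstrap_step:
  fixes v m :: "real^'d \<Rightarrow> real"
  assumes w: "has_weak_grad v G" and \<alpha>: "0 < \<alpha>" and m: "Lp (\<alpha> + 1) m" and K: "0 \<le> K"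
    and b: "AE x in torus. (norm (G x))\<^sup>2 \<le> K * (1 + \<bar>v x\<bar> + \<bar>m x\<bar> powr \<alpha>)"
    and q: "1 \<le> q" "q \<le> (\<alpha> + 1) / \<alpha>" and v: "Lp q v"
  shows "Lp (2 * q) (\<lambda>x. G x $ i)"
    and "(\<integral>x. \<bar>G x $ i\<bar> powr (2 * q) \<partial>torus)
      \<le> (3 * K) powr q * (1 + (\<integral>x. \<bar>v x\<bar> powr q \<partial>torus) + (\<integral>x. \<bar>m x\<bar> powr (\<alpha> * q) \<partial>torus))"
proof -
  have Lm: "Lp (\<alpha> * q) m"
    by (rule Lp_mono[OF m]) (use \<alpha> q in \<open>auto simp: field_simps\<close>)
  have meas: "(\<lambda>x. G x $ i) \<in> borel_measurable torus"
    using borel_measurable_integrable[OF has_weak_gradD(2)[OF w]]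
    by (auto intro: measurable_compose[OF _ borel_measurable_nth])
  define h where "h x = (3 * K) powr q * (1 + \<bar>v x\<bar> powr q + \<bar>m x\<bar> powr (\<alpha> * q))" for x
  have hi: "integrable torus h"
    unfolding h_def using LpD(2)[OF v] LpD(2)[OF Lm] by simp
  have le: "AE x in torus. \<bar>G x $ i\<bar> powr (2 * q) \<le> h x"
    using b
  proof eventually_elim
    case (elim x)
    have "\<bar>G x $ i\<bar> powr (2 * q) = (\<bar>G x $ i\<bar> powr 2) powr q" by (simp only: powr_powr)
    also have "\<bar>G x $ i\<bar> powr 2 = \<bar>G x $ i\<bar>\<^sup>2" by simp
    also have "(\<bar>G x $ i\<bar>\<^sup>2) powr q \<le> ((norm (G x))\<^sup>2) powr q"
      using q component_le_norm_cart[of "G x" i] by (intro powr_mono2 power_mono) auto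
    also have "\<dots> \<le> (K * (1 + \<bar>v x\<bar> + \<bar>m x\<bar> powr \<alpha>)) powr q"
      using elim q by (intro powr_mono2) auto
    also have "\<dots> = K powr q * (1 + \<bar>v x\<bar> + \<bar>m x\<bar> powr \<alpha>) powr q" by (rule powr_mult)
    also have "\<dots> \<le> K powr q * (3 powr q * (1 powr q + \<bar>v x\<bar> powr q + (\<bar>m x\<bar> powr \<alpha>) powr q))"
      using q by (intro mult_left_mono sum3_powr_le) auto
    also have "\<dots> = h x" by (simp add: h_def powr_mult powr_powr)
    finally show ?case .
  qed
  show L: "Lp (2 * q) (\<lambda>x. G x $ i)" by (rule Lp_bound[OF meas hi le])
  have "(\<integral>x. \<bar>G x $ i\<bar> powr (2 * q) \<partial>torus) \<le> (\<integral>x. h x \<partial>torus)"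
    by (rule integral_mono_AE[OF LpD(2)[OF L] hi le])
  also have "\<dots> = (3 * K) powr q * (1 + (\<integral>x. \<bar>v x\<bar> powr q \<partial>torus) + (\<integral>x. \<bar>m x\<bar> powr (\<alpha> * q) \<partial>torus))"
    unfolding h_def using LpD(2)[OF v] LpD(2)[OF Lm] by simp
  finally show "(\<integral>x. \<bar>G x $ i\<bar> powr (2 * q) \<partial>torus)
      \<le> (3 * K) powr q * (1 + (\<integral>x. \<bar>v x\<bar> powr q \<partial>torus) + (\<integral>x. \<bar>m x\<bar> powr (\<alpha> * q) \<partial>torus))" .
qed

text \<open>Integrability comes first, the bound second. The integral X of order s satisfies X \<le>
  Q (1 + Y + D), where Y has order s/2 and is at most \<eta> X + 1/\<eta>, so X can be absorbed. Q
  is the Poincare constant times the number of components times the factor of the gradient step; the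
  bound thus depends only on the dimension, \<alpha>, K and D.\<close>

lemma gradient_bootstrap:
  fixes v m :: "real^'d \<Rightarrow> real"
  assumes w: "has_weak_grad v G" and mf: "(\<integral>x. v x \<partial>torus) = 0"
    and \<alpha>: "0 < \<alpha>" and m: "Lp (\<alpha> + 1) m" and K: "0 \<le> K"
    and b: "AE x in torus. (norm (G x))\<^sup>2 \<le> K * (1 + \<bar>v x\<bar> + \<bar>m x\<bar> powr \<alpha>)"
    and D: "(\<integral>x. \<bar>m x\<bar> powr (\<alpha> + 1) \<partial>torus) \<le> D"
  defines "s \<equiv> 2 * ((\<alpha> + 1) / \<alpha>)"
  defines "Q \<equiv> real CARD('d) powr (2 * s) * (real CARD('d) * (3 * K) powr (s / 2))"
  shows "Lp s v" "Lp s (\<lambda>x. G x $ i)"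
    and "(\<integral>x. \<bar>v x\<bar> powr s \<partial>torus) \<le> 2 * Q * (1 + 2 * (Q + 1) + D)"
proof -
  define p where "p = (\<alpha> + 1) / \<alpha>"
  have p: "1 < p" "s = 2 * p" using \<alpha> by (auto simp: p_def s_def field_simps)
  have vi: "integrable torus v" by (rule has_weak_gradD(1)[OF w])
  \<comment> \<open>Purely qualitative: no constants are carried through the induction. It starts
    from plain integrability, 2^0 = 1, and the exponent is capped at p.\<close>
  have "Lp (min (2 ^ n) p) v" for n
  proof (induction n)
    case 0
    then show ?case using p(1) vi by (simp add: Lp_one_iff)
  next
    case (Suc n)
    let ?q = "min (2 ^ n) p"
    have q: "1 \<le> ?q" "?q \<le> (\<alpha> + 1) / \<alpha>" using p by (auto simp: p_def)
    have "1 \<le> 2 * ?q" using q(1) by linarith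
    then have "Lp (2 * ?q) v"
      by (rule poincare_weak(1)[OF w _ gradient_bootstrap_step(1)[OF w \<alpha> m K b q Suc]])
    then show ?case
      by (rule Lp_mono) (use p(1) in \<open>auto simp: min_def\<close>)
  qed
  moreover obtain n where "p < 2 ^ n" using real_arch_pow[of 2 p] by auto
  ultimately have vp: "Lp p v" by (metis less_imp_le min.absorb2)
  have q: "1 \<le> p" "p \<le> (\<alpha> + 1) / \<alpha>" using p by (auto simp: p_def)
  note G = gradient_bootstrap_step[OF w \<alpha> m K b q vp, folded p(2)]
  show "Lp s (\<lambda>x. G x $ i)" by (rule G(1))
  have s1: "1 \<le> s" using p by simp
  show vs: "Lp s v" by (rule poincare_weak(1)[OF w s1 G(1)])
  define X where "X = (\<integral>x. \<bar>v x\<bar> powr s \<partial>torus)"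
  define Y where "Y = (\<integral>x. \<bar>v x\<bar> powr p \<partial>torus)"
  \<comment> \<open>Chosen so that \<open>Q * \<eta>\<close> is at most 1/2; the \<open>+ 1\<close>
    avoids division by zero when Q = 0.\<close>
  define \<eta> where "\<eta> = 1 / (2 * (Q + 1))"
  have Q: "0 \<le> Q" by (simp add: Q_def)
  then have \<eta>: "0 < \<eta>" by (simp add: \<eta>_def)
  have X0: "0 \<le> X" by (simp add: X_def)
  have "Y \<le> (\<integral>x. \<eta> * \<bar>v x\<bar> powr s + 1 / \<eta> \<partial>torus)"
    unfolding Y_def
  proof (rule integral_mono)
    fix x
    define t where "t = \<bar>v x\<bar> powr p"
    have t: "\<bar>v x\<bar> powr s = t\<^sup>2" unfolding t_def p(2) power2_eq_square by (simp flip: powr_add)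
    have "0 \<le> (\<eta> * t - 1)\<^sup>2" by simp
    then have "2 * (\<eta> * t) \<le> \<eta> * (\<eta> * t\<^sup>2) + 1" by (simp add: power2_eq_square algebra_simps)
    moreover have "0 \<le> \<eta> * t" using \<eta> by (simp add: t_def)
    ultimately have "\<eta> * t \<le> \<eta> * (\<eta> * t\<^sup>2 + 1 / \<eta>)" using \<eta> by (simp add: distrib_left)
    then show "\<bar>v x\<bar> powr p \<le> \<eta> * \<bar>v x\<bar> powr s + 1 / \<eta>"
      unfolding t using \<eta> by (simp add: t_def)
  qed (use LpD(2)[OF vs] LpD(2)[OF vp] in auto)
  also have "\<dots> = \<eta> * X + 1 / \<eta>" using LpD(2)[OF vs] by (simp add: X_def)
  finally have Y: "Y \<le> \<eta> * X + 1 / \<eta>" .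
  have ap: "\<alpha> * p = \<alpha> + 1" using \<alpha> by (simp add: p_def)
  have "X \<le> real CARD('d) powr (2 * s) * (\<Sum>i\<in>UNIV. \<integral>x. \<bar>G x $ i\<bar> powr s \<partial>torus)"
    using poincare_weak(2)[OF w s1 G(1)] by (simp add: X_def mf)
  also have "\<dots> \<le> real CARD('d) powr (2 * s) * (\<Sum>i\<in>(UNIV::'d set). (3 * K) powr p * (1 + Y + D))"
    using G(2) D unfolding ap Y_def
    by (intro mult_left_mono sum_mono order_trans[OF G(2)]) (auto simp: ap intro!: mult_left_mono)
  also have "\<dots> = Q * (1 + Y + D)" by (simp add: Q_def p(2))
  also have "\<dots> \<le> Q * (1 + (\<eta> * X + 1 / \<eta>) + D)" by (intro mult_left_mono Q add_mono Y) auto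
  also have "\<dots> = (Q * \<eta>) * X + Q * (1 + 2 * (Q + 1) + D)"
    using Q by (simp add: \<eta>_def algebra_simps)
  also have "(Q * \<eta>) * X \<le> 1 / 2 * X"
    using Q X0 by (intro mult_right_mono) (auto simp: \<eta>_def field_simps)
  finally show "(\<integral>x. \<bar>v x\<bar> powr s \<partial>torus) \<le> 2 * Q * (1 + 2 * (Q + 1) + D)"
    by (simp add: X_def)
qed

text \<open>Convergence is given against bounded functions only. The L^q bound keeps the pairing of
  \<open>X e\<close> with Z below \<open>N Z\<close>, the limit l inherits this bound, and
  truncating Y leaves a tail whose pairings are uniformly small.\<close>

lemma weak_pairing_tendsto:
  fixes X :: "'e \<Rightarrow> real^'d \<Rightarrow> real"
  assumes pq: "1 < p" "1 < q" "1 / p + 1 / q = 1" and Y: "Lp p Y"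
    and F: "F \<noteq> bot"
    and X: "\<forall>\<^sub>F e in F. Lp q (X e) \<and> (\<integral>x. \<bar>X e x\<bar> powr q \<partial>torus) \<le> R"
    and l: "integrable torus l"
    and lim: "\<And>b B. b \<in> borel_measurable torus \<Longrightarrow> (\<And>x. \<bar>b x\<bar> \<le> B) \<Longrightarrow>
      ((\<lambda>e. \<integral>x. b x * X e x \<partial>torus) \<longlongrightarrow> (\<integral>x. b x * l x \<partial>torus)) F"
  shows "integrable torus (\<lambda>x. Y x * l x)"
    and "((\<lambda>e. \<integral>x. Y x * X e x \<partial>torus) \<longlongrightarrow> (\<integral>x. Y x * l x \<partial>torus)) F"
proof -
  note [measurable] = borel_measurable_integrable[OF l] LpD(1)[OF Y]
  define N where "N Z = (\<integral>x. \<bar>Z x\<bar> powr p \<partial>torus) powr (1 / p) * R powr (1 / q)" for Z :: "real^'d \<Rightarrow> real"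
  have pairX: "\<forall>\<^sub>F e in F. \<bar>\<integral>x. Z x * X e x \<partial>torus\<bar> \<le> N Z" if "Lp p Z" for Z
    using X
  proof eventually_elim
    case (elim e)
    have "\<bar>\<integral>x. Z x * X e x \<partial>torus\<bar> \<le> (\<integral>x. \<bar>Z x * X e x\<bar> \<partial>torus)" by (rule integral_abs_bound)
    also have "\<dots> \<le> (\<integral>x. \<bar>Z x\<bar> powr p \<partial>torus) powr (1 / p) * (\<integral>x. \<bar>X e x\<bar> powr q \<partial>torus) powr (1 / q)"
      by (rule holder_torus[OF pq that]) (use elim in auto)
    also have "\<dots> \<le> N Z"
      unfolding N_def using elim pq by (intro mult_left_mono powr_mono2) auto
    finally show ?case .
  qed
  have pairl: "integrable torus (\<lambda>x. \<bar>Z x\<bar> * \<bar>l x\<bar>)" "(\<integral>x. \<bar>Z x\<bar> * \<bar>l x\<bar> \<partial>torus) \<le> N Z" if Z: "Lp p Z" for Z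
  proof -
    note [measurable] = LpD(1)[OF Z]
    \<comment> \<open>The sign of l turns the pairing with the limit into an integral of |Z| |l|
      truncated in Z; Fatou removes the truncation, without prior knowledge of l in L^q.\<close>
    define b where "b n x = sgn (l x) * clip (real n) \<bar>Z x\<bar>" for n x
    have bm: "b n \<in> borel_measurable torus" for n unfolding b_def by measurable
    have clipnn: "0 \<le> clip (real n) \<bar>t\<bar>" for n t by (simp add: clip_def)
    have bb: "\<bar>b n x\<bar> \<le> real n" for n x
      unfolding b_def abs_mult using clip_bound[of "real n" "\<bar>Z x\<bar>"]
      by (auto simp: abs_sgn_eq)
    have bZ: "\<bar>b n x\<bar> \<le> \<bar>Z x\<bar>" for n x
      unfolding b_def abs_mult using clip_le[of "real n" "\<bar>Z x\<bar>"]
      by (auto simp: abs_sgn_eq)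
    have bl: "b n x * l x = clip (real n) \<bar>Z x\<bar> * \<bar>l x\<bar>" for n x
      by (simp add: b_def abs_sgn mult_ac)
    have 1: "(\<lambda>x. \<bar>Z x\<bar> * \<bar>l x\<bar>) \<in> borel_measurable torus" by measurable
    have 2: "integrable torus (\<lambda>x. clip (real n) \<bar>Z x\<bar> * \<bar>l x\<bar>)" for n
      using integrable_bounded_mult_torus[OF l bm bb, of n] by (simp add: mult.commute[of "l _"] bl)
    have 3: "(\<integral>x. clip (real n) \<bar>Z x\<bar> * \<bar>l x\<bar> \<partial>torus) \<le> N Z" for n
    proof -
      have Lb: "Lp p (b n)"
        by (rule Lp_bounded[OF bm _]) (use bb pq in auto)
      have "(\<integral>x. \<bar>b n x\<bar> powr p \<partial>torus) \<le> (\<integral>x. \<bar>Z x\<bar> powr p \<partial>torus)"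
        using pq bZ by (intro integral_mono LpD(2) Lb Z powr_mono2) auto
      then have "N (b n) \<le> N Z"
        unfolding N_def using pq by (intro mult_right_mono powr_mono2) auto
      with pairX[OF Lb] have "\<forall>\<^sub>F e in F. (\<integral>x. b n x * X e x \<partial>torus) \<le> N Z"
        by (auto elim!: eventually_mono)
      from tendsto_upperbound[OF lim[OF bm bb] this F] show ?thesis by (simp add: bl)
    qed
    have 4: "AE x in torus. (\<lambda>n. clip (real n) \<bar>Z x\<bar> * \<bar>l x\<bar>) \<longlonglongrightarrow> \<bar>Z x\<bar> * \<bar>l x\<bar>"
    proof (rule AE_I2)
      fix x
      have "\<forall>\<^sub>F n in sequentially. \<bar>Z x\<bar> * \<bar>l x\<bar> = clip (real n) \<bar>Z x\<bar> * \<bar>l x\<bar>"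
        using eventually_ge_at_top[of "nat \<lceil>\<bar>Z x\<bar>\<rceil>"]
      proof eventually_elim
        case (elim n)
        then have "\<bar>\<bar>Z x\<bar>\<bar> \<le> real n" by linarith
        then show ?case by (simp add: clip_eq)
      qed
      then show "(\<lambda>n. clip (real n) \<bar>Z x\<bar> * \<bar>l x\<bar>) \<longlonglongrightarrow> \<bar>Z x\<bar> * \<bar>l x\<bar>"
        by (rule Lim_transform_eventually[OF tendsto_const])
    qed
    have 5: "0 \<le> clip (real n) \<bar>Z x\<bar> * \<bar>l x\<bar>" for n x using clipnn by simp
    show "integrable torus (\<lambda>x. \<bar>Z x\<bar> * \<bar>l x\<bar>)" "(\<integral>x. \<bar>Z x\<bar> * \<bar>l x\<bar> \<partial>torus) \<le> N Z"
      using fatou_bounded[OF 1 2 5 3 4] by auto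
  qed
  have int: "integrable torus (\<lambda>x. Z x * l x)" if Z: "Lp p Z" for Z
    by (rule Bochner_Integration.integrable_bound[OF pairl(1)[OF Z]])
      (use LpD(1)[OF Z] in \<open>auto simp: abs_mult\<close>)
  show "integrable torus (\<lambda>x. Y x * l x)" by (rule int[OF Y])
  show "((\<lambda>e. \<integral>x. Y x * X e x \<partial>torus) \<longlongrightarrow> (\<integral>x. Y x * l x \<partial>torus)) F"
  proof (rule tendstoI)
    fix \<epsilon> :: real assume \<epsilon>: "0 < \<epsilon>"
    \<comment> \<open>The tail of Y above height k, small in L^p. The error splits into a bounded
      test function and two tail pairings, a third of \<epsilon> each.\<close>
    define Z where "Z k x = Y x - clip (real k) (Y x)" for k x
    have Lc: "Lp p (\<lambda>x. clip (real k) (Y x))" for k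
      by (rule Lp_bounded[of _ "real k"]) (use pq clip_bound in auto)
    have LZ: "Lp p (Z k)" for k unfolding Z_def[abs_def] by (rule Lp_diff[OF _ Y Lc]) (use pq in auto)
    have "(\<lambda>k. \<integral>x. \<bar>Z k x\<bar> powr p \<partial>torus) \<longlonglongrightarrow> 0"
      unfolding Z_def using clip_tendsto_Lp[OF Y] pq by (simp add: abs_minus_commute)
    then have "(\<lambda>k. N (Z k)) \<longlonglongrightarrow> 0 powr (1 / p) * R powr (1 / q)"
      unfolding N_def using pq by (intro tendsto_mult tendsto_powr' tendsto_const) auto
    then have "\<forall>\<^sub>F k in sequentially. N (Z k) < \<epsilon> / 3"
      using \<epsilon> by (intro order_tendstoD(2)) auto
    then obtain k where k: "N (Z k) < \<epsilon> / 3" by (auto simp: eventually_sequentially)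
    define b where "b x = clip (real k) (Y x)" for x
    have "((\<lambda>e. \<integral>x. b x * X e x \<partial>torus) \<longlongrightarrow> (\<integral>x. b x * l x \<partial>torus)) F"
      unfolding b_def by (rule lim[of _ "real k"]) (auto simp: clip_bound)
    from tendstoD[OF this, of "\<epsilon> / 3"] \<epsilon>
    have "\<forall>\<^sub>F e in F. dist (\<integral>x. b x * X e x \<partial>torus) (\<integral>x. b x * l x \<partial>torus) < \<epsilon> / 3" by simp
    then show "\<forall>\<^sub>F e in F. dist (\<integral>x. Y x * X e x \<partial>torus) (\<integral>x. Y x * l x \<partial>torus) < \<epsilon>"
      using X pairX[OF LZ[of k]]
    proof eventually_elim
      case (elim e)
      have s1: "(\<integral>x. Y x * X e x \<partial>torus) = (\<integral>x. b x * X e x \<partial>torus) + (\<integral>x. Z k x * X e x \<partial>torus)"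
      proof -
        have "(\<integral>x. b x * X e x \<partial>torus) + (\<integral>x. Z k x * X e x \<partial>torus) = (\<integral>x. b x * X e x + Z k x * X e x \<partial>torus)"
          using Lp_mult_integrable[OF pq Lc[of k]] Lp_mult_integrable[OF pq LZ[of k]] elim
          by (simp add: b_def)
        then show ?thesis by (simp add: b_def Z_def flip: distrib_right)
      qed
      have s2: "(\<integral>x. Y x * l x \<partial>torus) = (\<integral>x. b x * l x \<partial>torus) + (\<integral>x. Z k x * l x \<partial>torus)"
      proof -
        have "(\<integral>x. b x * l x \<partial>torus) + (\<integral>x. Z k x * l x \<partial>torus) = (\<integral>x. b x * l x + Z k x * l x \<partial>torus)"
          using int[OF Lc[of k]] int[OF LZ[of k]] by (simp add: b_def)
        then show ?thesis by (simp add: b_def Z_def flip: distrib_right)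
      qed
      have "\<bar>\<integral>x. Z k x * l x \<partial>torus\<bar> \<le> (\<integral>x. \<bar>Z k x * l x\<bar> \<partial>torus)" by (rule integral_abs_bound)
      also have "\<dots> \<le> N (Z k)" using pairl(2)[OF LZ[of k]] by (simp add: abs_mult)
      finally have "\<bar>\<integral>x. Z k x * l x \<partial>torus\<bar> \<le> N (Z k)" .
      then show ?case using elim k unfolding s1 s2 dist_real_def by linarith
    qed
  qed
qed

lemma weak_tendsto_L1_pairing:
  fixes b :: "real^'d \<Rightarrow> real"
  assumes w: "weak_tendsto torus_L1 L1_norm f l F"
    and b: "b \<in> borel_measurable torus" "\<And>x. \<bar>b x\<bar> \<le> B"
  shows "((\<lambda>e. \<integral>x. b x * f e x \<partial>torus) \<longlongrightarrow> (\<integral>x. b x * l x \<partial>torus)) F"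
proof -
  have int: "integrable torus (\<lambda>x. b x * h x)" if "integrable torus h" for h
    using integrable_bounded_mult_torus[OF that b(1) b(2)] by (simp add: mult.commute)
  have "bounded_functional_on torus_L1 L1_norm (\<lambda>h. \<integral>x. b x * h x \<partial>torus)"
    unfolding bounded_functional_on_def
  proof (intro conjI ballI allI exI)
    fix f h :: "real^'d \<Rightarrow> real" assume "f \<in> torus_L1" "h \<in> torus_L1"
    then show "(\<integral>x. b x * (f x + h x) \<partial>torus) = (\<integral>x. b x * f x \<partial>torus) + (\<integral>x. b x * h x \<partial>torus)"
      using int by (simp add: torus_L1_def distrib_left)
  next
    fix c and h :: "real^'d \<Rightarrow> real"
    show "(\<integral>x. b x * (c * h x) \<partial>torus) = c * (\<integral>x. b x * h x \<partial>torus)"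
      by (simp only: mult.left_commute[of _ c] integral_mult_right_zero)
  next
    fix h :: "real^'d \<Rightarrow> real" assume h: "h \<in> torus_L1"
    have "\<bar>\<integral>x. b x * h x \<partial>torus\<bar> \<le> (\<integral>x. \<bar>b x * h x\<bar> \<partial>torus)" by (rule integral_abs_bound)
    also have "\<dots> \<le> (\<integral>x. B * \<bar>h x\<bar> \<partial>torus)"
      using h b(2)
      by (intro integral_mono[OF integrable_abs[OF int]]) (auto simp: torus_L1_def abs_mult intro: mult_right_mono)
    finally show "\<bar>\<integral>x. b x * h x \<partial>torus\<bar> \<le> B * L1_norm h" by (simp add: L1_norm_def)
  qed
  with w show ?thesis unfolding weak_tendsto_def by blast
qed

lemma W12_integrable: "h \<in> torus_W12 \<Longrightarrow> integrable torus h"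
  unfolding torus_W12_def using has_weak_gradD(1) by blast

text \<open>Jensen on a space of measure 1. It makes integration against a bounded function a
  bounded functional on \<open>torus_W12\<close>.\<close>

lemma integral_abs_le_W12_norm:
  assumes h: "h \<in> torus_W12"
  shows "(\<integral>x. \<bar>h x\<bar> \<partial>torus) \<le> W12_norm h"
proof -
  have i: "integrable torus h" "integrable torus (\<lambda>x. (h x)\<^sup>2)"
    using W12_integrable[OF h] h by (auto simp: torus_W12_def)
  have "\<bar>\<integral>x. \<bar>h x\<bar> * 1 \<partial>torus\<bar> powr 2 \<le> (\<integral>x. \<bar>\<bar>h x\<bar>\<bar> powr 2 * 1 \<partial>torus)"
    by (rule jensen_powr) (use i in auto)
  then have "(\<integral>x. \<bar>h x\<bar> \<partial>torus)\<^sup>2 \<le> (\<integral>x. (h x)\<^sup>2 \<partial>torus)" by simp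
  also have "\<dots> \<le> (\<integral>x. (h x)\<^sup>2 \<partial>torus) + (\<integral>x. (norm (weak_grad h x))\<^sup>2 \<partial>torus)" by simp
  finally show ?thesis unfolding W12_norm_def by (rule real_le_rsqrt)
qed

lemma weak_tendsto_W12_pairing:
  fixes b :: "real^'d \<Rightarrow> real"
  assumes w: "weak_tendsto torus_W12 W12_norm f l F"
    and b: "b \<in> borel_measurable torus" "\<And>x. \<bar>b x\<bar> \<le> B"
  shows "((\<lambda>e. \<integral>x. b x * f e x \<partial>torus) \<longlongrightarrow> (\<integral>x. b x * l x \<partial>torus)) F"
proof -
  have int: "integrable torus (\<lambda>x. b x * h x)" if "h \<in> torus_W12" for h
    using integrable_bounded_mult_torus[OF W12_integrable[OF that] b(1) b(2)] by (simp add: mult.commute)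
  have "bounded_functional_on torus_W12 W12_norm (\<lambda>h. \<integral>x. b x * h x \<partial>torus)"
    unfolding bounded_functional_on_def
  proof (intro conjI ballI allI exI)
    fix f h :: "real^'d \<Rightarrow> real" assume "f \<in> torus_W12" "h \<in> torus_W12"
    then show "(\<integral>x. b x * (f x + h x) \<partial>torus) = (\<integral>x. b x * f x \<partial>torus) + (\<integral>x. b x * h x \<partial>torus)"
      using int by (simp add: distrib_left)
  next
    fix c and h :: "real^'d \<Rightarrow> real"
    show "(\<integral>x. b x * (c * h x) \<partial>torus) = c * (\<integral>x. b x * h x \<partial>torus)"
      by (simp only: mult.left_commute[of _ c] integral_mult_right_zero)
  next
    fix h :: "real^'d \<Rightarrow> real" assume h: "h \<in> torus_W12"
    have B: "0 \<le> B" using b(2)[of undefined] by linarith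
    have "\<bar>\<integral>x. b x * h x \<partial>torus\<bar> \<le> (\<integral>x. \<bar>b x * h x\<bar> \<partial>torus)" by (rule integral_abs_bound)
    also have "\<dots> \<le> (\<integral>x. B * \<bar>h x\<bar> \<partial>torus)"
      using W12_integrable[OF h] b(2)
      by (intro integral_mono[OF integrable_abs[OF int[OF h]]]) (auto simp: abs_mult intro: mult_right_mono)
    also have "\<dots> \<le> B * W12_norm h"
      using mult_left_mono[OF integral_abs_le_W12_norm[OF h] B] by simp
    finally show "\<bar>\<integral>x. b x * h x \<partial>torus\<bar> \<le> B * W12_norm h" .
  qed
  with w show ?thesis unfolding weak_tendsto_def by blast
qed

section \<open>The coupling\<close>

locale coupling =
  fixes g :: "real \<Rightarrow> ereal" and \<alpha> c1 c2 :: real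
  assumes ne_inf: "\<And>t. 0 \<le> t \<Longrightarrow> g t \<noteq> \<infinity>"
    and mono: "strict_mono_on {0..} g"
    and diffble: "\<And>t. 0 < t \<Longrightarrow> (\<lambda>t. real_of_ereal (g t)) differentiable (at t)"
    and c1: "0 < c1"
    and deriv_bounds: "\<And>t. 0 < t \<Longrightarrow> c1 * t powr (\<alpha> - 1) \<le> deriv (\<lambda>s. real_of_ereal (g s)) t \<and>
           deriv (\<lambda>s. real_of_ereal (g s)) t \<le> c2 * t powr (\<alpha> - 1)"
    and alpha: "0 < \<alpha>"
begin

definition gr :: "real \<Rightarrow> real" where "gr t = real_of_ereal (g t)"

text \<open>\<open>real_of_ereal\<close> sends -infinity to the default 0, so values of
  \<open>gr\<close> are meaningful only under \<open>fin\<close>. Among t \<ge> 0 only t = 0 can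
  fail, since g 0 may be -infinity.\<close>

definition fin :: "real \<Rightarrow> bool" where "fin t \<longleftrightarrow> 0 \<le> t \<and> g t = ereal (gr t)"

lemma fin_pos:
  assumes "0 < t"
  shows "fin t"
proof -
  have "g 0 < g t" using mono assms by (auto simp: strict_mono_on_def)
  then have "g t \<noteq> -\<infinity>" by auto
  moreover have "g t \<noteq> \<infinity>" using ne_inf assms by simp
  ultimately show ?thesis using assms by (cases "g t") (auto simp: fin_def gr_def)
qed

lemma gr_less:
  assumes "fin s" "fin t" "s < t"
  shows "gr s < gr t"
proof -
  have "0 \<le> s" "0 \<le> t" using assms by (auto simp: fin_def)
  then have "g s < g t" using mono assms(3) unfolding strict_mono_on_def by (metis atLeast_iff)
  moreover have "g s = ereal (gr s)" "g t = ereal (gr t)" using assms by (auto simp: fin_def)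
  ultimately show ?thesis by simp
qed

lemma gr_le: "fin s \<Longrightarrow> fin t \<Longrightarrow> s \<le> t \<Longrightarrow> gr s \<le> gr t"
  using gr_less[of s t] by (cases "s = t") auto

lemma gr_mult_nonneg:
  assumes "fin s" "fin t"
  shows "0 \<le> (gr s - gr t) * (s - t)"
  using gr_le[of s t] gr_le[of t s] assms by (cases "s \<le> t") (auto intro: mult_nonpos_nonpos)

lemma gr_deriv: "0 < t \<Longrightarrow> (gr has_real_derivative deriv gr t) (at t)"
  using diffble[of t] unfolding gr_def[abs_def]
  by (simp add: DERIV_deriv_iff_real_differentiable)

lemma gr_upper:
  assumes "0 < s" "s \<le> t"
  shows "gr t - gr s \<le> c2 / \<alpha> * (t powr \<alpha> - s powr \<alpha>)"
proof -
  define f where "f x = gr x - c2 / \<alpha> * x powr \<alpha>" for x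
  have "f t \<le> f s"
  proof (rule DERIV_nonpos_imp_nonincreasing[OF assms(2)])
    fix x assume "s \<le> x" "x \<le> t"
    then have x: "0 < x" using assms by simp
    have "(f has_real_derivative deriv gr x - c2 / \<alpha> * (\<alpha> * x powr (\<alpha> - 1))) (at x)"
      unfolding f_def by (intro DERIV_diff DERIV_cmult gr_deriv has_real_derivative_powr x)
    moreover have "deriv gr x - c2 / \<alpha> * (\<alpha> * x powr (\<alpha> - 1)) \<le> 0"
      using deriv_bounds[OF x] alpha by (simp add: gr_def[abs_def])
    ultimately show "\<exists>y. (f has_real_derivative y) (at x) \<and> y \<le> 0" by blast
  qed
  then show ?thesis by (simp add: f_def algebra_simps)
qed

lemma c2_nonneg: "0 \<le> c2"
  using deriv_bounds[of 1] c1 by simp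

text \<open>The bound c2 t^(\<alpha>-1) on the derivative is integrable at 0 because \<alpha> > 0,
  so \<open>gr\<close> stays bounded on (0, 1]; beyond 1 it grows at most like t^\<alpha>.\<close>

lemma gr_growth: "\<exists>K\<ge>0. \<forall>t. fin t \<longrightarrow> \<bar>gr t\<bar> \<le> K * (1 + t powr \<alpha>)"
proof -
  \<comment> \<open>\<open>gr 1\<close> is the reference value, c2/\<alpha> comes from integrating
    the derivative bound, and \<open>gr 0\<close> covers the endpoint that this bound does not
    reach.\<close>
  define K where "K = \<bar>gr 1\<bar> + c2 / \<alpha> + \<bar>gr 0\<bar>"
  have c: "0 \<le> c2 / \<alpha>" using c2_nonneg alpha by simp
  then have K: "0 \<le> K" by (simp add: K_def)
  have "\<bar>gr t\<bar> \<le> K * (1 + t powr \<alpha>)" if t: "fin t" for t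
  proof -
    consider "t = 0" | "0 < t" "t \<le> 1" | "1 < t" using t by (auto simp: fin_def) fastforce
    then show ?thesis
    proof cases
      case 1
      then show ?thesis using c alpha by (simp add: K_def)
    next
      case 2
      have "gr t \<le> gr 1" using 2 by (intro gr_le fin_pos) auto
      moreover have "gr 1 - gr t \<le> c2 / \<alpha> * (1 - t powr \<alpha>)" using gr_upper[of t 1] 2 by simp
      moreover have "c2 / \<alpha> * (1 - t powr \<alpha>) \<le> c2 / \<alpha> * 1" using c by (intro mult_left_mono) auto
      ultimately have "\<bar>gr t\<bar> \<le> K" unfolding K_def by linarith
      also have "K \<le> K * (1 + t powr \<alpha>)" using K by (simp add: distrib_left)
      finally show ?thesis .
    next
      case 3
      have "gr 1 \<le> gr t" using 3 by (intro gr_le fin_pos) auto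
      moreover have "gr t - gr 1 \<le> c2 / \<alpha> * (t powr \<alpha> - 1)" using gr_upper[of 1 t] 3 by simp
      moreover have "c2 / \<alpha> * (t powr \<alpha> - 1) \<le> c2 / \<alpha> * t powr \<alpha>" using c by (intro mult_left_mono) auto
      ultimately have "\<bar>gr t\<bar> \<le> \<bar>gr 1\<bar> + c2 / \<alpha> * t powr \<alpha>" by linarith
      also have "\<dots> \<le> K + K * t powr \<alpha>"
        using c by (intro add_mono mult_right_mono) (auto simp: K_def)
      finally show ?thesis by (simp add: distrib_left)
    qed
  qed
  with K show ?thesis by blast
qed

text \<open>Strict monotonicity has to become uniform although s is unbounded and s or t may be 0.
  Monotonicity reduces a gap of size \<delta> to an increment of length \<delta>/2 whose left end
  stays at least \<delta>/2 away from 0, and such increments have a positive minimum on a compact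
  interval.\<close>

lemma gr_gap:
  assumes \<delta>: "0 < \<delta>"
  shows "\<exists>c>0. \<forall>s t. fin s \<longrightarrow> fin t \<longrightarrow> t \<le> k \<longrightarrow> \<delta> \<le> \<bar>s - t\<bar> \<longrightarrow> c \<le> \<bar>gr s - gr t\<bar>"
proof (cases "0 \<le> k")
  case False
  then show ?thesis by (intro exI[of _ 1]) (auto simp: fin_def)
next
  case True
  define f where "f a = gr a - gr (a - \<delta> / 2)" for a
  have cont: "continuous_on {0<..} gr"
    using gr_deriv by (intro continuous_at_imp_continuous_on) (auto intro: DERIV_isCont)
  have "continuous_on {\<delta>..k + \<delta>} f"
    unfolding f_def using \<delta> by (intro continuous_intros continuous_on_compose2[OF cont]) auto
  then obtain a where a: "a \<in> {\<delta>..k + \<delta>}" "\<forall>b\<in>{\<delta>..k + \<delta>}. f a \<le> f b"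
    using continuous_attains_inf[of "{\<delta>..k + \<delta>}" f] True by auto
  have "0 < f a" using a(1) \<delta> by (auto simp: f_def intro!: gr_less fin_pos)
  moreover have "f a \<le> \<bar>gr s - gr t\<bar>" if "fin s" "fin t" "t \<le> k" "\<delta> \<le> \<bar>s - t\<bar>" for s t
  proof (cases "t \<le> s")
    case True
    have t0: "0 \<le> t" using that by (simp add: fin_def)
    have "f a \<le> f (t + \<delta>)" using a(2) t0 that by auto
    moreover have "gr (t + \<delta>) \<le> gr s" using that(4) True t0 \<delta> by (intro gr_le that fin_pos) auto
    moreover have "gr t \<le> gr (t + \<delta> - \<delta> / 2)" using t0 \<delta> by (intro gr_le that fin_pos) auto
    ultimately show ?thesis unfolding f_def by linarith
  next
    case False
    have s0: "0 \<le> s" using that by (simp add: fin_def)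
    have "f a \<le> f t" using a(2) that False s0 \<delta> by auto
    moreover have "gr s \<le> gr (t - \<delta> / 2)" using that(4) s0 False \<delta> by (intro gr_le that fin_pos) auto
    ultimately show ?thesis unfolding f_def by linarith
  qed
  ultimately show ?thesis by blast
qed

section \<open>Pointwise form of the equations and monotonicity\<close>

lemma coupling_integrand_eq:
  assumes "fin s" "fin t"
  shows "e2ennreal ((g s - g t) * ereal (s - t)) = ennreal ((gr s - gr t) * (s - t))"
  using assms by (simp add: fin_def e2ennreal_ereal)

text \<open>The slot f holds the constant H of the ergodic problem or the term -\<epsilon> u of the
  discounted one, so that both share the same estimates.\<close>

definition residual :: "(real^'d \<Rightarrow> real) \<Rightarrow> (real^'d \<Rightarrow> real) \<Rightarrow> (real^'d \<Rightarrow> real^'d) \<Rightarrow> (real^'d \<Rightarrow> real) \<Rightarrow> real^'d \<Rightarrow> real" where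
  "residual V f G m x = f x - (norm (G x))\<^sup>2 / 2 - V x + gr (m x)"

definition pointwise_sol :: "(real^'d \<Rightarrow> real) \<Rightarrow> (real^'d \<Rightarrow> real) \<Rightarrow> (real^'d \<Rightarrow> real^'d) \<Rightarrow> (real^'d \<Rightarrow> real) \<Rightarrow> bool" where
  "pointwise_sol V f G m \<longleftrightarrow> (AE x in torus. fin (m x) \<and> 0 \<le> residual V f G m x \<and> residual V f G m x * m x = 0)"

text \<open>A distributional inequality with an integrable left side holds almost everywhere.
  Finiteness of the residual excludes g(m) = -infinity, which gives \<open>fin (m x)\<close> also
  where m vanishes.\<close>

lemma pointwise_solI:
  fixes m :: "real^'d \<Rightarrow> real"
  assumes m: "AE x in torus. 0 \<le> m x"
    and nn: "nonneg_distr (\<lambda>x. ereal (f x - (norm (G x))\<^sup>2 / 2 - V x) + g (m x))"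
    and ze: "AE x in torus. (ereal (f x - (norm (G x))\<^sup>2 / 2 - V x) + g (m x)) * ereal (m x) = 0"
  shows "pointwise_sol V f G m"
proof -
  let ?F = "\<lambda>x. ereal (f x - (norm (G x))\<^sup>2 / 2 - V x) + g (m x)"
  have "AE x in torus. 0 \<le> real_of_ereal (?F x)"
    using nn unfolding nonneg_distr_def by (intro AE_nonneg_of_distr) auto
  moreover have "AE x in torus. \<bar>?F x\<bar> \<noteq> \<infinity>" using nn by (simp add: nonneg_distr_def)
  ultimately show ?thesis
    using m ze unfolding pointwise_sol_def
  proof eventually_elim
    case (elim x)
    have "g (m x) \<noteq> \<infinity>" using ne_inf elim by simp
    then have eq: "g (m x) = ereal (gr (m x))"
      using elim(2) by (cases "g (m x)") (auto simp: gr_def)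
    have "residual V f G m x * m x = 0"
      using elim(4) unfolding eq by (simp add: residual_def)
    then show ?case
      using elim(1,3) eq by (auto simp: residual_def fin_def)
  qed
qed

text \<open>After expansion, the right side minus the left is \<open>r1 * m2 + r2 * m1\<close> plus
  (m1 + m2) |G1 - G2|^2 / 2, because complementarity removes \<open>r1 * m1\<close> and
  \<open>r2 * m2\<close>. All remaining terms are nonnegative.\<close>

lemma monotonicity_pointwise:
  fixes G1 G2 :: "'a::real_inner"
  assumes "0 \<le> m1" "0 \<le> m2" "0 \<le> r1" "0 \<le> r2" "r1 * m1 = 0" "r2 * m2 = (0::real)"
    and "r1 = f1 - (norm G1)\<^sup>2 / 2 - v + g1" "r2 = f2 - (norm G2)\<^sup>2 / 2 - v + g2"
  shows "(g1 - g2) * (m1 - m2) \<le> (f2 - f1) * (m1 - m2)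
     + (m1 *\<^sub>R G1) \<bullet> (G1 - G2) - (m2 *\<^sub>R G2) \<bullet> (G1 - G2)"
proof -
  have g: "g1 = r1 - f1 + (G1 \<bullet> G1) / 2 + v" "g2 = r2 - f2 + (G2 \<bullet> G2) / 2 + v"
    using assms by (simp_all add: power2_norm_eq_inner)
  have "(f2 - f1) * (m1 - m2) + (m1 *\<^sub>R G1) \<bullet> (G1 - G2) - (m2 *\<^sub>R G2) \<bullet> (G1 - G2) - (g1 - g2) * (m1 - m2)
      = r1 * m2 + r2 * m1 + (m1 + m2) * ((G1 - G2) \<bullet> (G1 - G2)) / 2 - r1 * m1 - r2 * m2"
    unfolding g by (simp add: inner_diff_left inner_diff_right inner_commute[of G2 G1] field_simps)
  moreover have "0 \<le> r1 * m2" "0 \<le> r2 * m1" "0 \<le> (m1 + m2) * ((G1 - G2) \<bullet> (G1 - G2)) / 2"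
    using assms by simp_all
  ultimately show ?thesis using assms by linarith
qed

end

text \<open>The square of \<open>m powr ((\<alpha> + 1) / 2)\<close> is m^(\<alpha>+1), so the
  Sobolev bound C becomes a bound C^2 of order \<alpha> + 1.\<close>

lemma regular_boundsD:
  fixes u m :: "real^'d \<Rightarrow> real"
  assumes rb: "regular_bounds \<alpha> C u m"
  shows "AE x in torus. 0 \<le> m x" "integrable torus m" "(\<integral>x. m x \<partial>torus) = 1"
    "Lp (\<alpha> + 1) m" "(\<integral>x. \<bar>m x\<bar> powr (\<alpha> + 1) \<partial>torus) \<le> C\<^sup>2"
    "integrable torus u" "has_weak_grad (mean_free u) (weak_grad u)" "(\<integral>x. mean_free u x \<partial>torus) = 0"
proof -
  define h where "h x = m x powr ((\<alpha> + 1) / 2)" for x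
  have m: "integrable torus m" "AE x in torus. 0 \<le> m x" and h: "h \<in> torus_W12" "W12_norm h \<le> C"
    and u: "integrable torus u" "mean_free u \<in> torus_W12"
    using rb by (auto simp: regular_bounds_def h_def[abs_def])
  show "AE x in torus. 0 \<le> m x" "integrable torus m" "(\<integral>x. m x \<partial>torus) = 1" "integrable torus u"
    using rb by (auto simp: regular_bounds_def)
  have hi: "integrable torus (\<lambda>x. (h x)\<^sup>2)" using h(1) by (simp add: torus_W12_def)
  have eq: "AE x in torus. \<bar>m x\<bar> powr (\<alpha> + 1) = (h x)\<^sup>2"
    using m(2) by eventually_elim (simp add: h_def power2_eq_square flip: powr_add)
  show L: "Lp (\<alpha> + 1) m"
    by (rule Lp_bound[OF borel_measurable_integrable[OF m(1)] hi]) (use eq in \<open>auto elim!: eventually_mono\<close>)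
  have "(\<integral>x. \<bar>m x\<bar> powr (\<alpha> + 1) \<partial>torus) = (\<integral>x. (h x)\<^sup>2 \<partial>torus)"
    using LpD[OF L] hi eq by (intro integral_cong_AE) auto
  also have "\<dots> \<le> (\<integral>x. (h x)\<^sup>2 \<partial>torus) + (\<integral>x. (norm (weak_grad h x))\<^sup>2 \<partial>torus)" by simp
  also have "\<dots> \<le> C\<^sup>2" using h(2) unfolding W12_norm_def by (rule sqrt_le_D)
  finally show "(\<integral>x. \<bar>m x\<bar> powr (\<alpha> + 1) \<partial>torus) \<le> C\<^sup>2" .
  obtain G where "has_weak_grad (mean_free u) G" using u(2) by (auto simp: torus_W12_def)
  then have "has_weak_grad (mean_free u) (weak_grad (mean_free u))"
    unfolding weak_grad_def by (rule someI[of "has_weak_grad (mean_free u)"])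
  then show "has_weak_grad (mean_free u) (weak_grad u)" by (simp add: weak_grad_mean_free[OF u(1)])
  show "(\<integral>x. mean_free u x \<partial>torus) = 0"
    unfolding mean_free_def using u(1) by simp
qed

section \<open>Uniform bounds and the duality estimate\<close>

context coupling
begin

text \<open>The exponent \<open>2 * ((\<alpha> + 1) / \<alpha>)\<close> is where the bootstrap stops.\<close>

definition sol_bounds :: "real \<Rightarrow> (real^'d \<Rightarrow> real) \<Rightarrow> (real^'d \<Rightarrow> real^'d) \<Rightarrow> (real^'d \<Rightarrow> real) \<Rightarrow> bool" where
  "sol_bounds R v G m \<longleftrightarrow> has_weak_grad v G \<and> (\<integral>x. v x \<partial>torus) = 0 \<and>
     Lp (2 * ((\<alpha> + 1) / \<alpha>)) v \<and> (\<forall>i. Lp (2 * ((\<alpha> + 1) / \<alpha>)) (\<lambda>x. G x $ i)) \<and>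
     (\<integral>x. \<bar>v x\<bar> powr (2 * ((\<alpha> + 1) / \<alpha>)) \<partial>torus) \<le> R \<and>
     integrable torus m \<and> (\<integral>x. m x \<partial>torus) = 1 \<and>
     Lp (\<alpha> + 1) m \<and> (\<integral>x. \<bar>m x\<bar> powr (\<alpha> + 1) \<partial>torus) \<le> R"

text \<open>A nonnegative residual bounds |Du|^2 / 2 by f - V + g(m), which feeds the bootstrap. R
  is chosen before f, u and m, whence the later uniformity in \<epsilon>.\<close>

lemma sol_bounds_exist:
  fixes V :: "real^'d \<Rightarrow> real"
  assumes V: "continuous_on UNIV V" and M: "0 \<le> M"
  shows "\<exists>R\<ge>0. \<forall>f u m. regular_bounds \<alpha> C u m \<longrightarrow> pointwise_sol V f (weak_grad u) m \<longrightarrow>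
    (AE x in torus. \<bar>f x\<bar> \<le> M * (1 + \<bar>mean_free u x\<bar>)) \<longrightarrow> sol_bounds R (mean_free u) (weak_grad u) m"
proof -
  obtain B where B: "B \<ge> 0" "\<forall>x\<in>cbox 0 One. \<bar>V x\<bar> \<le> B" using continuous_bdd_torus[OF V] by blast
  obtain K0 where K0: "K0 \<ge> 0" "\<And>t. fin t \<Longrightarrow> \<bar>gr t\<bar> \<le> K0 * (1 + t powr \<alpha>)" using gr_growth by blast
  \<comment> \<open>The 2 clears the half in |Du|^2 / 2; the summands come from f, V and the growth
    of g.\<close>
  define K where "K = 2 * (M + B + K0)"
  have K: "0 \<le> K" using M B K0 by (simp add: K_def)
  define s where "s = 2 * ((\<alpha> + 1) / \<alpha>)"
  define Q where "Q = real CARD('d) powr (2 * s) * (real CARD('d) * (3 * K) powr (s / 2))"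
  have Q: "0 \<le> Q" by (simp add: Q_def)
  define R where "R = 2 * Q * (1 + 2 * (Q + 1) + C\<^sup>2) + C\<^sup>2"
  have R: "C\<^sup>2 \<le> R" "2 * Q * (1 + 2 * (Q + 1) + C\<^sup>2) \<le> R" using Q by (simp_all add: R_def)
  have "sol_bounds R (mean_free u) (weak_grad u) m"
    if rb: "regular_bounds \<alpha> C u m" and ps: "pointwise_sol V f (weak_grad u) m"
      and f: "AE x in torus. \<bar>f x\<bar> \<le> M * (1 + \<bar>mean_free u x\<bar>)" for f u m
  proof -
    note D = regular_boundsD[OF rb]
    have cube: "AE x in torus. x \<in> cbox 0 (One::real^'d)" by (rule AE_I2) simp
    have b: "AE x in torus. (norm (weak_grad u x))\<^sup>2 \<le> K * (1 + \<bar>mean_free u x\<bar> + \<bar>m x\<bar> powr \<alpha>)"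
      using f cube ps[unfolded pointwise_sol_def] D(1)
    proof eventually_elim
      case (elim x)
      define a b where "a = \<bar>mean_free u x\<bar>" and "b = m x powr \<alpha>"
      have ab: "0 \<le> a" "0 \<le> b" by (auto simp: a_def b_def)
      have "\<bar>V x\<bar> \<le> B" using B elim by blast
      from abs_le_D2[OF this] have "- V x \<le> B" .
      moreover have "\<bar>gr (m x)\<bar> \<le> K0 * (1 + b)" unfolding b_def using K0(2) elim by blast
      from abs_le_D1[OF this] have "gr (m x) \<le> K0 * (1 + b)" .
      moreover have "f x \<le> M * (1 + a)" using elim by (auto simp: a_def dest: abs_le_D1)
      moreover have "0 \<le> f x - (norm (weak_grad u x))\<^sup>2 / 2 - V x + gr (m x)"
        using elim by (simp add: residual_def)
      moreover have "n \<le> 2 * (X + B + Y)" if "- w \<le> B" "z \<le> Y" "y \<le> X" "0 \<le> y - n / 2 - w + z"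
        for n w z y X Y :: real using that by argo
      ultimately have "(norm (weak_grad u x))\<^sup>2 \<le> 2 * (M * (1 + a) + B + K0 * (1 + b))" by blast
      also have "\<dots> \<le> 2 * (M * (1 + a + b) + B * (1 + a + b) + K0 * (1 + a + b))"
      proof -
        have "M * (1 + a) \<le> M * (1 + a + b)" "B * 1 \<le> B * (1 + a + b)" "K0 * (1 + b) \<le> K0 * (1 + a + b)"
          by (rule mult_left_mono; use ab M B(1) K0(1) in simp)+
        then show ?thesis by simp
      qed
      also have "\<dots> = K * (1 + a + b)" by (simp add: K_def algebra_simps)
      finally show ?case using elim by (simp add: a_def b_def)
    qed
    note G = gradient_bootstrap[OF D(7,8) alpha D(4) K b D(5), folded s_def, folded Q_def]
    show ?thesis
      unfolding sol_bounds_def s_def[symmetric]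
      using D G(1,2) order_trans[OF G(3) R(2)] order_trans[OF D(5) R(1)] by blast
  qed
  moreover have "0 \<le> R" using R(1) zero_le_power2[of C] by linarith
  ultimately show ?thesis by blast
qed

lemma exponents:
  shows "1 < (\<alpha> + 1) / \<alpha>" "1 < \<alpha> + 1" "1 / ((\<alpha> + 1) / \<alpha>) + 1 / (\<alpha> + 1) = 1"
    "1 / (\<alpha> + 1) + 1 / ((\<alpha> + 1) / \<alpha>) = 1"
  using alpha by (auto simp: field_simps)

lemma sol_bounds_Lp:
  assumes "sol_bounds R v G m"
  shows "Lp ((\<alpha> + 1) / \<alpha>) v" "(\<integral>x. \<bar>v x\<bar> powr ((\<alpha> + 1) / \<alpha>) \<partial>torus) \<le> 1 + R"
proof -
  let ?p = "(\<alpha> + 1) / \<alpha>"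
  have v: "Lp (2 * ?p) v" "(\<integral>x. \<bar>v x\<bar> powr (2 * ?p) \<partial>torus) \<le> R" using assms by (auto simp: sol_bounds_def)
  have p: "0 \<le> ?p" "?p \<le> 2 * ?p" using exponents(1) by linarith+
  show L: "Lp ?p v" by (rule Lp_mono[OF v(1) p])
  have "(\<integral>x. \<bar>v x\<bar> powr ?p \<partial>torus) \<le> (\<integral>x. 1 + \<bar>v x\<bar> powr (2 * ?p) \<partial>torus)"
    using LpD(2)[OF L] LpD(2)[OF v(1)] by (intro integral_mono powr_le_one_plus[OF abs_ge_zero p]) auto
  also have "\<dots> \<le> 1 + R" using LpD(2)[OF v(1)] v(2) by simp
  finally show "(\<integral>x. \<bar>v x\<bar> powr ?p \<partial>torus) \<le> 1 + R" .
qed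

text \<open>Two solutions are allowed so as to include the crossed pairings of one solution's v with
  the other's density.\<close>

lemma sol_bounds_pairing:
  assumes s1: "sol_bounds R v G m" and s2: "sol_bounds R v' G' m'"
  shows "integrable torus (\<lambda>x. v x * m' x)" "\<bar>\<integral>x. v x * m' x \<partial>torus\<bar> \<le> 1 + 2 * R"
proof -
  let ?p = "(\<alpha> + 1) / \<alpha>"
  note v = sol_bounds_Lp[OF s1]
  have m: "Lp (\<alpha> + 1) m'" "(\<integral>x. \<bar>m' x\<bar> powr (\<alpha> + 1) \<partial>torus) \<le> R" using s2 by (auto simp: sol_bounds_def)
  show i: "integrable torus (\<lambda>x. v x * m' x)" by (rule Lp_mult_integrable[OF exponents(1,2,3) v(1) m(1)])
  have "\<bar>\<integral>x. v x * m' x \<partial>torus\<bar> \<le> (\<integral>x. \<bar>v x * m' x\<bar> \<partial>torus)" by (rule integral_abs_bound)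
  also have "\<dots> \<le> (\<integral>x. \<bar>v x\<bar> powr ?p + \<bar>m' x\<bar> powr (\<alpha> + 1) \<partial>torus)"
  proof (rule integral_mono)
    fix x
    have "\<bar>v x\<bar> * \<bar>m' x\<bar> \<le> \<bar>v x\<bar> powr ?p / ?p + \<bar>m' x\<bar> powr (\<alpha> + 1) / (\<alpha> + 1)"
      by (rule Youngs_inequality[OF exponents(1,2,3)]) auto
    also have "\<dots> \<le> \<bar>v x\<bar> powr ?p / 1 + \<bar>m' x\<bar> powr (\<alpha> + 1) / 1"
      using exponents by (intro add_mono divide_left_mono) auto
    finally show "\<bar>v x * m' x\<bar> \<le> \<bar>v x\<bar> powr ?p + \<bar>m' x\<bar> powr (\<alpha> + 1)" by (simp add: abs_mult)
  qed (use i LpD(2)[OF v(1)] LpD(2)[OF m(1)] in auto)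
  also have "\<dots> \<le> (1 + R) + R" using LpD(2)[OF v(1)] LpD(2)[OF m(1)] v(2) m(2) by simp
  finally show "\<bar>\<integral>x. v x * m' x \<partial>torus\<bar> \<le> 1 + 2 * R" by simp
qed

text \<open>Both equations are tested with v' - v. The terms in \<open>v' * m'\<close> cancel, and
  the constants disappear because both densities have mass 1 and v, v' have mean 0. The majorant W
  is handed on in place of the product itself, so integrability is established for W alone.\<close>

lemma monotonicity_estimate:
  fixes V v v' m m' :: "real^'d \<Rightarrow> real" and G G' :: "real^'d \<Rightarrow> real^'d"
  assumes s: "sol_bounds R v G m" and ps: "pointwise_sol V (\<lambda>x. H) G m"
    and eq: "\<And>\<phi>. torus_test \<phi> \<Longrightarrow> (\<integral>x. (m x *\<^sub>R G x) \<bullet> grad \<phi> x \<partial>torus) = 0"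
    and s': "sol_bounds R v' G' m'" and ps': "pointwise_sol V (\<lambda>x. - \<epsilon> * (v' x + a)) G' m'"
    and eq': "\<And>\<phi>. torus_test \<phi> \<Longrightarrow> (\<integral>x. \<epsilon> * (m' x - 1) * \<phi> x + (m' x *\<^sub>R G' x) \<bullet> grad \<phi> x \<partial>torus) = 0"
  shows "\<exists>W. integrable torus W
    \<and> (AE x in torus. fin (m x) \<and> fin (m' x) \<and> (gr (m' x) - gr (m x)) * (m' x - m x) \<le> W x)
    \<and> (\<integral>x. W x \<partial>torus) = \<epsilon> * ((\<integral>x. v x * m' x \<partial>torus) - (\<integral>x. v' x * m x \<partial>torus))"
proof -
  define s0 where "s0 = 2 * ((\<alpha> + 1) / \<alpha>)"
  \<comment> \<open>The exponent of the fluxes: 1/p = 1/(\<alpha>+1) + 1/s0, which is at the same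
    time the conjugate of s0.\<close>
  define p where "p = 2 * (\<alpha> + 1) / (\<alpha> + 2)"
  have inv: "1 / p = (\<alpha> + 2) / (2 * (\<alpha> + 1))" "1 / s0 = \<alpha> / (2 * (\<alpha> + 1))"
    "1 / (\<alpha> + 1) = 2 / (2 * (\<alpha> + 1))"
    using alpha by (simp_all add: p_def s0_def field_simps)
  have "1 / p + 1 / s0 = (2 * (\<alpha> + 1)) / (2 * (\<alpha> + 1))"
    unfolding inv by (simp add: add_divide_distrib[symmetric])
  also have "\<dots> = 1" using alpha by simp
  finally have ps1: "1 / p + 1 / s0 = 1" .
  have "1 < p" "1 < s0" using alpha by (simp_all add: p_def s0_def less_divide_eq)
  with ps1 have p1: "1 < p" "1 < s0" "1 / p + 1 / s0 = 1" by blast+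
  have "1 / (\<alpha> + 1) + 1 / s0 = 1 / p"
    unfolding inv by (simp add: add_divide_distrib[symmetric] add.commute)
  moreover have "p < \<alpha> + 1"
  proof -
    have "2 * (\<alpha> + 1) < (\<alpha> + 2) * (\<alpha> + 1)" using alpha by (intro mult_strict_right_mono) auto
    then show ?thesis using alpha by (simp add: p_def field_simps)
  qed
  moreover have "p < s0"
  proof -
    have "2 * (\<alpha> + 1) / (\<alpha> + 2) < 2 * (\<alpha> + 1) / \<alpha>"
      using alpha by (intro divide_strict_left_mono) auto
    then show ?thesis by (simp add: p_def s0_def)
  qed
  ultimately have p2: "0 < p" "p < \<alpha> + 1" "p < s0" "1 / (\<alpha> + 1) + 1 / s0 = 1 / p"
    using p1(1) by auto
  note b = s[unfolded sol_bounds_def, folded s0_def] and b' = s'[unfolded sol_bounds_def, folded s0_def]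
  have s01: "0 \<le> s0" "1 \<le> s0" using p1 by auto
  define v0 where "v0 x = v' x - v x" for x
  define G0 where "G0 x = G' x - G x" for x
  have v0: "Lp s0 v0" unfolding v0_def[abs_def] by (rule Lp_diff) (use b b' s01 in auto)
  have G0: "Lp s0 (\<lambda>x. G0 x $ i)" for i
    unfolding G0_def vector_minus_component by (rule Lp_diff) (use b b' s01 in auto)
  have w0: "has_weak_grad v0 G0"
    unfolding has_weak_grad_def
  proof (intro conjI allI impI)
    have w: "has_weak_grad v G" "has_weak_grad v' G'" using b b' by auto
    note i = has_weak_gradD[OF w(1)] and i' = has_weak_gradD[OF w(2)]
    show "integrable torus v0" "integrable torus G0"
      unfolding v0_def[abs_def] G0_def[abs_def] using i i' by auto
    fix \<phi> :: "real^'d \<Rightarrow> real" and j assume \<phi>: "torus_test \<phi>"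
    have c: "continuous_on UNIV \<phi>" "continuous_on UNIV (\<lambda>x. grad \<phi> x $ j)"
    proof -
      have "Ck 0 \<phi>" "Ck (Suc 0) \<phi>" using \<phi> by (auto simp: torus_test_def torus_Ck_def)
      then show "continuous_on UNIV \<phi>" "continuous_on UNIV (\<lambda>x. grad \<phi> x $ j)" by auto
    qed
    have gi: "integrable torus (\<lambda>x. G x $ j)" "integrable torus (\<lambda>x. G' x $ j)"
      using Lp_integrable[of s0] b b' s01 by auto
    have "(\<integral>x. v0 x * grad \<phi> x $ j \<partial>torus) = (\<integral>x. v' x * grad \<phi> x $ j \<partial>torus) - (\<integral>x. v x * grad \<phi> x $ j \<partial>torus)"
      using integrable_cont_mult_torus[OF i(1) c(2)] integrable_cont_mult_torus[OF i'(1) c(2)]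
      by (simp add: v0_def left_diff_distrib)
    also have "\<dots> = - ((\<integral>x. G' x $ j * \<phi> x \<partial>torus) - (\<integral>x. G x $ j * \<phi> x \<partial>torus))"
      using i(3)[OF \<phi>] i'(3)[OF \<phi>] by simp
    also have "(\<integral>x. G' x $ j * \<phi> x \<partial>torus) - (\<integral>x. G x $ j * \<phi> x \<partial>torus) = (\<integral>x. G0 x $ j * \<phi> x \<partial>torus)"
      using integrable_cont_mult_torus[OF gi(1) c(1)] integrable_cont_mult_torus[OF gi(2) c(1)]
      by (simp add: G0_def left_diff_distrib)
    finally show "(\<integral>x. v0 x * grad \<phi> x $ j \<partial>torus) = - (\<integral>x. G0 x $ j * \<phi> x \<partial>torus)" .
  qed
  have mL: "Lp (\<alpha> + 1) m" "Lp (\<alpha> + 1) m'" using b b' by auto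
  have F: "Lp p (\<lambda>x. (m x *\<^sub>R G x) $ i)" for i
    using Lp_mult[OF p2 mL(1), of "\<lambda>x. G x $ i"] b by simp
  have F': "Lp p (\<lambda>x. (m' x *\<^sub>R G' x) $ i)" for i
    using Lp_mult[OF p2 mL(2), of "\<lambda>x. G' x $ i"] b' by simp
  have wL: "Lp p (\<lambda>x. \<epsilon> * (m' x - 1))"
    by (intro Lp_cmult Lp_diff Lp_const Lp_mono[OF mL(2)]) (use p2 in auto)
  have e: "(\<integral>x. 0 * \<phi> x + (m x *\<^sub>R G x) \<bullet> grad \<phi> x \<partial>torus) = 0" if "torus_test \<phi>" for \<phi>
    using eq[OF that] by simp
  note E = extend_weak_equation[where w = "\<lambda>x. 0" and F = "\<lambda>x. m x *\<^sub>R G x", OF p1 Lp_const F e w0 v0 G0]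
  note E' = extend_weak_equation[where w = "\<lambda>x. \<epsilon> * (m' x - 1)" and F = "\<lambda>x. m' x *\<^sub>R G' x", OF p1 wL F' eq' w0 v0 G0]
  \<comment> \<open>The right side of \<open>monotonicity_pointwise\<close>, with the discounted
    solution as first and the ergodic one as second argument.\<close>
  define W where "W x = (H + \<epsilon> * (v' x + a)) * (m' x - m x) + (m' x *\<^sub>R G' x) \<bullet> G0 x - (m x *\<^sub>R G x) \<bullet> G0 x" for x
  have mi: "integrable torus m" "integrable torus m'" using b b' by auto
  have vi: "integrable torus v" "integrable torus v'"
    using b b' has_weak_gradD(1) by blast+
  note vm' = sol_bounds_pairing(1)[OF s s'] and v'm = sol_bounds_pairing(1)[OF s' s]
    and v'm' = sol_bounds_pairing(1)[OF s' s'] and vm = sol_bounds_pairing(1)[OF s s]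
  \<comment> \<open>The part of W without gradients, in separately integrable terms; the constant H
    + \<epsilon> a multiplies m' - m, whose integral is 0.\<close>
  define T where "T x = (H + \<epsilon> * a) * (m' x - m x) + \<epsilon> * (v' x * m' x - v' x * m x)" for x
  have T: "integrable torus T" unfolding T_def using mi v'm v'm' by auto
  have WT: "W x = T x + (m' x *\<^sub>R G' x) \<bullet> G0 x - (m x *\<^sub>R G x) \<bullet> G0 x" for x
    by (simp add: W_def T_def algebra_simps)
  have Wi: "integrable torus W"
    unfolding WT by (intro Bochner_Integration.integrable_add Bochner_Integration.integrable_diff T E(2) E'(2))
  have "(\<integral>x. T x \<partial>torus) = \<epsilon> * ((\<integral>x. v' x * m' x \<partial>torus) - (\<integral>x. v' x * m x \<partial>torus))"
    unfolding T_def using mi v'm v'm' b b' by simp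
  moreover have "(\<integral>x. (m x *\<^sub>R G x) \<bullet> G0 x \<partial>torus) = 0" using E(3) by simp
  moreover have "(\<integral>x. \<epsilon> * (m' x - 1) * v0 x \<partial>torus)
      = \<epsilon> * ((\<integral>x. v' x * m' x \<partial>torus) - (\<integral>x. v x * m' x \<partial>torus))"
  proof -
    have "(\<integral>x. \<epsilon> * (m' x - 1) * v0 x \<partial>torus) = (\<integral>x. \<epsilon> * ((v' x * m' x - v x * m' x) - (v' x - v x)) \<partial>torus)"
      by (simp add: v0_def algebra_simps)
    also have "\<dots> = \<epsilon> * (((\<integral>x. v' x * m' x \<partial>torus) - (\<integral>x. v x * m' x \<partial>torus)) - (0 - 0))"
      using vi vm' v'm' b b' by simp
    finally show ?thesis by simp
  qed
  moreover have "(\<integral>x. W x \<partial>torus) = (\<integral>x. T x \<partial>torus) + (\<integral>x. (m' x *\<^sub>R G' x) \<bullet> G0 x \<partial>torus) - (\<integral>x. (m x *\<^sub>R G x) \<bullet> G0 x \<partial>torus)"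
    unfolding WT using T E(2) E'(2) by (simp only: Bochner_Integration.integral_diff Bochner_Integration.integral_add Bochner_Integration.integrable_add)
  ultimately have "(\<integral>x. W x \<partial>torus) = \<epsilon> * ((\<integral>x. v x * m' x \<partial>torus) - (\<integral>x. v' x * m x \<partial>torus))"
    using E'(3) by (simp add: algebra_simps)
  moreover have "AE x in torus. fin (m x) \<and> fin (m' x) \<and> (gr (m' x) - gr (m x)) * (m' x - m x) \<le> W x"
    using ps[unfolded pointwise_sol_def] ps'[unfolded pointwise_sol_def]
  proof eventually_elim
    case (elim x)
    have "(gr (m' x) - gr (m x)) * (m' x - m x) \<le> (H - (- \<epsilon> * (v' x + a))) * (m' x - m x)
        + (m' x *\<^sub>R G' x) \<bullet> (G' x - G x) - (m x *\<^sub>R G x) \<bullet> (G' x - G x)"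
      by (rule monotonicity_pointwise[where v = "V x" and
            ?r1.0 = "residual V (\<lambda>x. - \<epsilon> * (v' x + a)) G' m' x" and ?r2.0 = "residual V (\<lambda>x. H) G m x"])
        (use elim in \<open>auto simp: fin_def residual_def\<close>)
    then show ?case using elim by (simp add: W_def G0_def)
  qed
  ultimately show ?thesis using Wi by blast
qed

end

section \<open>From regular weak solutions to the estimates\<close>

context coupling
begin

text \<open>With the source moved to the left the equation has the shape required by
  \<open>extend_weak_equation\<close>, the zeroth-order coefficient being \<epsilon> (m -
  1).\<close>

lemma discounted_equation:
  fixes u m :: "real^'d \<Rightarrow> real"
  assumes d: "regular_weak_discounted \<alpha> C V g \<epsilon> u m" and \<phi>: "torus_test \<phi>"
  shows "(\<integral>x. \<epsilon> * (m x - 1) * \<phi> x + (m x *\<^sub>R weak_grad u x) \<bullet> grad \<phi> x \<partial>torus) = 0"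
proof -
  have m: "integrable torus m" and F: "integrable torus (\<lambda>x. m x *\<^sub>R weak_grad u x)"
    and eq: "(\<integral>x. \<epsilon> * m x * \<phi> x + (m x *\<^sub>R weak_grad u x) \<bullet> grad \<phi> x \<partial>torus) = (\<integral>x. \<epsilon> * \<phi> x \<partial>torus)"
    using d \<phi> by (auto simp: regular_weak_discounted_def regular_bounds_def)
  have "Ck 0 \<phi>" "Ck (Suc 0) \<phi>" using \<phi> by (auto simp: torus_test_def torus_Ck_def)
  then have c: "continuous_on UNIV \<phi>" "\<And>i. continuous_on UNIV (\<lambda>x. grad \<phi> x $ i)" by auto
  have i1: "integrable torus (\<lambda>x. \<epsilon> * m x * \<phi> x)"
    using integrable_cont_mult_torus[OF integrable_mult_right[of \<epsilon> torus m] c(1)] m by simp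
  have i2: "integrable torus (\<lambda>x. (m x *\<^sub>R weak_grad u x) \<bullet> grad \<phi> x)"
    unfolding inner_vec_def inner_real_def
  proof (intro Bochner_Integration.integrable_sum integrable_cont_mult_torus c(2))
    fix i
    have "integrable torus (\<lambda>x. (m x *\<^sub>R weak_grad u x) \<bullet> axis i 1)" using F by (rule integrable_inner_left)
    then show "integrable torus (\<lambda>x. (m x *\<^sub>R weak_grad u x) $ i)" by (simp add: inner_axis)
  qed
  have i3: "integrable torus (\<lambda>x. \<epsilon> * \<phi> x)" using continuous_integrable_torus[OF c(1)] by simp
  have "(\<integral>x. \<epsilon> * (m x - 1) * \<phi> x + (m x *\<^sub>R weak_grad u x) \<bullet> grad \<phi> x \<partial>torus)
    = (\<integral>x. (\<epsilon> * m x * \<phi> x + (m x *\<^sub>R weak_grad u x) \<bullet> grad \<phi> x) - \<epsilon> * \<phi> x \<partial>torus)"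
    by (simp add: algebra_simps)
  also have "\<dots> = (\<integral>x. \<epsilon> * m x * \<phi> x + (m x *\<^sub>R weak_grad u x) \<bullet> grad \<phi> x \<partial>torus) - (\<integral>x. \<epsilon> * \<phi> x \<partial>torus)"
    by (rule Bochner_Integration.integral_diff[OF Bochner_Integration.integrable_add[OF i1 i2] i3])
  finally show ?thesis using eq by simp
qed

lemma discounted_pointwise:
  fixes u m :: "real^'d \<Rightarrow> real"
  assumes d: "regular_weak_discounted \<alpha> C V g \<epsilon> u m"
  shows "pointwise_sol V (\<lambda>x. - \<epsilon> * (mean_free u x + (\<integral>y. u y \<partial>torus))) (weak_grad u) m"
proof (rule pointwise_solI)
  show "AE x in torus. 0 \<le> m x" using d by (auto simp: regular_weak_discounted_def regular_bounds_def)
qed (use d in \<open>simp_all add: regular_weak_discounted_def discounted_residual_def[abs_def] mean_free_def\<close>)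

lemma ergodic_pointwise:
  fixes u m :: "real^'d \<Rightarrow> real"
  assumes d: "regular_weak_ergodic \<alpha> C V g u m H"
  shows "pointwise_sol V (\<lambda>x. H) (weak_grad u) m"
proof (rule pointwise_solI)
  show "AE x in torus. 0 \<le> m x" using d by (auto simp: regular_weak_ergodic_def regular_bounds_def)
qed (use d in \<open>simp_all add: regular_weak_ergodic_def ergodic_residual_def[abs_def]\<close>)

lemma uniform_sol_bounds:
  fixes V :: "real^'d \<Rightarrow> real"
  assumes V: "continuous_on UNIV V" and C: "0 \<le> C"
  shows "\<exists>R\<ge>0. (\<forall>u m. regular_weak_ergodic \<alpha> C V g u m H \<longrightarrow> sol_bounds R (mean_free u) (weak_grad u) m) \<and>
    (\<forall>\<epsilon> u m. 0 < \<epsilon> \<longrightarrow> \<epsilon> \<le> 1 \<longrightarrow> regular_weak_discounted \<alpha> C V g \<epsilon> u m \<longrightarrow>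
       sol_bounds R (mean_free u) (weak_grad u) m)"
proof -
  \<comment> \<open>This constant fits both problems: f is H in the ergodic one, and for \<epsilon>
    \<le> 1 the term \<epsilon> u is bounded by the mean-free part of u plus C, the bound on
    \<epsilon> times the mean.\<close>
  have M: "0 \<le> 1 + C + \<bar>H\<bar>" using C by simp
  obtain R where R: "R \<ge> 0" "\<And>f (u::real^'d \<Rightarrow> real) m. regular_bounds \<alpha> C u m \<Longrightarrow> pointwise_sol V f (weak_grad u) m \<Longrightarrow>
      AE x in torus. \<bar>f x\<bar> \<le> (1 + C + \<bar>H\<bar>) * (1 + \<bar>mean_free u x\<bar>) \<Longrightarrow> sol_bounds R (mean_free u) (weak_grad u) m"
    using sol_bounds_exist[OF V M, of C] by blast
  have le: "\<bar>b\<bar> \<le> (1 + C + \<bar>H\<bar>) * (1 + t)" if "\<bar>b\<bar> \<le> t + C + \<bar>H\<bar>" "0 \<le> t" for b t :: real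
  proof -
    have "t + (C + \<bar>H\<bar>) * 1 \<le> t + (C + \<bar>H\<bar>) * (1 + t)" using C that by (intro add_mono mult_left_mono) auto
    then have "t + C + \<bar>H\<bar> \<le> (1 + C + \<bar>H\<bar>) * (1 + t)" by (simp add: algebra_simps)
    with that show ?thesis by linarith
  qed
  have "sol_bounds R (mean_free u) (weak_grad u) m" if "regular_weak_ergodic \<alpha> C V g u m H" for u m :: "real^'d \<Rightarrow> real"
    by (rule R(2)[OF _ ergodic_pointwise[OF that]])
      (use that C in \<open>auto simp: regular_weak_ergodic_def intro!: AE_I2 le\<close>)
  moreover have "sol_bounds R (mean_free u) (weak_grad u) m"
    if \<epsilon>: "0 < \<epsilon>" "\<epsilon> \<le> 1" and d: "regular_weak_discounted \<alpha> C V g \<epsilon> u m" for \<epsilon> and u m :: "real^'d \<Rightarrow> real"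
  proof (rule R(2)[OF _ discounted_pointwise[OF d]])
    show "regular_bounds \<alpha> C u m" using d by (simp add: regular_weak_discounted_def)
    have a: "\<bar>\<epsilon> * (\<integral>x. u x \<partial>torus)\<bar> \<le> C" using d by (simp add: regular_weak_discounted_def)
    show "AE x in torus. \<bar>- \<epsilon> * (mean_free u x + (\<integral>y. u y \<partial>torus))\<bar> \<le> (1 + C + \<bar>H\<bar>) * (1 + \<bar>mean_free u x\<bar>)"
    proof (rule AE_I2, rule le)
      fix x
      have "\<bar>- \<epsilon> * (mean_free u x + (\<integral>y. u y \<partial>torus))\<bar> = \<bar>\<epsilon> * mean_free u x + \<epsilon> * (\<integral>y. u y \<partial>torus)\<bar>"
        by (simp add: distrib_left)
      also have "\<dots> \<le> \<bar>\<epsilon> * mean_free u x\<bar> + \<bar>\<epsilon> * (\<integral>y. u y \<partial>torus)\<bar>" by (rule abs_triangle_ineq)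
      also have "\<bar>\<epsilon> * mean_free u x\<bar> \<le> 1 * \<bar>mean_free u x\<bar>"
        unfolding abs_mult using \<epsilon> by (intro mult_right_mono) auto
      finally show "\<bar>- \<epsilon> * (mean_free u x + (\<integral>y. u y \<partial>torus))\<bar> \<le> \<bar>mean_free u x\<bar> + C + \<bar>H\<bar>"
        using a by simp
    qed simp
  qed
  ultimately show ?thesis using R(1) by blast
qed

text \<open>The nonnegative integral is monotone for arbitrary integrands, so the almost everywhere
  majorant W transfers directly to \<open>coupling_integral\<close>.\<close>

lemma coupling_integral_le:
  assumes W: "integrable torus W"
    and ae: "AE x in torus. fin (m x) \<and> fin (m' x) \<and> (gr (m' x) - gr (m x)) * (m' x - m x) \<le> W x"
  shows "coupling_integral g m' m \<le> ennreal (\<integral>x. W x \<partial>torus)" "0 \<le> (\<integral>x. W x \<partial>torus)"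
    "AE x in torus. 0 \<le> W x"
proof -
  show nn: "AE x in torus. 0 \<le> W x"
    using ae by eventually_elim (use gr_mult_nonneg in force)
  show "0 \<le> (\<integral>x. W x \<partial>torus)" using nn by (rule integral_nonneg_AE)
  have "coupling_integral g m' m \<le> (\<integral>\<^sup>+x. ennreal (W x) \<partial>torus)"
    unfolding coupling_integral_def
  proof (rule nn_integral_mono_AE)
    show "AE x in torus. e2ennreal ((g (m' x) - g (m x)) * ereal (m' x - m x)) \<le> ennreal (W x)"
      using ae by eventually_elim (simp only: coupling_integrand_eq ennreal_leI)
  qed
  also have "\<dots> = ennreal (\<integral>x. W x \<partial>torus)" by (rule nn_integral_eq_integral[OF W nn])
  finally show "coupling_integral g m' m \<le> ennreal (\<integral>x. W x \<partial>torus)" .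
qed

text \<open>
  Testing against the sign of \<open>mbar - m\<close> on \<open>{m \<le> k}\<close>: there \<open>g\<close> has a uniform gap, so \<open>m\<^sub>\<epsilon>\<close> converges
  to \<open>m\<close> in \<open>L\<^sup>1\<close> on this set.
\<close>

lemma density_limit_unique:
  fixes m mbar :: "real^'d \<Rightarrow> real" and me :: "real \<Rightarrow> real^'d \<Rightarrow> real"
  assumes w: "weak_tendsto torus_L1 L1_norm me mbar (at_right 0)" and m: "integrable torus m"
    and est: "\<And>\<epsilon>. 0 < \<epsilon> \<Longrightarrow> \<epsilon> \<le> 1 \<Longrightarrow> \<exists>W. integrable torus W \<and>
      (AE x in torus. fin (m x) \<and> fin (me \<epsilon> x) \<and> (gr (me \<epsilon> x) - gr (m x)) * (me \<epsilon> x - m x) \<le> W x) \<and>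
      (\<integral>x. W x \<partial>torus) \<le> \<epsilon> * D"
    and ev: "\<And>\<epsilon>. 0 < \<epsilon> \<Longrightarrow> \<epsilon> \<le> 1 \<Longrightarrow> integrable torus (me \<epsilon>)"
  shows "AE x in torus. mbar x = m x"
proof -
  have l: "integrable torus mbar" using w by (simp add: weak_tendsto_def torus_L1_def)
  note [measurable] = borel_measurable_integrable[OF l] borel_measurable_integrable[OF m]
  have small: "\<forall>\<^sub>F \<epsilon> in at_right (0::real). 0 < \<epsilon> \<and> \<epsilon> \<le> 1"
    using eventually_at_right_real[of 0 1] by (auto elim!: eventually_mono)
  have "AE x in torus. m x \<le> real k \<longrightarrow> mbar x = m x" for k
  proof -
    define b where "b x = (if m x \<le> real k then sgn (mbar x - m x) else 0)" for x
    have bm [measurable]: "b \<in> borel_measurable torus" unfolding b_def by measurable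
    have b1: "\<bar>b x\<bar> \<le> 1" for x by (auto simp: b_def abs_sgn_eq)
    have bi: "integrable torus (\<lambda>x. b x * h x)" if "integrable torus h" for h
      using integrable_bounded_mult_torus[OF that bm b1] by (simp add: mult.commute)
    have L: "((\<lambda>\<epsilon>. (\<integral>x. b x * me \<epsilon> x \<partial>torus) - (\<integral>x. b x * m x \<partial>torus)) \<longlongrightarrow>
        (\<integral>x. b x * mbar x \<partial>torus) - (\<integral>x. b x * m x \<partial>torus)) (at_right 0)"
      by (intro tendsto_diff tendsto_const weak_tendsto_L1_pairing[OF w bm b1])
    define I where "I = (\<integral>x. b x * (mbar x - m x) \<partial>torus)"
    have I: "I = (\<integral>x. b x * mbar x \<partial>torus) - (\<integral>x. b x * m x \<partial>torus)"
      unfolding I_def right_diff_distrib by (rule Bochner_Integration.integral_diff[OF bi[OF l] bi[OF m]])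
    have "I \<le> \<delta>" if \<delta>: "0 < \<delta>" for \<delta>
    proof -
      obtain c where c: "c > 0" "\<And>s t. fin s \<Longrightarrow> fin t \<Longrightarrow> t \<le> real k \<Longrightarrow> \<delta> \<le> \<bar>s - t\<bar> \<Longrightarrow> c \<le> \<bar>gr s - gr t\<bar>"
        using gr_gap[OF \<delta>, of "real k"] by blast
      \<comment> \<open>On {m \<le> k}, points with |m_eps - m| < \<delta> contribute at most
        \<delta>, as the torus has measure 1; at the others the gap c gives |m_eps - m| \<le> W /
        c.\<close>
      have "\<forall>\<^sub>F \<epsilon> in at_right 0. (\<integral>x. b x * me \<epsilon> x \<partial>torus) - (\<integral>x. b x * m x \<partial>torus) \<le> \<delta> + \<epsilon> * D / c"
        using small
      proof eventually_elim
        case (elim \<epsilon>)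
        then obtain W where W: "integrable torus W" "(\<integral>x. W x \<partial>torus) \<le> \<epsilon> * D"
          "AE x in torus. fin (m x) \<and> fin (me \<epsilon> x) \<and> (gr (me \<epsilon> x) - gr (m x)) * (me \<epsilon> x - m x) \<le> W x"
          using est by blast
        note nn = coupling_integral_le(3)[OF W(1,3)]
        have "(\<integral>x. b x * me \<epsilon> x \<partial>torus) - (\<integral>x. b x * m x \<partial>torus) = (\<integral>x. b x * me \<epsilon> x - b x * m x \<partial>torus)"
          using bi[OF ev] bi[OF m] elim by simp
        also have "\<dots> \<le> (\<integral>x. \<delta> + W x / c \<partial>torus)"
        proof (rule integral_mono_AE)
          show "integrable torus (\<lambda>x. b x * me \<epsilon> x - b x * m x)" using bi[OF ev] bi[OF m] elim by simp
          show "integrable torus (\<lambda>x. \<delta> + W x / c)" using W(1) by simp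
          show "AE x in torus. b x * me \<epsilon> x - b x * m x \<le> \<delta> + W x / c"
            using W(3) nn
          proof eventually_elim
            case (elim x)
            have Wc: "0 \<le> W x / c" using elim c(1) by simp
            have b_le: "\<bar>b x\<bar> * \<bar>me \<epsilon> x - m x\<bar> \<le> \<bar>me \<epsilon> x - m x\<bar>"
              by (rule mult_left_le_one_le) (use b1 in auto)
            have "b x * me \<epsilon> x - b x * m x \<le> \<bar>b x\<bar> * \<bar>me \<epsilon> x - m x\<bar>"
              by (metis abs_ge_self abs_mult right_diff_distrib)
            also have "\<dots> \<le> \<delta> + W x / c"
            proof (cases "m x \<le> real k \<and> \<delta> \<le> \<bar>me \<epsilon> x - m x\<bar>")
              case True
              have "c * \<bar>me \<epsilon> x - m x\<bar> \<le> \<bar>gr (me \<epsilon> x) - gr (m x)\<bar> * \<bar>me \<epsilon> x - m x\<bar>"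
                using c(2) elim True by (intro mult_right_mono) auto
              also have "\<dots> = (gr (me \<epsilon> x) - gr (m x)) * (me \<epsilon> x - m x)"
                using gr_mult_nonneg[of "me \<epsilon> x" "m x"] elim by (simp flip: abs_mult)
              also have "\<dots> \<le> W x" using elim by simp
              finally have "\<bar>me \<epsilon> x - m x\<bar> \<le> W x / c" using c(1) by (simp add: le_divide_eq mult.commute)
              also have "\<dots> \<le> \<delta> + W x / c" using \<delta> by simp
              finally show ?thesis by (rule order_trans[OF b_le])
            next
              case False
              show ?thesis
              proof (cases "m x \<le> real k")
                case True
                then have "\<bar>me \<epsilon> x - m x\<bar> \<le> \<delta>" using False by simp
                also have "\<dots> \<le> \<delta> + W x / c" using Wc by simp
                finally show ?thesis by (rule order_trans[OF b_le])
              next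
                case False
                then show ?thesis using Wc \<delta> by (simp add: b_def)
              qed
            qed
            finally show ?case .
          qed
        qed
        also have "\<dots> = \<delta> + (\<integral>x. W x \<partial>torus) / c" using W(1) by simp
        also have "\<dots> \<le> \<delta> + \<epsilon> * D / c" using W(2) c(1) by (simp add: divide_right_mono)
        finally show ?case .
      qed
      moreover have "((\<lambda>\<epsilon>. \<delta> + \<epsilon> * D / c) \<longlongrightarrow> \<delta> + 0 * D / c) (at_right 0)"
        using c(1) by (intro tendsto_intros) auto
      ultimately show ?thesis using tendsto_le[OF _ _ L] unfolding I by fastforce
    qed
    then have "I \<le> 0" by (rule field_le_epsilon[where y = 0, simplified])
    moreover have nn: "0 \<le> b x * (mbar x - m x)" for x
      by (auto simp: b_def sgn_if)
    moreover have "0 \<le> I" unfolding I_def using nn by simp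
    ultimately have "I = 0" by simp
    moreover have "integrable torus (\<lambda>x. b x * (mbar x - m x))" using bi l m by simp
    ultimately have "AE x in torus. b x * (mbar x - m x) = 0"
      unfolding I_def using nn by (subst (asm) integral_nonneg_eq_0_iff_AE) auto
    then show ?thesis
      by eventually_elim (auto simp: b_def sgn_if split: if_splits)
  qed
  \<comment> \<open>Every value of m lies below some natural number, so countably many levels k
    cover all points.\<close>
  then have "AE x in torus. \<forall>k::nat. m x \<le> real k \<longrightarrow> mbar x = m x"
    unfolding AE_all_countable by blast
  then show ?thesis
    by eventually_elim (use real_arch_simple in blast)
qed

end

theorem theorem1p9:
  fixes V :: "real^'d \<Rightarrow> real"
    and g :: "real \<Rightarrow> ereal"
    and \<gamma> \<alpha> c1 c2 C H :: real
    and u_eps m_eps :: "real \<Rightarrow> real^'d \<Rightarrow> real"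
    and ubar mbar u m :: "real^'d \<Rightarrow> real"
  assumes "0 < \<gamma>" and "\<gamma> < 1"
    and "torus_C1_holder \<gamma> V"
    and "\<And>t. 0 \<le> t \<Longrightarrow> g t \<noteq> \<infinity>"
    and "strict_mono_on {0..} g"
    and "C1_holder_loc_pos \<gamma> (\<lambda>t. real_of_ereal (g t))"
    and "0 < c1" and "0 < c2"
    and "\<And>t. 0 < t \<Longrightarrow>
           c1 * t powr (\<alpha> - 1) \<le> deriv (\<lambda>s. real_of_ereal (g s)) t \<and>
           deriv (\<lambda>s. real_of_ereal (g s)) t \<le> c2 * t powr (\<alpha> - 1)"
    and "0 < \<alpha>"
    and "4 < CARD('d) \<and> CARD('d) \<le> 8 \<Longrightarrow> (real CARD('d) - 4) / real CARD('d) < \<alpha>"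
    and "8 \<le> CARD('d) \<Longrightarrow> (real CARD('d) - 4) / 2 < \<alpha>"
    and "0 < C"
    and "\<And>\<epsilon>. 0 < \<epsilon> \<Longrightarrow> regular_weak_discounted \<alpha> C V g \<epsilon> (u_eps \<epsilon>) (m_eps \<epsilon>)"
    and "weak_tendsto torus_W12 W12_norm (\<lambda>\<epsilon>. mean_free (u_eps \<epsilon>)) ubar (at_right 0)"
    and "weak_tendsto torus_L1 L1_norm m_eps mbar (at_right 0)"
    and "regular_weak_ergodic \<alpha> C V g u m H"
  shows "((\<lambda>\<epsilon>. coupling_integral g (m_eps \<epsilon>) m) \<longlongrightarrow> 0) (at_right 0)
       \<and> (AE x in torus. mbar x = m x)
       \<and> integrable torus (\<lambda>x. mean_free ubar x * m x)
       \<and> integrable torus (\<lambda>x. mean_free u x * m x)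
       \<and> (\<integral>x. mean_free ubar x * m x \<partial>torus) \<le> (\<integral>x. mean_free u x * m x \<partial>torus)"
proof -
  interpret coupling g \<alpha> c1 c2
    by unfold_locales (use assms in \<open>auto simp: C1_holder_loc_pos_def\<close>)
  note disc = assms(14) and wu = assms(15) and wm = assms(16) and erg = assms(17)
  have "Ck (Suc 0) V" using assms(3) by (simp add: torus_C1_holder_def torus_Ck_def)
  then have V: "continuous_on UNIV V"
    by (auto simp: continuous_on_eq_continuous_at intro: differentiable_imp_continuous_within)
  obtain R where R: "R \<ge> 0" "sol_bounds R (mean_free u) (weak_grad u) m"
    "\<And>\<epsilon>. 0 < \<epsilon> \<Longrightarrow> \<epsilon> \<le> 1 \<Longrightarrow> sol_bounds R (mean_free (u_eps \<epsilon>)) (weak_grad (u_eps \<epsilon>)) (m_eps \<epsilon>)"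
    using uniform_sol_bounds[OF V, of C H] assms(13) erg disc by (metis less_imp_le)
  define v where "v = mean_free u"
  define ve where "ve \<epsilon> = mean_free (u_eps \<epsilon>)" for \<epsilon>
  note s = R(2)[folded v_def] and se = R(3)[folded ve_def]
  have W: "\<exists>W. integrable torus W
      \<and> (AE x in torus. fin (m x) \<and> fin (m_eps \<epsilon> x) \<and> (gr (m_eps \<epsilon> x) - gr (m x)) * (m_eps \<epsilon> x - m x) \<le> W x)
      \<and> (\<integral>x. W x \<partial>torus) = \<epsilon> * ((\<integral>x. v x * m_eps \<epsilon> x \<partial>torus) - (\<integral>x. ve \<epsilon> x * m x \<partial>torus))"
    if \<epsilon>: "0 < \<epsilon>" "\<epsilon> \<le> 1" for \<epsilon>
    by (rule monotonicity_estimate[OF s ergodic_pointwise[OF erg] _ se[OF \<epsilon>]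
          discounted_pointwise[OF disc[OF \<epsilon>(1)], folded ve_def] discounted_equation[OF disc[OF \<epsilon>(1)]]])
      (use erg in \<open>auto simp: regular_weak_ergodic_def\<close>)
  \<comment> \<open>The bound of \<open>sol_bounds_pairing\<close>, once for each of the two crossed
    integrals.\<close>
  define D where "D = 2 * (1 + 2 * R)"
  have Dle: "(\<integral>x. v x * m_eps \<epsilon> x \<partial>torus) - (\<integral>x. ve \<epsilon> x * m x \<partial>torus) \<le> D" if "0 < \<epsilon>" "\<epsilon> \<le> 1" for \<epsilon>
  proof -
    have "a - b \<le> 2 * K" if "\<bar>a\<bar> \<le> K" "\<bar>b\<bar> \<le> K" for a b K :: real
      using that by linarith
    then show ?thesis
      unfolding D_def using sol_bounds_pairing(2)[OF s se[OF that]] sol_bounds_pairing(2)[OF se[OF that] s] by blast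
  qed
  have ord: "(\<integral>x. ve \<epsilon> x * m x \<partial>torus) \<le> (\<integral>x. v x * m_eps \<epsilon> x \<partial>torus)"
    and ci: "coupling_integral g (m_eps \<epsilon>) m \<le> ennreal (\<epsilon> * D)" if \<epsilon>: "0 < \<epsilon>" "\<epsilon> \<le> 1" for \<epsilon>
  proof -
    obtain W where W: "integrable torus W"
      "AE x in torus. fin (m x) \<and> fin (m_eps \<epsilon> x) \<and> (gr (m_eps \<epsilon> x) - gr (m x)) * (m_eps \<epsilon> x - m x) \<le> W x"
      "(\<integral>x. W x \<partial>torus) = \<epsilon> * ((\<integral>x. v x * m_eps \<epsilon> x \<partial>torus) - (\<integral>x. ve \<epsilon> x * m x \<partial>torus))"
      using W[OF \<epsilon>] by blast
    note c = coupling_integral_le[OF W(1,2)]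
    \<comment> \<open>The integral of W is nonnegative and carries the factor \<epsilon> > 0, which
      is divided out here; what remains is the selection inequality before the limit.\<close>
    show "(\<integral>x. ve \<epsilon> x * m x \<partial>torus) \<le> (\<integral>x. v x * m_eps \<epsilon> x \<partial>torus)"
      using c(2) \<epsilon>(1) unfolding W(3) by (simp add: zero_le_mult_iff)
    have "(\<integral>x. W x \<partial>torus) \<le> \<epsilon> * D" unfolding W(3) using Dle[OF \<epsilon>] \<epsilon> by simp
    then show "coupling_integral g (m_eps \<epsilon>) m \<le> ennreal (\<epsilon> * D)"
      using c(1) ennreal_leI order_trans by blast
  qed
  have small: "\<forall>\<^sub>F \<epsilon> in at_right (0::real). 0 < \<epsilon> \<and> \<epsilon> \<le> 1"
    using eventually_at_right_real[of 0 1] by (auto elim!: eventually_mono)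
  have "((\<lambda>\<epsilon>. ennreal (\<epsilon> * D)) \<longlongrightarrow> ennreal (0 * D)) (at_right 0)"
    by (intro tendsto_ennrealI tendsto_intros)
  then have lim0: "((\<lambda>\<epsilon>. ennreal (\<epsilon> * D)) \<longlongrightarrow> 0) (at_right 0)" by simp
  have "\<forall>\<^sub>F \<epsilon> in at_right 0. coupling_integral g (m_eps \<epsilon>) m \<le> ennreal (\<epsilon> * D)"
    using small by eventually_elim (blast intro: ci)
  from tendsto_sandwich[OF always_eventually this tendsto_const lim0]
  have "((\<lambda>\<epsilon>. coupling_integral g (m_eps \<epsilon>) m) \<longlongrightarrow> 0) (at_right 0)" by simp
  moreover have mbar: "AE x in torus. mbar x = m x"
  proof (rule density_limit_unique[OF wm])
    show "integrable torus m" using s by (simp add: sol_bounds_def)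
    show "integrable torus (m_eps \<epsilon>)" if "0 < \<epsilon>" "\<epsilon> \<le> 1" for \<epsilon> using se[OF that] by (simp add: sol_bounds_def)
    fix \<epsilon> :: real assume \<epsilon>: "0 < \<epsilon>" "\<epsilon> \<le> 1"
    obtain W where W: "integrable torus W"
      "AE x in torus. fin (m x) \<and> fin (m_eps \<epsilon> x) \<and> (gr (m_eps \<epsilon> x) - gr (m x)) * (m_eps \<epsilon> x - m x) \<le> W x"
      "(\<integral>x. W x \<partial>torus) = \<epsilon> * ((\<integral>x. v x * m_eps \<epsilon> x \<partial>torus) - (\<integral>x. ve \<epsilon> x * m x \<partial>torus))"
      using W[OF \<epsilon>] by blast
    have "(\<integral>x. W x \<partial>torus) \<le> \<epsilon> * D" unfolding W(3) using Dle[OF \<epsilon>] \<epsilon> by simp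
    with W(1,2) show "\<exists>W. integrable torus W \<and>
      (AE x in torus. fin (m x) \<and> fin (m_eps \<epsilon> x) \<and> (gr (m_eps \<epsilon> x) - gr (m x)) * (m_eps \<epsilon> x - m x) \<le> W x) \<and>
      (\<integral>x. W x \<partial>torus) \<le> \<epsilon> * D"
      by (intro exI[of _ W] conjI)
  qed
  moreover have "integrable torus (\<lambda>x. mean_free u x * m x)"
    using sol_bounds_pairing(1)[OF s s] by (simp add: v_def)
  moreover have "integrable torus (\<lambda>x. mean_free ubar x * m x)
      \<and> (\<integral>x. mean_free ubar x * m x \<partial>torus) \<le> (\<integral>x. mean_free u x * m x \<partial>torus)"
  proof -
    have wu': "weak_tendsto torus_W12 W12_norm ve ubar (at_right 0)"
      using wu by (simp add: ve_def[abs_def])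
    have li: "integrable torus ubar" "integrable torus mbar"
      using wu wm W12_integrable by (auto simp: weak_tendsto_def torus_L1_def)
    have mL: "Lp (\<alpha> + 1) m" using s by (simp add: sol_bounds_def)
    have bm: "\<forall>\<^sub>F \<epsilon> in at_right 0. Lp (\<alpha> + 1) (m_eps \<epsilon>) \<and> (\<integral>x. \<bar>m_eps \<epsilon> x\<bar> powr (\<alpha> + 1) \<partial>torus) \<le> R"
      using small by eventually_elim (use se in \<open>auto simp: sol_bounds_def\<close>)
    have bv: "\<forall>\<^sub>F \<epsilon> in at_right 0. Lp ((\<alpha> + 1) / \<alpha>) (ve \<epsilon>) \<and> (\<integral>x. \<bar>ve \<epsilon> x\<bar> powr ((\<alpha> + 1) / \<alpha>) \<partial>torus) \<le> 1 + R"
      using small by eventually_elim (use se sol_bounds_Lp in blast)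
    have lm: "((\<lambda>\<epsilon>. \<integral>x. b x * m_eps \<epsilon> x \<partial>torus) \<longlongrightarrow> (\<integral>x. b x * mbar x \<partial>torus)) (at_right 0)"
      and lv: "((\<lambda>\<epsilon>. \<integral>x. b x * ve \<epsilon> x \<partial>torus) \<longlongrightarrow> (\<integral>x. b x * ubar x \<partial>torus)) (at_right 0)"
      if "b \<in> borel_measurable torus" "\<And>x. \<bar>b x\<bar> \<le> B" for b B
      using weak_tendsto_L1_pairing[OF wm that] weak_tendsto_W12_pairing[OF wu' that] .
    \<comment> \<open>The fixed factor v has order (\<alpha>+1)/\<alpha> and the densities are
      bounded in the conjugate order \<alpha>+1. In the pairing of \<open>ve\<close> with m the two
      exponents exchange roles.\<close>
    have L1: "((\<lambda>\<epsilon>. \<integral>x. v x * m_eps \<epsilon> x \<partial>torus) \<longlongrightarrow> (\<integral>x. v x * mbar x \<partial>torus)) (at_right 0)"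
      by (rule weak_pairing_tendsto(2)[OF exponents(1,2,3) sol_bounds_Lp(1)[OF s]
            trivial_limit_at_right_real bm li(2)]) (rule lm)
    have int: "integrable torus (\<lambda>x. m x * ubar x)"
      by (rule weak_pairing_tendsto(1)[OF exponents(2,1,4) mL trivial_limit_at_right_real bv li(1)]) (rule lv)
    have "((\<lambda>\<epsilon>. \<integral>x. m x * ve \<epsilon> x \<partial>torus) \<longlongrightarrow> (\<integral>x. m x * ubar x \<partial>torus)) (at_right 0)"
      by (rule weak_pairing_tendsto(2)[OF exponents(2,1,4) mL trivial_limit_at_right_real bv li(1)]) (rule lv)
    then have L2: "((\<lambda>\<epsilon>. \<integral>x. ve \<epsilon> x * m x \<partial>torus) \<longlongrightarrow> (\<integral>x. ubar x * m x \<partial>torus)) (at_right 0)"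
      by (simp only: mult.commute)
    have "\<forall>\<^sub>F \<epsilon> in at_right 0. (\<integral>x. ve \<epsilon> x * m x \<partial>torus) \<le> (\<integral>x. v x * m_eps \<epsilon> x \<partial>torus)"
      using small by eventually_elim (blast intro: ord)
    then have "(\<integral>x. ubar x * m x \<partial>torus) \<le> (\<integral>x. v x * mbar x \<partial>torus)"
      by (rule tendsto_le[OF trivial_limit_at_right_real L1 L2])
    also have "(\<integral>x. v x * mbar x \<partial>torus) = (\<integral>x. v x * m x \<partial>torus)"
    proof (rule integral_cong_AE)
      show "AE x in torus. v x * mbar x = v x * m x" using mbar by eventually_elim simp
    qed (use LpD(1)[OF sol_bounds_Lp(1)[OF s]] LpD(1)[OF mL] borel_measurable_integrable[OF li(2)] in auto)
    finally have le: "(\<integral>x. ubar x * m x \<partial>torus) \<le> (\<integral>x. v x * m x \<partial>torus)" .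
    \<comment> \<open>Testing with the constant 1 shows that ubar has mean 0, being a weak limit of
      mean-free functions; hence \<open>mean_free ubar\<close> is ubar itself.\<close>
    have "((\<lambda>\<epsilon>. \<integral>x. 1 * ve \<epsilon> x \<partial>torus) \<longlongrightarrow> (\<integral>x. 1 * ubar x \<partial>torus)) (at_right 0)"
      by (rule lv[of "\<lambda>x. 1" 1]) auto
    moreover have "\<forall>\<^sub>F \<epsilon> in at_right 0. (\<integral>x. 1 * ve \<epsilon> x \<partial>torus) = 0"
      using small
    proof eventually_elim
      case (elim \<epsilon>)
      then show ?case using se[of \<epsilon>] by (simp add: sol_bounds_def)
    qed
    then have "((\<lambda>\<epsilon>. \<integral>x. 1 * ve \<epsilon> x \<partial>torus) \<longlongrightarrow> 0) (at_right 0)" by (rule tendsto_eventually)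
    ultimately have "(\<integral>x. 1 * ubar x \<partial>torus) = 0"
      by (rule tendsto_unique[OF trivial_limit_at_right_real])
    then have "mean_free ubar = ubar" by (simp add: mean_free_def[abs_def])
    then show ?thesis using int le by (simp add: v_def mult.commute)
  qed
  ultimately show ?thesis by blast
qed

end
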